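(* Let $A\to B$ be a finite extension of domains and assume $A$ is a noetherian ring. If $A$ is $s_c$-normal in $B$, then there is a finite sequence $(B_i)_{i=0,\ldots,n}$ of real domains such that: 1) $A=B_n\subset\cdots\subset B_1\subset B_0=B$. 2) $B_1$ is the birational gluing of $B$ over $A$. 3) For $i\geq 1$, $B_{i+1}$ is the central gluing of $B_i$ over a central prime ideal of $A$.
   Context: All rings are commutative and contain $\mathbb{Q}$; an extension is an injective ring homomorphism; it is finite if $B$ is a finitely generated $A$-module. For a domain $A$, $\mathcal{K}(A)$ is its fraction field and $\sum\mathcal{K}(A)^2$ the set of finite sums of squares in $\mathcal{K}(A)$. $A$ is a real domain if $-1\notin\sum\mathcal{K}(A)^2$. An ideal $I\subset A$ is central if for all $a\in A$, $b\in\sum\mathcal{K}(A)^2$, $a^2+b\in I$ implies $a\in I$. $\text{C-Spec}\,A$ is the set of central prime ideals of $A$; contraction gives a well-defined map $\text{C-Spec}\,B\to\text{C-Spec}\,A$ for an extension of domains $A\to B$. For a prime ideal $\mathfrak p$, $k(\mathfrak p)$ denotes the residue field at $\mathfrak p$. An extension of domains $A\to B$ is $s_c$-subintegral (centrally subintegral) if it is integral and $\text{C-Spec}\,B\to\text{C-Spec}\,A$ is bijective and equiresidual, i.e. $k(\mathfrak q\cap A)\to k(\mathfrak q)$ is an isomorphism for every $\mathfrak q\in\text{C-Spec}\,B$. $A$ is $s_c$-normal (centrally seminormal) in $B$ if there is no intermediate domain $A\subsetneq C\subset B$ with $A\to C$ $s_c$-subintegral. The birational gluing (also called birational closure) of $B$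 over $A$ is $\widetilde{A}_B=B\times_{\mathcal{K}(B)}\mathcal{K}(A)$, i.e. $B\cap\mathcal{K}(A)$ inside $\mathcal{K}(B)$. For a finite extension of domains $A\to C$ with $A$ a real domain and $\mathfrak p\in\text{C-Spec}\,A$, let $\mathfrak q_1,\ldots,\mathfrak q_t$ be the central prime ideals of $C$ lying over $\mathfrak p$. The (elementary) central gluing of $C$ over $\mathfrak p$ is $A^{s_c,\mathfrak p}_C=C\times_Q k(\mathfrak p)$ with $Q=\prod_{i=1}^t k(\mathfrak q_i)$, i.e. the set of $c\in C$ for which there is an element of $k(\mathfrak p)$ whose image in $k(\mathfrak q_i)$ equals the class of $c$ for every $i=1,\ldots,t$; if $t=0$ one sets $A^{s_c,\mathfrak p}_C=C$.
   Formalization: As printed, the claim that all B_i are real fails (A = ℝ, B = ℂ: B_0 = ℂ is not real); proved instead: 1)–3) hold for domains B_i, all B_i are real if B is real, and B_i is real for i ≥ 1 if A is real. *)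

theory Defs
  imports "HOL-Algebra.Algebra"
begin

section \<open>Fraction fields and residue fields\<close>

definition frac_pairs :: "('a, 'm) ring_scheme \<Rightarrow> ('a \<times> 'a) set" where
  "frac_pairs R = carrier R \<times> (carrier R - {\<zero>\<^bsub>R\<^esub>})"

definition frac_rel :: "('a, 'm) ring_scheme \<Rightarrow> (('a \<times> 'a) \<times> ('a \<times> 'a)) set" where
  "frac_rel R = {((a, s), (b, t)).
     (a, s) \<in> frac_pairs R \<and> (b, t) \<in> frac_pairs R \<and> a \<otimes>\<^bsub>R\<^esub> t = b \<otimes>\<^bsub>R\<^esub> s}"

definition fraction :: "('a, 'm) ring_scheme \<Rightarrow> 'a \<Rightarrow> 'a \<Rightarrow> ('a \<times> 'a) set" where
  "fraction R a s = frac_rel R `` {(a, s)}"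

definition frac_field :: "('a, 'm) ring_scheme \<Rightarrow> ('a \<times> 'a) set ring" where
  "frac_field R =
     \<lparr>carrier = frac_pairs R // frac_rel R,
      monoid.mult = (\<lambda>U V. \<Union>(a, s)\<in>U. \<Union>(b, t)\<in>V. fraction R (a \<otimes>\<^bsub>R\<^esub> b) (s \<otimes>\<^bsub>R\<^esub> t)),
      monoid.one = fraction R \<one>\<^bsub>R\<^esub> \<one>\<^bsub>R\<^esub>,
      ring.zero = fraction R \<zero>\<^bsub>R\<^esub> \<one>\<^bsub>R\<^esub>,
      ring.add = (\<lambda>U V. \<Union>(a, s)\<in>U. \<Union>(b, t)\<in>V.
               fraction R ((a \<otimes>\<^bsub>R\<^esub> t) \<oplus>\<^bsub>R\<^esub> (b \<otimes>\<^bsub>R\<^esub> s)) (s \<otimes>\<^bsub>R\<^esub> t))\<rparr>"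

definition frac_emb :: "('a, 'm) ring_scheme \<Rightarrow> 'a \<Rightarrow> ('a \<times> 'a) set" where
  "frac_emb R a = fraction R a \<one>\<^bsub>R\<^esub>"

text \<open>The map of fraction fields induced by an injective homomorphism \<open>h\<close> of domains into \<open>S\<close>;
  the classes in the union all coincide, see \<open>frac_map_frac\<close> below.\<close>

definition frac_map :: "('b, 'n) ring_scheme \<Rightarrow> ('a \<Rightarrow> 'b) \<Rightarrow> ('a \<times> 'a) set \<Rightarrow> ('b \<times> 'b) set" where
  "frac_map S h U = (\<Union>(a, s)\<in>U. fraction S (h a) (h s))"

definition quot_map :: "('b, 'n) ring_scheme \<Rightarrow> 'b set \<Rightarrow> ('a \<Rightarrow> 'b) \<Rightarrow> 'a set \<Rightarrow> 'b set" where
  "quot_map S q h U = (\<Union>x\<in>U. q +>\<^bsub>S\<^esub> h x)"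

definition residue_field :: "('a, 'm) ring_scheme \<Rightarrow> 'a set \<Rightarrow> ('a set \<times> 'a set) set ring" where
  "residue_field R p = frac_field (R Quot p)"

definition residue_class :: "('a, 'm) ring_scheme \<Rightarrow> 'a set \<Rightarrow> 'a \<Rightarrow> ('a set \<times> 'a set) set" where
  "residue_class R p a = frac_emb (R Quot p) (p +>\<^bsub>R\<^esub> a)"

text \<open>The homomorphism from the residue field at the contraction of \<open>q\<close> along \<open>h\<close> to the residue
  field of \<open>S\<close> at \<open>q\<close>.\<close>

definition residue_map ::
  "('b, 'n) ring_scheme \<Rightarrow> 'b set \<Rightarrow> ('a \<Rightarrow> 'b) \<Rightarrow> ('a set \<times> 'a set) set \<Rightarrow> ('b set \<times> 'b set) set" where
  "residue_map S q h = frac_map (S Quot q) (quot_map S q h)"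


section \<open>Central prime ideals\<close>

definition sums_of_squares :: "('a, 'm) ring_scheme \<Rightarrow> 'a set" where
  "sums_of_squares K =
     {\<Oplus>\<^bsub>K\<^esub>i\<in>{..<n}. y i [^]\<^bsub>K\<^esub> (2::nat) | (n::nat) y. y \<in> {..<n} \<rightarrow> carrier K}"

definition real_domain :: "('a, 'm) ring_scheme \<Rightarrow> bool" where
  "real_domain R \<longleftrightarrow>
     domain R \<and> \<ominus>\<^bsub>frac_field R\<^esub> \<one>\<^bsub>frac_field R\<^esub> \<notin> sums_of_squares (frac_field R)"

definition central_ideal :: "'a set \<Rightarrow> ('a, 'm) ring_scheme \<Rightarrow> bool" where
  "central_ideal I R \<longleftrightarrow>
     ideal I R \<and>
     (\<forall>a \<in> carrier R. \<forall>b \<in> sums_of_squares (frac_field R).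
        frac_emb R a [^]\<^bsub>frac_field R\<^esub> (2::nat) \<oplus>\<^bsub>frac_field R\<^esub> b \<in> frac_emb R ` I \<longrightarrow> a \<in> I)"

definition C_Spec :: "('a, 'm) ring_scheme \<Rightarrow> 'a set set" where
  "C_Spec R = {p. primeideal p R \<and> central_ideal p R}"

definition contraction :: "('a, 'm) ring_scheme \<Rightarrow> ('a \<Rightarrow> 'b) \<Rightarrow> 'b set \<Rightarrow> 'a set" where
  "contraction R h q = {a \<in> carrier R. h a \<in> q}"


section \<open>Extensions of domains\<close>

text \<open>Throughout, \<open>f\<close> is an extension \<open>A \<rightarrow> B\<close>. A domain \<open>C\<close> between \<open>A\<close> and \<open>B\<close> is represented by its
  underlying set, a subring of \<open>B\<close> containing \<open>f ` carrier A\<close>; as a ring it is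
  \<open>B\<lparr>carrier := C\<rparr>\<close>, and the structure map \<open>A \<rightarrow> C\<close> is again \<open>f\<close>.\<close>

definition rat_ring :: "rat ring" where
  "rat_ring = \<lparr>carrier = UNIV, monoid.mult = (*), monoid.one = 1, ring.zero = 0, ring.add = (+)\<rparr>"

definition contains_rat :: "('a, 'm) ring_scheme \<Rightarrow> bool" where
  "contains_rat R \<longleftrightarrow> (\<exists>h \<in> ring_hom rat_ring R. inj h)"

definition domain_extension ::
  "('a, 'm) ring_scheme \<Rightarrow> ('b, 'n) ring_scheme \<Rightarrow> ('a \<Rightarrow> 'b) \<Rightarrow> bool" where
  "domain_extension A B f \<longleftrightarrow>
     domain A \<and> domain B \<and> f \<in> ring_hom A B \<and> inj_on f (carrier A)"

definition finite_extension ::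
  "('a, 'm) ring_scheme \<Rightarrow> ('b, 'n) ring_scheme \<Rightarrow> ('a \<Rightarrow> 'b) \<Rightarrow> bool" where
  "finite_extension A B f \<longleftrightarrow>
     domain_extension A B f \<and>
     (\<exists>G. finite G \<and> G \<subseteq> carrier B \<and>
        (\<forall>b \<in> carrier B. \<exists>c \<in> G \<rightarrow> carrier A. b = (\<Oplus>\<^bsub>B\<^esub>g\<in>G. f (c g) \<otimes>\<^bsub>B\<^esub> g)))"

definition integral_extension ::
  "('a, 'm) ring_scheme \<Rightarrow> ('b, 'n) ring_scheme \<Rightarrow> ('a \<Rightarrow> 'b) \<Rightarrow> bool" where
  "integral_extension A B f \<longleftrightarrow>
     domain_extension A B f \<and>
     (\<forall>b \<in> carrier B. \<exists>P \<in> carrier (univ_poly B (f ` carrier A)).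
        P \<noteq> [] \<and> lead_coeff P = \<one>\<^bsub>B\<^esub> \<and> ring.eval B P b = \<zero>\<^bsub>B\<^esub>)"

definition sc_subintegral ::
  "('a, 'm) ring_scheme \<Rightarrow> ('b, 'n) ring_scheme \<Rightarrow> ('a \<Rightarrow> 'b) \<Rightarrow> bool" where
  "sc_subintegral A B f \<longleftrightarrow>
     integral_extension A B f \<and>
     bij_betw (contraction A f) (C_Spec B) (C_Spec A) \<and>
     (\<forall>q \<in> C_Spec B.
        residue_map B q f \<in> ring_iso (residue_field A (contraction A f q)) (residue_field B q))"

definition sc_normal ::
  "('a, 'm) ring_scheme \<Rightarrow> ('b, 'n) ring_scheme \<Rightarrow> ('a \<Rightarrow> 'b) \<Rightarrow> bool" where
  "sc_normal A B f \<longleftrightarrow>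
     \<not> (\<exists>C. subdomain C B \<and> f ` carrier A \<subset> C \<and> sc_subintegral A (B\<lparr>carrier := C\<rparr>) f)"


section \<open>Gluings\<close>

definition birational_gluing ::
  "('a, 'm) ring_scheme \<Rightarrow> ('b, 'n) ring_scheme \<Rightarrow> ('a \<Rightarrow> 'b) \<Rightarrow> 'b set" where
  "birational_gluing A B f =
     {b \<in> carrier B. frac_emb B b \<in> frac_map B f ` carrier (frac_field A)}"

text \<open>If no central prime ideal of \<open>C\<close> lies over \<open>p\<close>, the condition is vacuous and the gluing is \<open>C\<close>.\<close>

definition central_gluing ::
  "('a, 'm) ring_scheme \<Rightarrow> ('b, 'n) ring_scheme \<Rightarrow> ('a \<Rightarrow> 'b) \<Rightarrow> 'a set \<Rightarrow> 'b set" where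
  "central_gluing A C f p =
     {c \<in> carrier C. \<exists>\<xi> \<in> carrier (residue_field A p). \<forall>q \<in> C_Spec C.
        contraction A f q = p \<longrightarrow> residue_map C q f \<xi> = residue_class C q c}"


section \<open>Well-definedness\<close>

lemma (in domain) frac_pairs_mult:
  assumes "(a, s) \<in> frac_pairs R" "(b, t) \<in> frac_pairs R"
  shows "(x, s \<otimes> t) \<in> frac_pairs R \<longleftrightarrow> x \<in> carrier R"
  using assms integral by (auto simp: frac_pairs_def)

lemma (in domain) equiv_frac_rel: "equiv (frac_pairs R) (frac_rel R)"
proof (rule equivI)
  show "trans (frac_rel R)"
  proof (rule transI)
    fix x y z assume xy: "(x, y) \<in> frac_rel R" and yz: "(y, z) \<in> frac_rel R"
    obtain a s b t c u where [simp]: "x = (a, s)" "y = (b, t)" "z = (c, u)"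
      by (metis surj_pair)
    have carr: "a \<in> carrier R" "b \<in> carrier R" "c \<in> carrier R" "s \<in> carrier R" "t \<in> carrier R"
      "u \<in> carrier R" "t \<noteq> \<zero>" and e: "a \<otimes> t = b \<otimes> s" "b \<otimes> u = c \<otimes> t"
      using xy yz by (auto simp: frac_rel_def frac_pairs_def)
    have "t \<otimes> (a \<otimes> u) = (a \<otimes> t) \<otimes> u" using carr by (simp add: m_ac)
    also have "\<dots> = (b \<otimes> u) \<otimes> s" using carr by (simp add: e(1) m_ac)
    also have "\<dots> = t \<otimes> (c \<otimes> s)" using carr by (simp add: e(2) m_ac)
    finally have "a \<otimes> u = c \<otimes> s" using carr m_lcancel by simp
    then show "(x, z) \<in> frac_rel R" using xy yz by (auto simp: frac_rel_def)
  qed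
qed (auto simp: refl_on_def sym_def frac_rel_def)

lemma (in domain) frac_eq_iff:
  assumes "(a, s) \<in> frac_pairs R" "(b, t) \<in> frac_pairs R"
  shows "fraction R a s = fraction R b t \<longleftrightarrow> a \<otimes> t = b \<otimes> s"
  using eq_equiv_class_iff[OF equiv_frac_rel assms] assms
  by (simp add: fraction_def frac_rel_def)

lemma (in domain) carrier_frac_field:
  "carrier (frac_field R) = {fraction R a s | a s. (a, s) \<in> frac_pairs R}"
  by (auto simp: frac_field_def quotient_def fraction_def)

lemma (in domain) frac_self: "(a, s) \<in> frac_pairs R \<Longrightarrow> (a, s) \<in> fraction R a s"
  by (auto simp: fraction_def frac_rel_def)

lemma UN_const:
  assumes "p \<in> U" and "\<And>a s. (a, s) \<in> U \<Longrightarrow> g a s = Z"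
  shows "(\<Union>(a, s)\<in>U. g a s) = Z"
proof -
  have "(\<Union>(a, s)\<in>U. g a s) = (\<Union>x\<in>U. Z)"
    using assms(2) by (intro SUP_cong refl) (auto split: prod.splits)
  then show ?thesis using assms(1) by auto
qed

lemma UN_UN_const:
  assumes "p \<in> U" "q \<in> V"
    and "\<And>a s b t. \<lbrakk>(a, s) \<in> U; (b, t) \<in> V\<rbrakk> \<Longrightarrow> g a s b t = Z"
  shows "(\<Union>(a, s)\<in>U. \<Union>(b, t)\<in>V. g a s b t) = Z"
proof -
  have "(\<Union>(a, s)\<in>U. \<Union>(b, t)\<in>V. g a s b t) = (\<Union>x\<in>U. \<Union>y\<in>V. Z)"
    using assms(3) by (intro SUP_cong refl) (auto split: prod.splits)
  then show ?thesis using assms(1,2) by auto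
qed

lemma (in domain) mult_frac_field:
  assumes "(a, s) \<in> frac_pairs R" "(b, t) \<in> frac_pairs R"
  shows "fraction R a s \<otimes>\<^bsub>frac_field R\<^esub> fraction R b t = fraction R (a \<otimes> b) (s \<otimes> t)"
proof -
  have "fraction R (a' \<otimes> b') (s' \<otimes> t') = fraction R (a \<otimes> b) (s \<otimes> t)"
    if "(a', s') \<in> fraction R a s" "(b', t') \<in> fraction R b t" for a' s' b' t'
  proof -
    have p: "(a', s') \<in> frac_pairs R" "(b', t') \<in> frac_pairs R"
      and e: "a \<otimes> s' = a' \<otimes> s" "b \<otimes> t' = b' \<otimes> t"
      using that by (auto simp: fraction_def frac_rel_def)
    have carr: "{a, b, s, t, a', b', s', t'} \<subseteq> carrier R"
      using assms p by (auto simp: frac_pairs_def)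
    have "(a' \<otimes> b') \<otimes> (s \<otimes> t) = (a' \<otimes> s) \<otimes> (b' \<otimes> t)" using carr by (simp add: m_ac)
    also have "\<dots> = (a \<otimes> s') \<otimes> (b \<otimes> t')" by (simp add: e)
    also have "\<dots> = (a \<otimes> b) \<otimes> (s' \<otimes> t')" using carr by (simp add: m_ac)
    finally show ?thesis
      using frac_eq_iff frac_pairs_mult[OF p] frac_pairs_mult[OF assms] carr by simp
  qed
  then show ?thesis
    unfolding frac_field_def monoid.simps ring.simps
    by (intro UN_UN_const[OF frac_self[OF assms(1)] frac_self[OF assms(2)]])
qed

lemma (in domain) add_frac_field:
  assumes "(a, s) \<in> frac_pairs R" "(b, t) \<in> frac_pairs R"
  shows "fraction R a s \<oplus>\<^bsub>frac_field R\<^esub> fraction R b t = fraction R (a \<otimes> t \<oplus> b \<otimes> s) (s \<otimes> t)"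
proof -
  have "fraction R (a' \<otimes> t' \<oplus> b' \<otimes> s') (s' \<otimes> t') = fraction R (a \<otimes> t \<oplus> b \<otimes> s) (s \<otimes> t)"
    if "(a', s') \<in> fraction R a s" "(b', t') \<in> fraction R b t" for a' s' b' t'
  proof -
    have p: "(a', s') \<in> frac_pairs R" "(b', t') \<in> frac_pairs R"
      and e: "a \<otimes> s' = a' \<otimes> s" "b \<otimes> t' = b' \<otimes> t"
      using that by (auto simp: fraction_def frac_rel_def)
    have carr: "{a, b, s, t, a', b', s', t'} \<subseteq> carrier R"
      using assms p by (auto simp: frac_pairs_def)
    have "(a' \<otimes> t' \<oplus> b' \<otimes> s') \<otimes> (s \<otimes> t)
        = (a' \<otimes> s) \<otimes> (t \<otimes> t') \<oplus> (b' \<otimes> t) \<otimes> (s \<otimes> s')"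
      using carr by (simp add: l_distr r_distr m_ac)
    also have "\<dots> = (a \<otimes> s') \<otimes> (t \<otimes> t') \<oplus> (b \<otimes> t') \<otimes> (s \<otimes> s')" by (simp add: e)
    also have "\<dots> = (a \<otimes> t \<oplus> b \<otimes> s) \<otimes> (s' \<otimes> t')" using carr by (simp add: l_distr r_distr m_ac)
    finally show ?thesis
      using frac_eq_iff frac_pairs_mult[OF p] frac_pairs_mult[OF assms] carr by simp
  qed
  then show ?thesis
    unfolding frac_field_def monoid.simps ring.simps
    by (intro UN_UN_const[OF frac_self[OF assms(1)] frac_self[OF assms(2)]])
qed

lemma (in domain) frac_field_is_field: "field (frac_field R)"
proof -
  let ?K = "frac_field R"
  have pI: "(a, s) \<in> frac_pairs R" if "a \<in> carrier R" "s \<in> carrier R" "s \<noteq> \<zero>" for a s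
    using that by (simp add: frac_pairs_def)
  have one: "\<one>\<^bsub>?K\<^esub> = fraction R \<one> \<one>" and zero: "\<zero>\<^bsub>?K\<^esub> = fraction R \<zero> \<one>"
    by (simp_all add: frac_field_def)
  have elim: "\<exists>a s. x = fraction R a s \<and> a \<in> carrier R \<and> s \<in> carrier R \<and> s \<noteq> \<zero>" if "x \<in> carrier ?K" for x
    using that by (auto simp: carrier_frac_field frac_pairs_def)
  have K: "fraction R a s \<in> carrier ?K" if "a \<in> carrier R" "s \<in> carrier R" "s \<noteq> \<zero>" for a s
    using that pI by (auto simp: carrier_frac_field)
  have nz: "s \<otimes> t \<noteq> \<zero>" if "s \<in> carrier R" "s \<noteq> \<zero>" "t \<in> carrier R" "t \<noteq> \<zero>" for s t
    using that integral by blast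
  note S = pI K nz one zero mult_frac_field add_frac_field frac_eq_iff
  have ag: "abelian_group ?K"
  proof (rule abelian_groupI)
    fix x y assume "x \<in> carrier ?K" "y \<in> carrier ?K"
    then show "x \<oplus>\<^bsub>?K\<^esub> y \<in> carrier ?K" by (auto dest!: elim simp: S)
  next
    show "\<zero>\<^bsub>?K\<^esub> \<in> carrier ?K" by (simp add: S)
  next
    fix x y z assume "x \<in> carrier ?K" "y \<in> carrier ?K" "z \<in> carrier ?K"
    then show "x \<oplus>\<^bsub>?K\<^esub> y \<oplus>\<^bsub>?K\<^esub> z = x \<oplus>\<^bsub>?K\<^esub> (y \<oplus>\<^bsub>?K\<^esub> z)"
      by (auto dest!: elim simp: S l_distr r_distr m_ac a_ac)
  next
    fix x y assume "x \<in> carrier ?K" "y \<in> carrier ?K"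
    then show "x \<oplus>\<^bsub>?K\<^esub> y = y \<oplus>\<^bsub>?K\<^esub> x"
      by (auto dest!: elim simp: S l_distr r_distr m_ac a_ac)
  next
    fix x assume "x \<in> carrier ?K"
    then show "\<zero>\<^bsub>?K\<^esub> \<oplus>\<^bsub>?K\<^esub> x = x" by (auto dest!: elim simp: S)
  next
    fix x assume "x \<in> carrier ?K"
    then obtain a s where a: "x = fraction R a s" "a \<in> carrier R" "s \<in> carrier R" "s \<noteq> \<zero>"
      using elim by blast
    then have "fraction R (\<ominus> a) s \<oplus>\<^bsub>?K\<^esub> x = \<zero>\<^bsub>?K\<^esub>"
      by (simp add: S l_distr[symmetric] l_neg)
    then show "\<exists>y\<in>carrier ?K. y \<oplus>\<^bsub>?K\<^esub> x = \<zero>\<^bsub>?K\<^esub>"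
      using K[of "\<ominus> a" s] a by auto
  qed
  have cm: "Group.comm_monoid ?K"
    by (rule Group.comm_monoidI) (auto dest!: elim simp: S m_ac)
  have cr: "cring ?K"
  proof (rule cringI[OF ag cm])
    fix x y z assume "x \<in> carrier ?K" "y \<in> carrier ?K" "z \<in> carrier ?K"
    note xyz = this
    obtain a s where x: "x = fraction R a s" "a \<in> carrier R" "s \<in> carrier R" "s \<noteq> \<zero>"
      using elim[OF xyz(1)] by blast
    obtain b t where y: "y = fraction R b t" "b \<in> carrier R" "t \<in> carrier R" "t \<noteq> \<zero>"
      using elim[OF xyz(2)] by blast
    obtain c u where z: "z = fraction R c u" "c \<in> carrier R" "u \<in> carrier R" "u \<noteq> \<zero>"
      using elim[OF xyz(3)] by blast
    show "(x \<oplus>\<^bsub>?K\<^esub> y) \<otimes>\<^bsub>?K\<^esub> z = x \<otimes>\<^bsub>?K\<^esub> z \<oplus>\<^bsub>?K\<^esub> y \<otimes>\<^bsub>?K\<^esub> z"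
      using x y z by (simp add: S l_distr r_distr m_ac)
  qed
  show ?thesis
  proof (rule cring.cring_fieldI2[OF cr])
    show "\<zero>\<^bsub>?K\<^esub> \<noteq> \<one>\<^bsub>?K\<^esub>" by (simp add: S)
    fix x assume "x \<in> carrier ?K" "x \<noteq> \<zero>\<^bsub>?K\<^esub>"
    obtain a s where a: "x = fraction R a s" "a \<in> carrier R" "s \<in> carrier R" "s \<noteq> \<zero>"
      using elim[OF \<open>x \<in> carrier ?K\<close>] by blast
    have "a \<noteq> \<zero>"
    proof
      assume "a = \<zero>"
      then have "x = \<zero>\<^bsub>?K\<^esub>" using a by (simp add: S)
      then show False using \<open>x \<noteq> \<zero>\<^bsub>?K\<^esub>\<close> by simp
    qed
    note a = a this
    from a have "x \<otimes>\<^bsub>?K\<^esub> fraction R s a = \<one>\<^bsub>?K\<^esub>" by (simp add: S m_ac)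
    then show "\<exists>y\<in>carrier ?K. x \<otimes>\<^bsub>?K\<^esub> y = \<one>\<^bsub>?K\<^esub>"
      using K[of s a] a by auto
  qed
qed

lemma frac_map_frac:
  assumes "domain_extension R S h" "(a, s) \<in> frac_pairs R"
  shows "frac_map S h (fraction R a s) = fraction S (h a) (h s)" "(h a, h s) \<in> frac_pairs S"
proof -
  interpret R: "domain" R using assms(1) by (simp add: domain_extension_def)
  interpret S: "domain" S using assms(1) by (simp add: domain_extension_def)
  have hom: "h \<in> ring_hom R S" and inj: "inj_on h (carrier R)"
    using assms(1) by (auto simp: domain_extension_def)
  have hz: "h \<zero>\<^bsub>R\<^esub> = \<zero>\<^bsub>S\<^esub>" using ring_hom_zero[OF hom R.ring_axioms S.ring_axioms] .
  have P: "(h b, h t) \<in> frac_pairs S" if "(b, t) \<in> frac_pairs R" for b t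
    using that ring_hom_closed[OF hom] inj_onD[OF inj, of t "\<zero>\<^bsub>R\<^esub>"] hz
    by (auto simp: frac_pairs_def)
  show "(h a, h s) \<in> frac_pairs S" using P assms(2) .
  have "fraction S (h b) (h t) = fraction S (h a) (h s)" if "(b, t) \<in> fraction R a s" for b t
  proof -
    have p: "(b, t) \<in> frac_pairs R" and e: "a \<otimes>\<^bsub>R\<^esub> t = b \<otimes>\<^bsub>R\<^esub> s"
      using that by (auto simp: fraction_def frac_rel_def)
    have "h b \<otimes>\<^bsub>S\<^esub> h s = h a \<otimes>\<^bsub>S\<^esub> h t"
      using p assms(2) e ring_hom_mult[OF hom] by (metis SigmaE2 DiffD1 frac_pairs_def)
    then show ?thesis using S.frac_eq_iff P p assms(2) by simp
  qed
  then show "frac_map S h (fraction R a s) = fraction S (h a) (h s)"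
    unfolding frac_map_def by (intro UN_const[OF R.frac_self[OF assms(2)]])
qed

lemma quot_map_coset:
  assumes "ring R" "ideal q S" "h \<in> ring_hom R S" "a \<in> carrier R"
  shows "quot_map S q h (contraction R h q +>\<^bsub>R\<^esub> a) = q +>\<^bsub>S\<^esub> h a"
proof -
  interpret R: ring R by fact
  interpret q: ideal q S by fact
  have hz: "h \<zero>\<^bsub>R\<^esub> = \<zero>\<^bsub>S\<^esub>" using ring_hom_zero[OF assms(3) R.ring_axioms q.ring_axioms] .
  have const: "q +>\<^bsub>S\<^esub> h x = q +>\<^bsub>S\<^esub> h a" if x: "x \<in> contraction R h q +>\<^bsub>R\<^esub> a" for x
  proof -
    obtain i where i: "i \<in> carrier R" "h i \<in> q" "x = i \<oplus>\<^bsub>R\<^esub> a"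
      using x unfolding a_r_coset_def' contraction_def by blast
    then have "h x = h i \<oplus>\<^bsub>S\<^esub> h a" using ring_hom_add[OF assms(3)] assms(4) by simp
    then have "h x \<in> q +>\<^bsub>S\<^esub> h a" using i(2) unfolding a_r_coset_def' by blast
    from q.a_repr_independence'[OF this ring_hom_closed[OF assms(3,4)]] show ?thesis by (rule sym)
  qed
  have a: "a \<in> contraction R h q +>\<^bsub>R\<^esub> a"
  proof -
    have "\<zero>\<^bsub>R\<^esub> \<in> contraction R h q" by (simp add: contraction_def hz)
    moreover have "a = \<zero>\<^bsub>R\<^esub> \<oplus>\<^bsub>R\<^esub> a" using assms(4) by simp
    ultimately show ?thesis unfolding a_r_coset_def' by blast
  qed
  have "quot_map S q h (contraction R h q +>\<^bsub>R\<^esub> a)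
      = (\<Union>x \<in> contraction R h q +>\<^bsub>R\<^esub> a. q +>\<^bsub>S\<^esub> h a)"
    unfolding quot_map_def by (intro SUP_cong refl const)
  then show ?thesis using a by (metis UN_constant empty_iff)
qed

end

theory Submission
  imports Defs
begin

text \<open>
  Let \<open>C\<close> be an intermediate domain between \<open>A\<close> and the birational gluing, with conductor
  \<open>I = (A : C)\<close>, and let \<open>J\<close> be the intersection of the central primes of \<open>C\<close> containing \<open>I\<close>.
  The extension \<open>A \<rightarrow> A + J\<close> is centrally subintegral: over a central prime containing \<open>I\<close> the
  only central prime of \<open>A + J\<close> is \<open>p + J\<close>, and away from \<open>I\<close> nothing changes. Hence central
  seminormality gives \<open>J \<subseteq> A\<close>, that is, \<open>I = J\<close>. If \<open>C \<noteq> A\<close>, pick \<open>u \<in> A - I\<close> with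
  \<open>p = (I : u)\<close> maximal; then \<open>p\<close> is a central prime of \<open>A\<close> and minimal over \<open>I\<close>. An element
  \<open>c\<close> of the central gluing \<open>C'\<close> of \<open>C\<close> over \<open>p\<close> satisfies \<open>s c - a \<in> q\<close> for all central \<open>q\<close>
  over \<open>p\<close>, and minimality of \<open>p\<close> together with \<open>I = J\<close> gives \<open>v (s c - a) \<in> I\<close> for some
  \<open>v \<in> A - p\<close>. As \<open>C'\<close> is a finite \<open>A\<close>-module, some \<open>w \<in> A - p\<close> satisfies \<open>w C' \<subseteq> A\<close>, so
  the conductor of \<open>C'\<close> is strictly larger than \<open>I\<close>. Since \<open>A\<close> is noetherian, iterated gluing
  reaches \<open>A\<close>.

  Central lying over for integral birational extensions needs no real spectrum: integral elements
  have squares bounded by elements of \<open>A\<close> with respect to the sums of squares of \<open>\<K>(A)\<close>, and an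
  ideal maximal among those avoiding \<open>{s\<^sup>2 + t}\<close>, with \<open>s\<close> in a multiplicative set and \<open>t\<close> a sum
  of squares, is a central prime.
\<close>

section \<open>Submodules over a subring\<close>

text \<open>Every ring between \<open>A\<close> and the birational gluing has fraction field K(A),
  so centrality is tested against one fixed cone of sums of squares. After clearing square
  denominators no fraction field is left, and residue fields enter only through congruences
  \<open>s c - a \<in> q\<close>. The central gluings start at the birational gluing because K(B)
  may contain more sums of squares.

  As \<open>J\<close> is an ideal of \<open>C\<close>, the inclusion \<open>J \<subseteq> A\<close>
  puts it into the conductor, and \<open>I = J\<close> makes \<open>I\<close> an intersection of
  central primes. Hence \<open>(I : u)\<close> inherits centrality. The effective form of minimality
  is \<open>p u \<subseteq> I\<close> with \<open>u \<notin> p\<close>: a central prime over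
  \<open>I\<close> that misses \<open>u\<close> contains \<open>p\<close>.

  If -1 is a sum of squares in K(A), there are no central primes; then \<open>J = C\<close>, central
  seminormality forces \<open>C = A\<close>, and there is nothing to glue.

  Noetherianity enters four times: monic equations for elements of \<open>B\<close>, maximal
  annihilators, common multipliers for finitely generated modules, and termination via
  conductors.\<close>

text \<open>An ideal of a subring \<open>C\<close> of \<open>R\<close> is an \<open>N \<subseteq> C\<close> with \<open>is_submodule R C N\<close>.\<close>

definition is_submodule :: "('b, 'n) ring_scheme \<Rightarrow> 'b set \<Rightarrow> 'b set \<Rightarrow> bool" where
  "is_submodule R A N \<longleftrightarrow> N \<subseteq> carrier R \<and> \<zero>\<^bsub>R\<^esub> \<in> N \<and>
     (\<forall>x\<in>N. \<forall>y\<in>N. x \<oplus>\<^bsub>R\<^esub> y \<in> N) \<and> (\<forall>a\<in>A. \<forall>x\<in>N. a \<otimes>\<^bsub>R\<^esub> x \<in> N)"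

text \<open>Generation is phrased by minimality: every submodule containing \<open>Z\<close>
  contains \<open>N\<close>. Linear combinations never have to be written out, and the condition
  combines directly with Zorn arguments.\<close>

definition fin_generated :: "('b, 'n) ring_scheme \<Rightarrow> 'b set \<Rightarrow> 'b set \<Rightarrow> bool" where
  "fin_generated R A N \<longleftrightarrow>
     (\<exists>Z. finite Z \<and> Z \<subseteq> N \<and> (\<forall>M. is_submodule R A M \<longrightarrow> Z \<subseteq> M \<longrightarrow> N \<subseteq> M))"

text \<open>The \<open>A\<close>-span of \<open>1, x, ..., x^(k-1)\<close>, with \<open>x^k\<close>
  excluded: membership of \<open>x^k\<close> in \<open>power_span R A x k\<close> is a monic
  equation of degree \<open>k\<close> for \<open>x\<close>.\<close>

primrec power_span :: "('b, 'n) ring_scheme \<Rightarrow> 'b set \<Rightarrow> 'b \<Rightarrow> nat \<Rightarrow> 'b set" where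
  "power_span R A x 0 = {\<zero>\<^bsub>R\<^esub>}"
| "power_span R A x (Suc k) = {v \<oplus>\<^bsub>R\<^esub> a \<otimes>\<^bsub>R\<^esub> x [^]\<^bsub>R\<^esub> k | v a. v \<in> power_span R A x k \<and> a \<in> A}"

lemma is_submoduleD:
  assumes "is_submodule R A N"
  shows "x \<in> N \<Longrightarrow> x \<in> carrier R" "\<zero>\<^bsub>R\<^esub> \<in> N" "x \<in> N \<Longrightarrow> y \<in> N \<Longrightarrow> x \<oplus>\<^bsub>R\<^esub> y \<in> N"
    "a \<in> A \<Longrightarrow> x \<in> N \<Longrightarrow> a \<otimes>\<^bsub>R\<^esub> x \<in> N"
  using assms by (auto simp: is_submodule_def)

lemma (in cring) submodule_uminus:
  assumes "subring A R" "is_submodule R A N" "x \<in> N"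
  shows "\<ominus> x \<in> N"
proof -
  have "(\<ominus> \<one>) \<otimes> x \<in> N"
    using subringE(3,5)[OF assms(1)] is_submoduleD(4)[OF assms(2)] assms(3) by blast
  then show ?thesis using is_submoduleD(1)[OF assms(2,3)] by (simp add: l_minus)
qed

lemma (in cring) submodule_minus:
  assumes "subring A R" "is_submodule R A N" "x \<in> N" "y \<in> N"
  shows "x \<ominus> y \<in> N"
  using submodule_uminus[OF assms(1,2,4)] is_submoduleD(3)[OF assms(2)] assms(3)
  by (simp add: a_minus_def)

lemma (in cring) subring_minus:
  "subring A R \<Longrightarrow> x \<in> A \<Longrightarrow> y \<in> A \<Longrightarrow> x \<ominus> y \<in> A"
  unfolding a_minus_def using subringE(5,7) by metis

lemma submodule_Int:
  "is_submodule R A M \<Longrightarrow> is_submodule R A N \<Longrightarrow> is_submodule R A (M \<inter> N)"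
  by (auto simp: is_submodule_def)

lemma submodule_Union_chain:
  assumes "subset.chain {N. is_submodule R A N} \<C>" "\<C> \<noteq> {}"
  shows "is_submodule R A (\<Union>\<C>)"
proof -
  have sub: "is_submodule R A N" if "N \<in> \<C>" for N
    using assms(1) that by (auto simp: subset.chain_def)
  have "x \<oplus>\<^bsub>R\<^esub> y \<in> \<Union>\<C>" if "x \<in> M" "M \<in> \<C>" "y \<in> N" "N \<in> \<C>" for x y M N
  proof -
    have "M \<subseteq> N \<or> N \<subseteq> M" using assms(1) that by (auto simp: subset_chain_def)
    then show ?thesis using that is_submoduleD(3)[OF sub] by blast
  qed
  moreover have "\<Union>\<C> \<subseteq> carrier R" using is_submoduleD(1)[OF sub] by blast
  moreover have "\<zero>\<^bsub>R\<^esub> \<in> \<Union>\<C>" using is_submoduleD(2)[OF sub] assms(2) by blast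
  moreover have "a \<otimes>\<^bsub>R\<^esub> x \<in> \<Union>\<C>" if "a \<in> A" "x \<in> \<Union>\<C>" for a x
    using is_submoduleD(4)[OF sub] that by blast
  ultimately show ?thesis unfolding is_submodule_def by blast
qed

text \<open>A finite generating set of the union of a chain lies in a single member, so the union is
  that member. This supplies the upper bound for Zorn inside the family itself.\<close>

lemma submodule_maximal:
  assumes "\<And>N. is_submodule R A N \<Longrightarrow> fin_generated R A N"
    and "\<F> \<noteq> {}" "\<And>N. N \<in> \<F> \<Longrightarrow> is_submodule R A N"
  shows "\<exists>M\<in>\<F>. \<forall>N\<in>\<F>. M \<subseteq> N \<longrightarrow> N = M"
proof (rule subset_Zorn_nonempty[OF assms(2)])
  fix \<C> assume C: "\<C> \<noteq> {}" "subset.chain \<F> \<C>"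
  have "subset.chain {N. is_submodule R A N} \<C>"
    using C(2) assms(3) by (auto simp: subset_chain_def)
  then have "fin_generated R A (\<Union>\<C>)" using assms(1) submodule_Union_chain C(1) by blast
  then obtain Z where Z: "finite Z" "Z \<subseteq> \<Union>\<C>"
    "\<And>M. is_submodule R A M \<Longrightarrow> Z \<subseteq> M \<Longrightarrow> \<Union>\<C> \<subseteq> M"
    by (auto simp: fin_generated_def)
  obtain M where "M \<in> \<C>" "Z \<subseteq> M" by (rule finite_subset_Union_chain[OF Z(1,2) C])
  then have "\<Union>\<C> = M" using Z(3) assms(3) C(2) by (auto simp: subset_chain_def)
  then show "\<Union>\<C> \<in> \<F>" using \<open>M \<in> \<C>\<close> C(2) by (auto simp: subset_chain_def)
qed

section \<open>Central primes and lying over\<close>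

text \<open>\<open>R\<close> is the birational gluing of an extension of \<open>A\<close>, and \<open>P\<close> consists of its elements that
  are sums of squares in \<open>\<K>(A)\<close>. For every ring \<open>C\<close> between \<open>A\<close> and \<open>R\<close> we have \<open>\<K>(C) = \<K>(A)\<close>,
  so the central primes of \<open>C\<close> are defined by one and the same \<open>P\<close>.\<close>

locale positive_domain = domain R for R :: "('b, 'n) ring_scheme" (structure) +
  fixes A P :: "'b set"
  assumes A: "subring A R"
    and P_carrier: "P \<subseteq> carrier R"
    and P_add: "x \<in> P \<Longrightarrow> y \<in> P \<Longrightarrow> x \<oplus> y \<in> P"
    and P_mult: "x \<in> P \<Longrightarrow> y \<in> P \<Longrightarrow> x \<otimes> y \<in> P"
    and P_square: "x \<in> carrier R \<Longrightarrow> x \<otimes> x \<in> P"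
    and P_cancel: "\<lbrakk>s \<in> carrier R; s \<noteq> \<zero>; t \<in> carrier R; s \<otimes> s \<otimes> t \<in> P\<rbrakk> \<Longrightarrow> t \<in> P"
    and integral_elt: "x \<in> carrier R \<Longrightarrow> \<exists>k. x [^] k \<in> power_span R A x k"
    and noetherian: "is_submodule R A N \<Longrightarrow> fin_generated R A N"
begin

lemma P_closed: "x \<in> P \<Longrightarrow> x \<in> carrier R"
  using P_carrier by blast

lemma A_closed: "x \<in> A \<Longrightarrow> x \<in> carrier R"
  using subringE(1)[OF A] by blast

text \<open>\<open>t\<close> ranges over the whole cone \<open>P\<close>, not over
  \<open>P \<inter> C\<close>. For a subring \<open>C\<close> this makes no difference:
  \<open>a^2 + t \<in> q \<subseteq> C\<close> already puts \<open>t\<close> into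
  \<open>C\<close>.\<close>

definition cprime :: "'b set \<Rightarrow> 'b set \<Rightarrow> bool" where
  "cprime C q \<longleftrightarrow> is_submodule R C q \<and> q \<subseteq> C \<and> \<one> \<notin> q \<and>
     (\<forall>x\<in>C. \<forall>y\<in>C. x \<otimes> y \<in> q \<longrightarrow> x \<in> q \<or> y \<in> q) \<and>
     (\<forall>a\<in>C. \<forall>t\<in>P. a \<otimes> a \<oplus> t \<in> q \<longrightarrow> a \<in> q)"

lemma cprimeD:
  assumes "cprime C q"
  shows "is_submodule R C q" "x \<in> q \<Longrightarrow> x \<in> C" "\<one> \<notin> q"
    "x \<in> C \<Longrightarrow> y \<in> C \<Longrightarrow> x \<otimes> y \<in> q \<Longrightarrow> x \<in> q \<or> y \<in> q"
    "a \<in> C \<Longrightarrow> t \<in> P \<Longrightarrow> a \<otimes> a \<oplus> t \<in> q \<Longrightarrow> a \<in> q"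
  using assms by (auto simp: cprime_def)

text \<open>A maximal \<open>Q \<supseteq> I\<close> avoiding \<open>M = {s\<^sup>2 + t}\<close> is central: if \<open>a\<^sup>2 + t \<in> Q\<close> and
  \<open>s\<^sup>2 + t' = q + c a\<close>, then \<open>(s\<^sup>2 + t')\<^sup>2 + c\<^sup>2 t\<close> lies in both \<open>Q\<close> and \<open>M\<close>.\<close>

lemma avoiding_ideal_extend:
  assumes C: "subring C R"
    and S: "S \<subseteq> C" "S \<noteq> {}" "\<And>s t. s \<in> S \<Longrightarrow> t \<in> S \<Longrightarrow> s \<otimes> t \<in> S"
    and I: "is_submodule R C I" "I \<subseteq> C" "\<And>s t. s \<in> S \<Longrightarrow> t \<in> P \<Longrightarrow> s \<otimes> s \<oplus> t \<notin> I"
  shows "\<exists>Q. cprime C Q \<and> I \<subseteq> Q \<and> Q \<inter> S = {}"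
proof -
  define \<F> where "\<F> = {Q. is_submodule R C Q \<and> Q \<subseteq> C \<and> I \<subseteq> Q \<and>
    (\<forall>s\<in>S. \<forall>t\<in>P. s \<otimes> s \<oplus> t \<notin> Q)}"
  have "I \<in> \<F>" using I by (auto simp: \<F>_def)
  have "\<exists>M\<in>\<F>. \<forall>Z\<in>\<F>. M \<subseteq> Z \<longrightarrow> Z = M"
  proof (rule subset_Zorn_nonempty)
    show "\<F> \<noteq> {}" using \<open>I \<in> \<F>\<close> by blast
    fix \<C> assume c: "\<C> \<noteq> {}" "subset.chain \<F> \<C>"
    then have "subset.chain {N. is_submodule R C N} \<C>" by (auto simp: subset_chain_def \<F>_def)
    from submodule_Union_chain[OF this c(1)]
    show "\<Union>\<C> \<in> \<F>" using c by (auto simp: subset_chain_def \<F>_def)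
  qed
  then obtain Q where Q: "Q \<in> \<F>" and max: "\<And>Z. Z \<in> \<F> \<Longrightarrow> Q \<subseteq> Z \<Longrightarrow> Z = Q" by blast
  have Qs: "is_submodule R C Q" "Q \<subseteq> C" "I \<subseteq> Q" and av: "\<And>s t. s \<in> S \<Longrightarrow> t \<in> P \<Longrightarrow> s \<otimes> s \<oplus> t \<notin> Q"
    using Q by (auto simp: \<F>_def)
  note Qd = is_submoduleD[OF Qs(1)] submodule_minus[OF C Qs(1)]
  have Cc: "x \<in> carrier R" if "x \<in> C" for x using subringE(1)[OF C] that by blast
  have z: "\<zero> \<in> P" using P_square[of \<zero>] by simp
  have step: "\<exists>s t q c. s \<in> S \<and> t \<in> P \<and> q \<in> Q \<and> c \<in> C \<and> s \<otimes> s \<oplus> t = q \<oplus> c \<otimes> x"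
    if x: "x \<in> C" "x \<notin> Q" for x
  proof -
    \<comment> \<open>\<open>Z\<close> is the ideal \<open>Q + C x\<close>; as \<open>x\<close> is
      outside \<open>Q\<close>, maximality of \<open>Q\<close> makes \<open>Z\<close> meet the set
      \<open>{s^2 + t}\<close>.\<close>
    define Z where "Z = {q \<oplus> c \<otimes> x | q c. q \<in> Q \<and> c \<in> C}"
    have "is_submodule R C Z"
      unfolding is_submodule_def
    proof (intro conjI ballI)
      show "Z \<subseteq> carrier R" using Cc x Qd(1) by (auto simp: Z_def)
      have "\<zero> = \<zero> \<oplus> \<zero> \<otimes> x" using Cc x by simp
      then show "\<zero> \<in> Z" unfolding Z_def using Qd(2) subringE(2)[OF C] by blast
      fix y z assume "y \<in> Z" "z \<in> Z"
      then obtain q c q' c' where e: "q \<in> Q" "c \<in> C" "q' \<in> Q" "c' \<in> C"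
        "y = q \<oplus> c \<otimes> x" "z = q' \<oplus> c' \<otimes> x" unfolding Z_def by blast
      have "y \<oplus> z = (q \<oplus> q') \<oplus> (c \<oplus> c') \<otimes> x"
        unfolding e(5,6) using e(2,4)[THEN Cc] x(1)[THEN Cc] e(1,3)[THEN Qd(1)] by algebra
      then show "y \<oplus> z \<in> Z" unfolding Z_def using Qd(3) subringE(7)[OF C] e by blast
    next
      fix a y assume a: "a \<in> C" "y \<in> Z"
      then obtain q c where e: "q \<in> Q" "c \<in> C" "y = q \<oplus> c \<otimes> x" unfolding Z_def by blast
      have "a \<otimes> y = a \<otimes> q \<oplus> (a \<otimes> c) \<otimes> x"
        unfolding e(3) using e(1)[THEN Qd(1)] e(2)[THEN Cc] a(1)[THEN Cc] x(1)[THEN Cc] by algebra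
      then show "a \<otimes> y \<in> Z" unfolding Z_def using Qd(4) subringE(6)[OF C] e a by blast
    qed
    moreover have "Z \<subseteq> C"
      using Qs(2) x subringE(6,7)[OF C] unfolding Z_def by blast
    moreover have "Q \<subseteq> Z"
    proof
      fix q assume q: "q \<in> Q"
      then have "q = q \<oplus> \<zero> \<otimes> x" using Qd(1) Cc x by simp
      then show "q \<in> Z" unfolding Z_def using q subringE(2)[OF C] by blast
    qed
    moreover have "x \<in> Z"
    proof -
      have "x = \<zero> \<oplus> \<one> \<otimes> x" using Cc x by simp
      then show ?thesis unfolding Z_def using Qd(2) subringE(3)[OF C] by blast
    qed
    ultimately have "Z \<notin> \<F>" using max[of Z] x by blast
    then obtain s t where "s \<in> S" "t \<in> P" "s \<otimes> s \<oplus> t \<in> Z"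
      using \<open>is_submodule R C Z\<close> \<open>Z \<subseteq> C\<close> \<open>Q \<subseteq> Z\<close> Qs(3) unfolding \<F>_def by blast
    then show ?thesis unfolding Z_def by blast
  qed
  have "cprime C Q"
    unfolding cprime_def
  proof (intro conjI ballI impI)
    obtain s where s: "s \<in> S" using S(2) by blast
    show "\<one> \<notin> Q"
    proof
      assume "\<one> \<in> Q"
      then have "(s \<otimes> s) \<otimes> \<one> \<in> Q" using Qd(4) subringE(6)[OF C] S(1) s by blast
      then show False using av[OF s z] Cc S(1) s by auto
    qed
    fix x y assume xy: "x \<in> C" "y \<in> C" "x \<otimes> y \<in> Q"
    show "x \<in> Q \<or> y \<in> Q"
    proof (rule ccontr)
      assume "\<not> (x \<in> Q \<or> y \<in> Q)"
      then obtain s t q c s' t' q' c' where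
        1: "s \<in> S" "t \<in> P" "q \<in> Q" "c \<in> C" "s \<otimes> s \<oplus> t = q \<oplus> c \<otimes> x" and
        2: "s' \<in> S" "t' \<in> P" "q' \<in> Q" "c' \<in> C" "s' \<otimes> s' \<oplus> t' = q' \<oplus> c' \<otimes> y"
        using step[OF xy(1)] step[OF xy(2)] by metis
      \<comment> \<open>The set \<open>{s^2 + t}\<close> is closed under products: \<open>?t\<close>
        is what remains of \<open>(s^2 + t)(s'^2 + t')\<close> beside \<open>(s s')^2\<close>. In
        the other expansion of the same product every term contains \<open>q\<close>,
        \<open>q'\<close> or \<open>x y\<close>.\<close>
      let ?t = "(s \<otimes> s) \<otimes> t' \<oplus> (s' \<otimes> s') \<otimes> t \<oplus> t \<otimes> t'"
      have c: "s \<in> carrier R" "s' \<in> carrier R" "t \<in> carrier R" "t' \<in> carrier R"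
        "q \<in> carrier R" "q' \<in> carrier R" "c \<in> carrier R" "c' \<in> carrier R"
        "x \<in> carrier R" "y \<in> carrier R"
        using 1 2 xy Cc S(1) Qd(1) P_closed by blast+
      have "(s \<otimes> s') \<otimes> (s \<otimes> s') \<oplus> ?t = (s \<otimes> s \<oplus> t) \<otimes> (s' \<otimes> s' \<oplus> t')"
        using c by algebra
      also have "\<dots> = (q' \<oplus> c' \<otimes> y) \<otimes> q \<oplus> ((c \<otimes> x) \<otimes> q' \<oplus> (c \<otimes> c') \<otimes> (x \<otimes> y))"
        unfolding 1(5) 2(5) using c by algebra
      also have "\<dots> \<in> Q"
        using Qd(3,4) 1(3,4) 2(3,4) xy subringE(6,7)[OF C] Qs(2) by (meson subsetD)
      finally show False
        using av[of "s \<otimes> s'" ?t] S(3) 1 2 P_add P_mult P_square c by auto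
    qed
  next
    fix a t assume a: "a \<in> C" "t \<in> P" "a \<otimes> a \<oplus> t \<in> Q"
    show "a \<in> Q"
    proof (rule ccontr)
      assume "a \<notin> Q"
      then obtain s t' q c where
        1: "s \<in> S" "t' \<in> P" "q \<in> Q" "c \<in> C" "s \<otimes> s \<oplus> t' = q \<oplus> c \<otimes> a"
        using step[OF a(1)] by metis
      have c: "s \<in> carrier R" "t \<in> carrier R" "t' \<in> carrier R" "q \<in> carrier R" "c \<in> carrier R"
        "a \<in> carrier R"
        using 1 a Cc S(1) Qd(1) P_closed by blast+
      let ?t = "(s \<otimes> s) \<otimes> t' \<oplus> (s \<otimes> s) \<otimes> t' \<oplus> t' \<otimes> t' \<oplus> (c \<otimes> c) \<otimes> t"
      have "(s \<otimes> s) \<otimes> (s \<otimes> s) \<oplus> ?t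
          = (s \<otimes> s \<oplus> t') \<otimes> (s \<otimes> s \<oplus> t') \<oplus> (c \<otimes> c) \<otimes> t"
        using c by algebra
      also have "\<dots> = (q \<oplus> (c \<otimes> a \<oplus> c \<otimes> a)) \<otimes> q \<oplus> (c \<otimes> c) \<otimes> (a \<otimes> a \<oplus> t)"
        unfolding 1(5) using c by algebra
      also have "\<dots> \<in> Q"
        using Qd(3,4) 1(3,4) a subringE(6,7)[OF C] Qs(2) by (meson subsetD)
      finally show False
        using av[of "s \<otimes> s" ?t] S(3) 1 a P_add P_mult P_square c by auto
    qed
  qed (use Qs in auto)
  moreover have "Q \<inter> S = {}"
  proof -
    have "s \<notin> Q" if "s \<in> S" for s
    proof
      assume "s \<in> Q"
      then have "s \<otimes> s \<in> Q" using Qd(4) S(1) that by blast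
      then show False using av[OF that z] Cc S(1) that by auto
    qed
    then show ?thesis by blast
  qed
  ultimately show ?thesis using Qs(3) by blast
qed

end

section \<open>Squares of integral elements are bounded by elements of \<open>A\<close>\<close>

primrec even_power_sum :: "('b, 'n) ring_scheme \<Rightarrow> 'b \<Rightarrow> nat \<Rightarrow> 'b" where
  "even_power_sum R x 0 = \<zero>\<^bsub>R\<^esub>"
| "even_power_sum R x (Suc k) =
     even_power_sum R x k \<oplus>\<^bsub>R\<^esub> x [^]\<^bsub>R\<^esub> k \<otimes>\<^bsub>R\<^esub> x [^]\<^bsub>R\<^esub> k"

context positive_domain begin

lemma zero_in_P: "\<zero> \<in> P" using P_square[of \<zero>] by simp

lemma one_in_P: "\<one> \<in> P" using P_square[of \<one>] by simp

lemma even_power_sum_in_P: "x \<in> carrier R \<Longrightarrow> even_power_sum R x k \<in> P"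
  by (induction k) (auto intro: P_add P_square zero_in_P)

text \<open>With \<open>w = 1 + x^2 + ... + x^(2k-2)\<close> this is the geometric sum formula
  \<open>(x^2 - 1) w = x^(2k) - 1\<close>, both subtractions being moved to the other side.\<close>

lemma even_power_sum_telescope:
  assumes x: "x \<in> carrier R"
  shows "(x \<otimes> x) \<otimes> even_power_sum R x k \<oplus> \<one> = even_power_sum R x k \<oplus> x [^] k \<otimes> x [^] k"
proof (induction k)
  case (Suc k)
  have c: "even_power_sum R x k \<in> carrier R" "x [^] k \<in> carrier R"
    using x even_power_sum_in_P P_closed by auto
  have "(x \<otimes> x) \<otimes> even_power_sum R x (Suc k) \<oplus> \<one>
      = ((x \<otimes> x) \<otimes> even_power_sum R x k \<oplus> \<one>) \<oplus> (x [^] k \<otimes> x) \<otimes> (x [^] k \<otimes> x)"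
    using c x by (simp, algebra)
  also have "\<dots> = even_power_sum R x (Suc k) \<oplus> x [^] Suc k \<otimes> x [^] Suc k"
    unfolding Suc.IH using c x by simp
  finally show ?case .
qed (use x in simp)

text \<open>Reading \<open>h - y^2 \<in> P\<close> as \<open>y^2 \<le> h\<close>, this is
  \<open>(y + z)^2 \<le> 2 h + 2 k\<close>, a consequence of
  \<open>2 y^2 + 2 z^2 = (y + z)^2 + (y - z)^2\<close>.\<close>

lemma sum_square_bound:
  assumes c: "h \<in> carrier R" "k \<in> carrier R" "y \<in> carrier R" "z \<in> carrier R"
    and h: "h \<ominus> y \<otimes> y \<in> P" and k: "k \<ominus> z \<otimes> z \<in> P"
  shows "h \<oplus> h \<oplus> (k \<oplus> k) \<ominus> (y \<oplus> z) \<otimes> (y \<oplus> z) \<in> P"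
proof -
  have "h \<oplus> h \<oplus> (k \<oplus> k) \<ominus> (y \<oplus> z) \<otimes> (y \<oplus> z)
    = (h \<ominus> y \<otimes> y) \<oplus> (h \<ominus> y \<otimes> y) \<oplus> ((k \<ominus> z \<otimes> z) \<oplus> (k \<ominus> z \<otimes> z)) \<oplus> (y \<ominus> z) \<otimes> (y \<ominus> z)"
    using c by algebra
  also have "\<dots> \<in> P" using h k c by (intro P_add P_square) auto
  finally show ?thesis .
qed

text \<open>A bound of Cauchy-Schwarz type: the square of a combination of
  \<open>1, ..., x^(k-1)\<close> is at most \<open>r\<close> times the sum of the
  \<open>x^(2i)\<close>. The factor \<open>r\<close> is built from the coefficients alone, which is
  why it can be found in \<open>A\<close>.\<close>

lemma power_span_bound:
  assumes x: "x \<in> carrier R"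
  shows "v \<in> power_span R A x k \<Longrightarrow>
    \<exists>r\<in>A. r \<in> P \<and> r \<otimes> even_power_sum R x k \<ominus> v \<otimes> v \<in> P \<and> v \<in> carrier R"
proof (induction k arbitrary: v)
  case 0
  then show ?case using subringE(2)[OF A] zero_in_P by (intro bexI[of _ \<zero>]) (auto simp: a_minus_def)
next
  case (Suc k)
  then obtain u a where u: "u \<in> power_span R A x k" "a \<in> A" "v = u \<oplus> a \<otimes> x [^] k" by auto
  obtain r where r: "r \<in> A" "r \<in> P" "r \<otimes> even_power_sum R x k \<ominus> u \<otimes> u \<in> P" "u \<in> carrier R"
    using Suc.IH[OF u(1)] by blast
  define w y where "w = even_power_sum R x k" and "y = x [^] k"
  have w: "w \<in> P" unfolding w_def using x by (rule even_power_sum_in_P)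
  have c: "w \<in> carrier R" "y \<in> carrier R" "a \<in> carrier R" "r \<in> carrier R"
    using x w P_closed A_closed u r by (auto simp: y_def)
  \<comment> \<open>From \<open>(u + a y)^2 \<le> 2 r w + 2 a^2 y^2\<close> the bound
    \<open>(2 r + 2 a^2)(w + y^2)\<close> follows by adding \<open>2 r y^2 + 2 a^2 w\<close>, which
    lies in \<open>P\<close> because \<open>r\<close> does.\<close>
  let ?r = "(r \<oplus> r) \<oplus> (a \<otimes> a \<oplus> a \<otimes> a)"
  let ?h = "r \<otimes> w" and ?k = "(a \<otimes> a) \<otimes> (y \<otimes> y)"
  have "?k \<ominus> (a \<otimes> y) \<otimes> (a \<otimes> y) = \<zero>" using c by algebra
  then have k: "?k \<ominus> (a \<otimes> y) \<otimes> (a \<otimes> y) \<in> P" using zero_in_P by simp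
  have "?h \<oplus> ?h \<oplus> (?k \<oplus> ?k) \<ominus> (u \<oplus> a \<otimes> y) \<otimes> (u \<oplus> a \<otimes> y) \<in> P"
    by (rule sum_square_bound[OF _ _ _ _ _ k]) (use r(3,4) c in \<open>auto simp: w_def\<close>)
  moreover have "?r \<otimes> (w \<oplus> y \<otimes> y) \<ominus> z = (?h \<oplus> ?h \<oplus> (?k \<oplus> ?k) \<ominus> z)
      \<oplus> (r \<otimes> (y \<otimes> y) \<oplus> r \<otimes> (y \<otimes> y) \<oplus> ((a \<otimes> a) \<otimes> w \<oplus> (a \<otimes> a) \<otimes> w))" if "z \<in> carrier R" for z
    using c that by algebra
  moreover have "r \<otimes> (y \<otimes> y) \<oplus> r \<otimes> (y \<otimes> y) \<oplus> ((a \<otimes> a) \<otimes> w \<oplus> (a \<otimes> a) \<otimes> w) \<in> P"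
    using r(2) c w by (intro P_add P_mult P_square) auto
  ultimately have "?r \<otimes> (w \<oplus> y \<otimes> y) \<ominus> (u \<oplus> a \<otimes> y) \<otimes> (u \<oplus> a \<otimes> y) \<in> P"
    using P_add c r(4) by simp
  then have "?r \<otimes> even_power_sum R x (Suc k) \<ominus> v \<otimes> v \<in> P" by (simp add: u(3) w_def y_def)
  moreover have "?r \<in> A" "?r \<in> P"
    using r u subringE(6,7)[OF A] P_add P_square c by auto
  moreover have "v \<in> carrier R" using c r u by (simp add: y_def)
  ultimately show ?case by blast
qed

text \<open>With \<open>w = (\<Sum>i<k. (x^i)\<^sup>2)\<close> and \<open>(x^k)\<^sup>2 \<le> r w\<close>, telescoping gives
  \<open>(1 + r - x\<^sup>2) w = 1 + (r w - (x^k)\<^sup>2)\<close>.\<close>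

lemma square_bounded:
  assumes real: "\<ominus> \<one> \<notin> P" and x: "x \<in> carrier R"
  shows "\<exists>g\<in>A. g \<ominus> x \<otimes> x \<in> P"
proof -
  obtain k where "x [^] k \<in> power_span R A x k" using integral_elt[OF x] by blast
  from power_span_bound[OF x this] obtain r where
    r: "r \<in> A" "r \<in> P" "r \<otimes> even_power_sum R x k \<ominus> x [^] k \<otimes> x [^] k \<in> P" by blast
  define w y where "w = even_power_sum R x k" and "y = x [^] k \<otimes> x [^] k"
  have w: "w \<in> P" unfolding w_def using x by (rule even_power_sum_in_P)
  have c: "w \<in> carrier R" "y \<in> carrier R" "r \<in> carrier R" "x \<otimes> x \<in> carrier R"
    using x w P_closed r by (auto simp: y_def)
  have rw: "r \<otimes> w \<ominus> y \<in> P" using r by (simp add: w_def y_def)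
  have e: "(x \<otimes> x) \<otimes> w \<oplus> \<one> = w \<oplus> y"
    unfolding w_def y_def by (rule even_power_sum_telescope[OF x])
  \<comment> \<open>For \<open>w = 0\<close> the telescoping identity gives \<open>y = 1\<close>, so
    the bound on \<open>y\<close> would read \<open>- 1 \<in> P\<close>. This is where realness
    enters.\<close>
  have nz: "w \<noteq> \<zero>"
  proof
    assume "w = \<zero>"
    then have "r \<otimes> w \<ominus> y = \<ominus> \<one>" using e c by (simp add: a_minus_def)
    then show False using rw real by simp
  qed
  have "(\<one> \<oplus> r \<ominus> x \<otimes> x) \<otimes> w = ((\<one> \<oplus> r) \<otimes> w \<oplus> \<one>) \<ominus> ((x \<otimes> x) \<otimes> w \<oplus> \<one>)"
    using c by algebra
  also have "\<dots> = \<one> \<oplus> (r \<otimes> w \<ominus> y)" unfolding e using c by algebra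
  finally have "(\<one> \<oplus> r \<ominus> x \<otimes> x) \<otimes> w \<in> P" using P_add one_in_P rw by simp
  \<comment> \<open>\<open>P_cancel\<close> removes squares only, so \<open>w\<close> is multiplied
    in once more.\<close>
  then have "w \<otimes> ((\<one> \<oplus> r \<ominus> x \<otimes> x) \<otimes> w) \<in> P" using P_mult w by blast
  moreover have "w \<otimes> ((\<one> \<oplus> r \<ominus> x \<otimes> x) \<otimes> w) = w \<otimes> w \<otimes> (\<one> \<oplus> r \<ominus> x \<otimes> x)"
    using c by algebra
  ultimately have "\<one> \<oplus> r \<ominus> x \<otimes> x \<in> P" using P_cancel nz c by simp
  moreover have "\<one> \<oplus> r \<in> A" using r subringE(3,7)[OF A] by blast
  ultimately show ?thesis by blast
qed

text \<open>A single central prime thus supplies the realness on which the bound for squares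
  depends.\<close>

lemma cprime_imp_real:
  assumes "subring C R" "cprime C q"
  shows "\<ominus> \<one> \<notin> P"
proof
  assume "\<ominus> \<one> \<in> P"
  moreover have "\<one> \<otimes> \<one> \<oplus> \<ominus> \<one> = \<zero>" using r_neg by simp
  ultimately show False
    using cprimeD(3,5)[OF assms(2)] subringE(3)[OF assms(1)] is_submoduleD(2)[OF cprimeD(1)[OF assms(2)]]
    by metis
qed

lemma lying_over:
  assumes D: "subring D R" "A \<subseteq> D" and C: "subring C R" "D \<subseteq> C" and q: "cprime D q"
  shows "\<exists>Q. cprime C Q \<and> Q \<inter> D = q"
proof -
  have real: "\<ominus> \<one> \<notin> P" by (rule cprime_imp_real[OF D(1) q])
  note qd = is_submoduleD[OF cprimeD(1)[OF q]]
  have Cc: "x \<in> carrier R" if "x \<in> C" for x using subringE(1)[OF C(1)] that by blast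
  \<comment> \<open>\<open>E\<close> replaces the extended ideal \<open>qC\<close>: it contracts to \<open>q\<close> because \<open>q\<close> is central.\<close>
  define E where "E = {y\<in>C. \<exists>h\<in>q. h \<ominus> y \<otimes> y \<in> P}"
  have Eq: "y \<in> q" if y: "y \<in> E" "y \<in> D" for y
  proof -
    obtain h where h: "h \<in> q" "h \<ominus> y \<otimes> y \<in> P" using y by (auto simp: E_def)
    have "y \<otimes> y \<oplus> (h \<ominus> y \<otimes> y) = h" using qd(1)[OF h(1)] Cc y(2) C(2) by (simp add: a_minus_def a_ac r_neg subset_iff)
    then show ?thesis using cprimeD(5)[OF q y(2) h(2)] h(1) by simp
  qed
  have qE: "q \<subseteq> E"
  proof
    fix y assume y: "y \<in> q"
    then have "y \<otimes> y \<in> q" "y \<in> D" using qd(4) cprimeD(2)[OF q] by blast+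
    moreover have "y \<otimes> y \<ominus> y \<otimes> y \<in> P" using zero_in_P qd(1)[OF y] by (simp add: a_minus_def r_neg)
    ultimately show "y \<in> E" using C(2) by (auto simp: E_def)
  qed
  have Esub: "is_submodule R C E"
    unfolding is_submodule_def
  proof (intro conjI ballI)
    show "E \<subseteq> carrier R" using Cc by (auto simp: E_def)
    show "\<zero> \<in> E" using qE qd(2) by blast
    fix y z assume "y \<in> E" "z \<in> E"
    then obtain h k where h: "y \<in> C" "z \<in> C" "h \<in> q" "k \<in> q" "h \<ominus> y \<otimes> y \<in> P" "k \<ominus> z \<otimes> z \<in> P"
      by (auto simp: E_def)
    have c: "h \<in> carrier R" "k \<in> carrier R" "y \<in> carrier R" "z \<in> carrier R"
      using h Cc qd(1) by auto
    have "h \<oplus> h \<oplus> (k \<oplus> k) \<ominus> (y \<oplus> z) \<otimes> (y \<oplus> z) \<in> P"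
      using c h by (intro sum_square_bound)
    then show "y \<oplus> z \<in> E"
      using h qd(3) subringE(7)[OF C(1)] unfolding E_def by blast
  next
    fix b y assume b: "b \<in> C" "y \<in> E"
    then obtain h where h: "y \<in> C" "h \<in> q" "h \<ominus> y \<otimes> y \<in> P" by (auto simp: E_def)
    obtain g where g: "g \<in> A" "g \<ominus> b \<otimes> b \<in> P" using square_bounded[OF real Cc[OF b(1)]] by blast
    have c: "h \<in> carrier R" "y \<in> carrier R" "b \<in> carrier R" "g \<in> carrier R"
      using h b g Cc qd(1) A_closed by auto
    \<comment> \<open>From \<open>b^2 \<le> g\<close> and \<open>y^2 \<le> h\<close> follows
      \<open>(b y)^2 \<le> g h\<close>, and \<open>g h \<in> q\<close> because \<open>g\<close>
      comes from \<open>A \<subseteq> D\<close>. Integrality enters this proof here, through the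
      choice of \<open>g\<close>.\<close>
    have "g \<otimes> h \<ominus> (b \<otimes> y) \<otimes> (b \<otimes> y)
       = ((g \<ominus> b \<otimes> b) \<oplus> b \<otimes> b) \<otimes> (h \<ominus> y \<otimes> y) \<oplus> (g \<ominus> b \<otimes> b) \<otimes> (y \<otimes> y)"
      using c by algebra
    also have "\<dots> \<in> P" using h g c by (intro P_add P_mult P_square) auto
    finally show "b \<otimes> y \<in> E"
      using h g b qd(4) D(2) subringE(6)[OF C(1)] unfolding E_def by blast
  qed
  have "\<exists>Q. cprime C Q \<and> E \<subseteq> Q \<and> Q \<inter> (D - q) = {}"
  proof (rule avoiding_ideal_extend[OF C(1)])
    show "D - q \<subseteq> C" using C(2) by blast
    show "D - q \<noteq> {}" using cprimeD(3)[OF q] subringE(3)[OF D(1)] by blast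
    show "s \<otimes> t \<in> D - q" if "s \<in> D - q" "t \<in> D - q" for s t
      using that subringE(6)[OF D(1)] cprimeD(4)[OF q] by blast
    show "is_submodule R C E" by (rule Esub)
    show "E \<subseteq> C" by (auto simp: E_def)
    fix s t assume s: "s \<in> D - q" "t \<in> P"
    show "s \<otimes> s \<oplus> t \<notin> E"
    proof
      assume e: "s \<otimes> s \<oplus> t \<in> E"
      then obtain h where h: "h \<in> q" "h \<ominus> (s \<otimes> s \<oplus> t) \<otimes> (s \<otimes> s \<oplus> t) \<in> P" by (auto simp: E_def)
      have c: "h \<in> carrier R" "s \<in> carrier R" "t \<in> carrier R"
        using h s C(2) Cc qd(1) P_closed by auto
      \<comment> \<open>Since \<open>s^4 \<le> (s^2 + t)^2 \<le> h\<close>, the square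
        \<open>s^2\<close> itself lies in \<open>E\<close>, hence in \<open>q\<close>, although
        \<open>s\<close> does not.\<close>
      have "h \<ominus> (s \<otimes> s) \<otimes> (s \<otimes> s)
         = (h \<ominus> (s \<otimes> s \<oplus> t) \<otimes> (s \<otimes> s \<oplus> t)) \<oplus> ((s \<otimes> s) \<otimes> t \<oplus> (s \<otimes> s) \<otimes> t \<oplus> t \<otimes> t)"
        using c by algebra
      also have "\<dots> \<in> P" using h s c by (intro P_add P_mult P_square) auto
      finally have "s \<otimes> s \<in> E"
        using h s C subringE(6)[OF C(1)] by (auto simp: E_def)
      then have "s \<otimes> s \<in> q" using Eq subringE(6)[OF D(1)] s by blast
      then show False using cprimeD(4)[OF q] s by blast
    qed
  qed
  then obtain Q where "cprime C Q" "E \<subseteq> Q" "Q \<inter> (D - q) = {}" by blast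
  moreover have "q \<subseteq> D" using cprimeD(2)[OF q] by blast
  ultimately show ?thesis using qE by blast
qed

section \<open>Conductors and central gluings\<close>

definition conductor :: "'b set \<Rightarrow> 'b set" where
  "conductor C = {a\<in>A. \<forall>c\<in>C. a \<otimes> c \<in> A}"

definition central_closure :: "'b set \<Rightarrow> 'b set" where
  "central_closure C = {c\<in>C. \<forall>Q. cprime C Q \<longrightarrow> conductor C \<subseteq> Q \<longrightarrow> c \<in> Q}"

text \<open>The second conjunct is surjectivity of k(Q \<inter> A) \<rightarrow> k(Q), tested on
  classes \<open>c = a / s\<close>; injectivity is automatic for fields. Integrality is not recorded
  because it holds for every ring between \<open>A\<close> and \<open>R\<close>.\<close>

definition subintegral :: "'b set \<Rightarrow> bool" where
  "subintegral D \<longleftrightarrow> bij_betw (\<lambda>Q. Q \<inter> A) {Q. cprime D Q} {p. cprime A p} \<and>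
     (\<forall>Q. cprime D Q \<longrightarrow> (\<forall>c\<in>D. \<exists>a\<in>A. \<exists>s\<in>A. s \<notin> Q \<and> s \<otimes> c \<ominus> a \<in> Q))"

lemma submodule_restrict:
  "is_submodule R C N \<Longrightarrow> A' \<subseteq> C \<Longrightarrow> is_submodule R A' N"
  by (auto simp: is_submodule_def)

lemma cprime_contract:
  assumes "subring E R" "E \<subseteq> D" "cprime D Q"
  shows "cprime E (Q \<inter> E)"
proof -
  have "is_submodule R E E" using subringE[OF assms(1)] by (simp add: is_submodule_def)
  then have "is_submodule R E (Q \<inter> E)"
    using submodule_Int submodule_restrict[OF cprimeD(1)[OF assms(3)] assms(2)] by blast
  then show ?thesis
    unfolding cprime_def using cprimeD[OF assms(3)] assms(2) subringE(6,7)[OF assms(1)] by blast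
qed

lemma conductor_submodule:
  assumes C: "subring C R" "A \<subseteq> C"
  shows "is_submodule R C (conductor C)"
  unfolding is_submodule_def
proof (intro conjI ballI)
  have Cc: "x \<in> carrier R" if "x \<in> C" for x using subringE(1)[OF C(1)] that by blast
  show "conductor C \<subseteq> carrier R" using A_closed by (auto simp: conductor_def)
  show "\<zero> \<in> conductor C" using subringE(2)[OF A] Cc by (auto simp: conductor_def)
  fix x y assume xy: "x \<in> conductor C" "y \<in> conductor C"
  have "(x \<oplus> y) \<otimes> c \<in> A" if c: "c \<in> C" for c
  proof -
    have "(x \<oplus> y) \<otimes> c = x \<otimes> c \<oplus> y \<otimes> c"
      using xy c Cc A_closed by (intro l_distr) (auto simp: conductor_def)
    then show ?thesis using xy c subringE(7)[OF A] by (auto simp: conductor_def)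
  qed
  then show "x \<oplus> y \<in> conductor C" using xy subringE(7)[OF A] by (auto simp: conductor_def)
next
  have Cc: "x \<in> carrier R" if "x \<in> C" for x using subringE(1)[OF C(1)] that by blast
  fix c x assume c: "c \<in> C" and x: "x \<in> conductor C"
  have xA: "x \<in> A" using x by (simp add: conductor_def)
  have "(c \<otimes> x) \<otimes> d \<in> A" if d: "d \<in> C" for d
  proof -
    have "(c \<otimes> x) \<otimes> d = x \<otimes> (c \<otimes> d)" using c d Cc A_closed[OF xA] by (simp add: m_ac)
    then show ?thesis using x subringE(6)[OF C(1) c d] by (simp add: conductor_def)
  qed
  moreover have "c \<otimes> x \<in> A"
    using x c m_comm[OF Cc[OF c] A_closed[OF xA]] by (simp add: conductor_def)
  ultimately show "c \<otimes> x \<in> conductor C" by (simp add: conductor_def)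
qed

lemma conductor_subset: "conductor C \<subseteq> A"
  by (auto simp: conductor_def)

lemma ideal_subset_conductor:
  assumes "subring C R" "is_submodule R C J" "J \<subseteq> A"
  shows "J \<subseteq> conductor C"
proof
  fix x assume x: "x \<in> J"
  have "x \<otimes> c \<in> A" if "c \<in> C" for c
  proof -
    have "x \<otimes> c = c \<otimes> x"
      using that x subringE(1)[OF assms(1)] is_submoduleD(1)[OF assms(2)] m_comm by blast
    then show ?thesis using is_submoduleD(4)[OF assms(2) that x] assms(3) by auto
  qed
  then show "x \<in> conductor C" using x assms(3) by (auto simp: conductor_def)
qed

lemma central_closure_submodule:
  assumes "subring C R" "A \<subseteq> C"
  shows "is_submodule R C (central_closure C)"
  unfolding is_submodule_def
proof (intro conjI ballI)
  note C = subringE[OF assms(1)]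
  show "central_closure C \<subseteq> carrier R" using C(1) by (auto simp: central_closure_def)
  show "\<zero> \<in> central_closure C"
    using C(2) is_submoduleD(2)[OF cprimeD(1)] by (auto simp: central_closure_def)
  show "x \<oplus> y \<in> central_closure C" if "x \<in> central_closure C" "y \<in> central_closure C" for x y
    using that C(7) is_submoduleD(3)[OF cprimeD(1)] by (auto simp: central_closure_def)
  show "a \<otimes> x \<in> central_closure C" if "a \<in> C" "x \<in> central_closure C" for a x
    using that C(6) is_submoduleD(4)[OF cprimeD(1)] by (auto simp: central_closure_def)
qed

lemma conductor_subset_central_closure: "A \<subseteq> C \<Longrightarrow> conductor C \<subseteq> central_closure C"
  by (auto simp: conductor_def central_closure_def)

section \<open>The extension by \<open>J\<close> is centrally subintegral\<close>

lemma subring_plus_ideal: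
  assumes C: "subring C R" "A \<subseteq> C" and J: "is_submodule R C J" "J \<subseteq> C"
  defines "D \<equiv> {a \<oplus> j | a j. a \<in> A \<and> j \<in> J}"
  shows "subring D R" "A \<subseteq> D" "D \<subseteq> C" "J \<subseteq> D"
proof -
  note Cd = subringE[OF C(1)] note Ad = subringE[OF A] note Jd = is_submoduleD[OF J(1)]
  have sm: "is_submodule R A J" using J(1) C(2) by (rule submodule_restrict)
  show AD: "A \<subseteq> D"
  proof
    fix a assume "a \<in> A"
    then have "a = a \<oplus> \<zero>" using A_closed by simp
    then show "a \<in> D" unfolding D_def using Jd(2) \<open>a \<in> A\<close> by blast
  qed
  show "J \<subseteq> D"
  proof
    fix a assume "a \<in> J"
    then have "a = \<zero> \<oplus> a" using Jd(1) by simp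
    then show "a \<in> D" unfolding D_def using Ad(2) \<open>a \<in> J\<close> by blast
  qed
  show "D \<subseteq> C" using C(2) J(2) Cd(7) by (auto simp: D_def)
  show "subring D R"
  proof (rule subringI)
    show "D \<subseteq> carrier R" using A_closed Jd(1) by (auto simp: D_def)
    show "\<one> \<in> D" using AD Ad(3) by blast
    fix x assume "x \<in> D"
    then obtain a j where x: "a \<in> A" "j \<in> J" "x = a \<oplus> j" by (auto simp: D_def)
    have "\<ominus> x = \<ominus> a \<oplus> \<ominus> j" using x A_closed Jd(1) by (simp add: minus_add)
    then show "\<ominus> x \<in> D"
      unfolding D_def using Ad(5)[OF x(1)] submodule_uminus[OF A sm x(2)] by blast
    fix y assume "y \<in> D"
    then obtain b k where y: "b \<in> A" "k \<in> J" "y = b \<oplus> k" by (auto simp: D_def)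
    have c: "a \<in> carrier R" "b \<in> carrier R" "j \<in> carrier R" "k \<in> carrier R"
      using x y A_closed Jd(1) by auto
    have "x \<oplus> y = (a \<oplus> b) \<oplus> (j \<oplus> k)" unfolding x(3) y(3) using c by algebra
    then show "x \<oplus> y \<in> D" unfolding D_def using Ad(7) Jd(3) x y by blast
    have "x \<otimes> y = (a \<otimes> b) \<oplus> (a \<otimes> k \<oplus> (b \<otimes> j \<oplus> j \<otimes> k))"
      unfolding x(3) y(3) using c by algebra
    moreover have "a \<otimes> k \<oplus> (b \<otimes> j \<oplus> j \<otimes> k) \<in> J"
      using x y C(2) J(2) by (intro Jd(3,4)) auto
    ultimately show "x \<otimes> y \<in> D" unfolding D_def using Ad(6) x y by blast
  qed
qed

text \<open>One fraction \<open>a / s\<close> represents \<open>x\<close> at all central primes of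
  \<open>D\<close> over \<open>p\<close> at once, which serves both injectivity of contraction and
  equality of residue fields. If the conductor lies in \<open>p\<close>, write
  \<open>x = a + j\<close> and take \<open>s = 1\<close>, as \<open>j\<close> vanishes at all these
  primes; otherwise an \<open>s\<close> in the conductor but outside \<open>p\<close> moves
  \<open>x\<close> into \<open>A\<close>.\<close>

lemma fibre_values:
  assumes C: "subring C R" "A \<subseteq> C" and D: "D = {a \<oplus> j | a j. a \<in> A \<and> j \<in> central_closure C}"
    and p: "cprime A p" and x: "x \<in> D"
  shows "\<exists>a\<in>A. \<exists>s\<in>A. s \<notin> p \<and> (\<forall>Q. cprime D Q \<longrightarrow> Q \<inter> A = p \<longrightarrow> s \<otimes> x \<ominus> a \<in> Q)"
proof -
  let ?J = "central_closure C"
  have JC: "?J \<subseteq> C" by (auto simp: central_closure_def)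
  note Ds = subring_plus_ideal[OF C central_closure_submodule[OF C] JC, folded D]
  show ?thesis
  proof (cases "conductor C \<subseteq> p")
    case True
    obtain a j where aj: "a \<in> A" "j \<in> ?J" "x = a \<oplus> j" using x D by blast
    have c: "a \<in> carrier R" "j \<in> carrier R"
      using aj A_closed JC subringE(1)[OF C(1)] by auto
    have "\<one> \<otimes> x \<ominus> a \<in> Q" if Q: "cprime D Q" "Q \<inter> A = p" for Q
    proof -
      \<comment> \<open>\<open>J\<close> is cut out by central primes of \<open>C\<close>, so
        \<open>Q\<close> is first lifted to one of those.\<close>
      obtain Q' where Q': "cprime C Q'" "Q' \<inter> D = Q"
        using lying_over[OF Ds(1,2) C(1) Ds(3) Q(1)] by blast
      have "conductor C \<subseteq> Q'" using True Q(2) Q'(2) by blast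
      then have "j \<in> Q'" using aj(2) Q'(1) by (auto simp: central_closure_def)
      then have "j \<in> Q" using Q'(2) aj(2) Ds(4) by blast
      moreover have "\<one> \<otimes> x \<ominus> a = j" unfolding aj(3) using c by algebra
      ultimately show ?thesis by simp
    qed
    then show ?thesis using aj(1) subringE(3)[OF A] cprimeD(3)[OF p] by blast
  next
    case False
    then obtain s where s: "s \<in> conductor C" "s \<notin> p" by blast
    have sx: "s \<otimes> x \<in> A" "s \<in> A" using s x Ds(3) by (auto simp: conductor_def)
    have "s \<otimes> x \<ominus> s \<otimes> x = \<zero>" using A_closed[OF sx(1)] by (simp add: a_minus_def r_neg)
    then show ?thesis using sx s(2) is_submoduleD(2)[OF cprimeD(1)] by metis
  qed
qed

lemma subintegral_plus_central_closure:
  assumes C: "subring C R" "A \<subseteq> C"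
  shows "subintegral {a \<oplus> j | a j. a \<in> A \<and> j \<in> central_closure C}"
proof -
  define D where D: "D = {a \<oplus> j | a j. a \<in> A \<and> j \<in> central_closure C}"
  have JC: "central_closure C \<subseteq> C" by (auto simp: central_closure_def)
  note Ds = subring_plus_ideal[OF C central_closure_submodule[OF C] JC, folded D]
  \<comment> \<open>Two central primes with the same trace on \<open>A\<close> are compared through
    a fraction \<open>a / s\<close> representing \<open>x\<close> at both: \<open>x \<in> Q\<close>
    gives \<open>a \<in> Q \<inter> A = Q' \<inter> A\<close>, hence \<open>s x \<in> Q'\<close>
    with \<open>s \<notin> Q'\<close>.\<close>
  have sub: "Q \<subseteq> Q'" if Q: "cprime D Q" "cprime D Q'" "Q \<inter> A = Q' \<inter> A" for Q Q'
  proof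
    fix x assume x: "x \<in> Q"
    then have xD: "x \<in> D" using cprimeD(2)[OF Q(1)] by blast
    obtain a s where as: "a \<in> A" "s \<in> A" "s \<notin> Q \<inter> A" "s \<otimes> x \<ominus> a \<in> Q" "s \<otimes> x \<ominus> a \<in> Q'"
      using fibre_values[OF C D cprime_contract[OF A Ds(2) Q(1)] xD] Q by metis
    have c: "s \<in> carrier R" "x \<in> carrier R" "a \<in> carrier R"
      using as xD A_closed subringE(1)[OF Ds(1)] by auto
    note Q1 = is_submoduleD[OF cprimeD(1)[OF Q(1)]] submodule_minus[OF Ds(1) cprimeD(1)[OF Q(1)]]
    note Q2 = is_submoduleD[OF cprimeD(1)[OF Q(2)]]
    have "s \<otimes> x \<in> Q" using Q1(4) as(2) x Ds(2) by blast
    then have "s \<otimes> x \<ominus> (s \<otimes> x \<ominus> a) \<in> Q" using Q1(5) as(4) by blast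
    moreover have "s \<otimes> x \<ominus> (s \<otimes> x \<ominus> a) = a" using c by algebra
    ultimately have "a \<in> Q'" using Q(3) as(1) by auto
    then have "(s \<otimes> x \<ominus> a) \<oplus> a \<in> Q'" using Q2(3) as(5) by blast
    moreover have "(s \<otimes> x \<ominus> a) \<oplus> a = s \<otimes> x" using c by algebra
    ultimately have "s \<in> Q' \<or> x \<in> Q'" using cprimeD(4)[OF Q(2)] as(2) Ds(2) xD by auto
    then show "x \<in> Q'" using as(2,3) Q(3) by blast
  qed
  have "bij_betw (\<lambda>Q. Q \<inter> A) {Q. cprime D Q} {p. cprime A p}"
  proof (rule bij_betw_imageI)
    show "inj_on (\<lambda>Q. Q \<inter> A) {Q. cprime D Q}"
      by (rule inj_onI) (use sub in \<open>simp add: subset_antisym\<close>)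
    have "\<exists>Q. cprime D Q \<and> Q \<inter> A = p" if "cprime A p" for p
      by (rule lying_over[OF A _ Ds(1,2) that]) simp
    then show "(\<lambda>Q. Q \<inter> A) ` {Q. cprime D Q} = {p. cprime A p}"
      using cprime_contract[OF A Ds(2)] by auto
  qed
  moreover have "\<exists>a\<in>A. \<exists>s\<in>A. s \<notin> Q \<and> s \<otimes> c \<ominus> a \<in> Q" if "cprime D Q" "c \<in> D" for Q c
    using fibre_values[OF C D cprime_contract[OF A Ds(2) that(1)] that(2)] that(1) by blast
  ultimately have "subintegral D" by (auto simp: subintegral_def)
  then show ?thesis by (simp only: D)
qed

text \<open>\<open>a / s\<close> plays the part of the element of k(p). It is chosen before
  \<open>q\<close>, since the residues of \<open>c\<close> at all central primes over
  \<open>p\<close> must come from one and the same element.\<close>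

definition gluing :: "'b set \<Rightarrow> 'b set \<Rightarrow> 'b set" where
  "gluing C p = {c\<in>C. \<exists>a\<in>A. \<exists>s\<in>A. s \<notin> p \<and>
     (\<forall>q. cprime C q \<longrightarrow> q \<inter> A = p \<longrightarrow> s \<otimes> c \<ominus> a \<in> q)}"

lemma gluing_subset: "gluing C p \<subseteq> C"
  by (auto simp: gluing_def)

lemma gluingI:
  assumes "c \<in> C" "a \<in> A" "s \<in> A" "s \<notin> p"
    and "\<And>q. cprime C q \<Longrightarrow> q \<inter> A = p \<Longrightarrow> s \<otimes> c \<ominus> a \<in> q"
  shows "c \<in> gluing C p"
  using assms by (auto simp: gluing_def)

lemma gluing_subring:
  assumes C: "subring C R" "A \<subseteq> C" and p: "cprime A p"
  shows "subring (gluing C p) R" "A \<subseteq> gluing C p"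
proof -
  note Cd = subringE[OF C(1)] note Ad = subringE[OF A]
  have Cc: "x \<in> carrier R" if "x \<in> C" for x using Cd(1) that by blast
  show AG: "A \<subseteq> gluing C p"
  proof
    fix a assume a: "a \<in> A"
    have "\<one> \<otimes> a \<ominus> a = \<zero>" using A_closed[OF a] by (simp add: a_minus_def r_neg)
    then show "a \<in> gluing C p"
      using a C(2) Ad(3) cprimeD(3)[OF p] is_submoduleD(2)[OF cprimeD(1)]
      by (intro gluingI[of _ _ a \<one>]) auto
  qed
  show "subring (gluing C p) R"
  proof (rule subringI)
    show "gluing C p \<subseteq> carrier R" using Cc by (auto simp: gluing_def)
    show "\<one> \<in> gluing C p" using AG Ad(3) by blast
    fix x assume "x \<in> gluing C p"
    then obtain a s where x: "x \<in> C" "a \<in> A" "s \<in> A" "s \<notin> p"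
      "\<And>q. cprime C q \<Longrightarrow> q \<inter> A = p \<Longrightarrow> s \<otimes> x \<ominus> a \<in> q" by (auto simp: gluing_def)
    have cx: "x \<in> carrier R" "a \<in> carrier R" "s \<in> carrier R" using x A_closed Cc by auto
    show "\<ominus> x \<in> gluing C p"
    proof (rule gluingI[of _ _ "\<ominus> a" s])
      fix q assume q: "cprime C q" "q \<inter> A = p"
      have "s \<otimes> (\<ominus> x) \<ominus> (\<ominus> a) = \<ominus> (s \<otimes> x \<ominus> a)" using cx by algebra
      then show "s \<otimes> (\<ominus> x) \<ominus> (\<ominus> a) \<in> q"
        using submodule_uminus[OF C(1) cprimeD(1)] x(5) q by simp
    qed (use x Cd(5) Ad(5) in auto)
    fix y assume "y \<in> gluing C p"
    then obtain b t where y: "y \<in> C" "b \<in> A" "t \<in> A" "t \<notin> p"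
      "\<And>q. cprime C q \<Longrightarrow> q \<inter> A = p \<Longrightarrow> t \<otimes> y \<ominus> b \<in> q" by (auto simp: gluing_def)
    have cy: "y \<in> carrier R" "b \<in> carrier R" "t \<in> carrier R" using y A_closed Cc by auto
    have st: "s \<otimes> t \<in> A" "s \<otimes> t \<notin> p" using Ad(6) cprimeD(4)[OF p] x y by blast+
    show "x \<oplus> y \<in> gluing C p"
    proof (rule gluingI[of _ _ "t \<otimes> a \<oplus> s \<otimes> b" "s \<otimes> t"])
      fix q assume q: "cprime C q" "q \<inter> A = p"
      note qd = is_submoduleD[OF cprimeD(1)[OF q(1)]]
      have "(s \<otimes> t) \<otimes> (x \<oplus> y) \<ominus> (t \<otimes> a \<oplus> s \<otimes> b) = t \<otimes> (s \<otimes> x \<ominus> a) \<oplus> s \<otimes> (t \<otimes> y \<ominus> b)"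
        using cx cy by algebra
      also have "\<dots> \<in> q" using x y q C(2) by (intro qd(3,4)) auto
      finally show "(s \<otimes> t) \<otimes> (x \<oplus> y) \<ominus> (t \<otimes> a \<oplus> s \<otimes> b) \<in> q" .
    qed (use x y st Cd(7) Ad(6,7) in auto)
    show "x \<otimes> y \<in> gluing C p"
    proof (rule gluingI[of _ _ "a \<otimes> b" "s \<otimes> t"])
      fix q assume q: "cprime C q" "q \<inter> A = p"
      note qd = is_submoduleD[OF cprimeD(1)[OF q(1)]]
      have "(s \<otimes> t) \<otimes> (x \<otimes> y) \<ominus> a \<otimes> b = (t \<otimes> y) \<otimes> (s \<otimes> x \<ominus> a) \<oplus> a \<otimes> (t \<otimes> y \<ominus> b)"
        using cx cy by algebra
      also have "\<dots> \<in> q" using x y q C(2) Cd(6) by (intro qd(3,4)) auto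
      finally show "(s \<otimes> t) \<otimes> (x \<otimes> y) \<ominus> a \<otimes> b \<in> q" .
    qed (use x y st Cd(6) Ad(6) in auto)
  qed
qed

section \<open>A gluing step that enlarges the conductor\<close>

lemma power_mem_cprime:
  assumes C: "subring C R" and Q: "cprime C Q" and v: "v \<in> C" and n: "n \<in> C"
  shows "v \<otimes> n [^] (k::nat) \<in> Q \<Longrightarrow> v \<otimes> n \<in> Q"
proof (induction k)
  case 0
  have "v \<in> Q" using 0 v subringE(1)[OF C] by auto
  then have "n \<otimes> v \<in> Q" using is_submoduleD(4)[OF cprimeD(1)[OF Q]] n by blast
  then show ?case using n v subringE(1)[OF C] m_comm by (metis subsetD)
next
  case (Suc k)
  have c: "v \<in> carrier R" "n \<in> carrier R" using n v subringE(1)[OF C] by auto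
  have nk: "n [^] k \<in> C" for k :: nat
    by (induction k) (use n subringE(3,6)[OF C] in auto)
  have "(v \<otimes> n [^] k) \<otimes> n \<in> Q" using Suc.prems c by (simp add: m_assoc)
  then have "v \<otimes> n [^] k \<in> Q \<or> n \<in> Q"
    using cprimeD(4)[OF Q] subringE(6)[OF C v nk] n by blast
  then show ?case using Suc.IH is_submoduleD(4)[OF cprimeD(1)[OF Q] v] by blast
qed

text \<open>An annihilator modulo \<open>I\<close> that is maximal is prime, as for associated
  primes. Centrality passes from \<open>I\<close> to \<open>(I : u)\<close> by multiplying
  \<open>a^2 + t\<close> with \<open>u^2\<close>; and \<open>u \<notin> p\<close>, because
  \<open>u^2 \<in> I\<close> would give \<open>u \<in> I\<close> by centrality with
  \<open>t = 0\<close>.\<close>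

lemma associated_central_prime:
  assumes I: "is_submodule R A I" "I \<subset> A" "\<one> \<notin> I"
    and central: "\<And>a t. a \<in> A \<Longrightarrow> t \<in> P \<Longrightarrow> a \<otimes> a \<oplus> t \<in> I \<Longrightarrow> a \<in> I"
  shows "\<exists>p u. cprime A p \<and> I \<subseteq> p \<and> u \<in> A \<and> u \<notin> p \<and> (\<forall>x\<in>p. x \<otimes> u \<in> I)"
proof -
  note Ad = subringE[OF A] note Id = is_submoduleD[OF I(1)]
  define ann where "ann u = {a\<in>A. a \<otimes> u \<in> I}" for u
  have sub: "is_submodule R A (ann u)" if u: "u \<in> A" for u
    unfolding is_submodule_def
  proof (intro conjI ballI)
    show "ann u \<subseteq> carrier R" using A_closed by (auto simp: ann_def)
    show "\<zero> \<in> ann u" using Ad(2) Id(2) A_closed u by (auto simp: ann_def)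
    show "x \<oplus> y \<in> ann u" if "x \<in> ann u" "y \<in> ann u" for x y
      using that Ad(7) Id(3) A_closed u by (auto simp: ann_def l_distr)
    show "a \<otimes> x \<in> ann u" if "a \<in> A" "x \<in> ann u" for a x
      using that Ad(6) Id(4) A_closed u by (auto simp: ann_def m_assoc)
  qed
  have "\<exists>M\<in>ann ` (A - I). \<forall>N\<in>ann ` (A - I). M \<subseteq> N \<longrightarrow> N = M"
    by (rule submodule_maximal[of R A]) (use noetherian I(2) sub in auto)
  then obtain u where u: "u \<in> A" "u \<notin> I"
    and max: "\<And>v. v \<in> A \<Longrightarrow> v \<notin> I \<Longrightarrow> ann u \<subseteq> ann v \<Longrightarrow> ann v = ann u" by auto
  have uc: "u \<in> carrier R" using u A_closed by blast
  have "cprime A (ann u)"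
    unfolding cprime_def
  proof (intro conjI ballI impI)
    show "is_submodule R A (ann u)" by (rule sub[OF u(1)])
    show "ann u \<subseteq> A" by (auto simp: ann_def)
    show "\<one> \<notin> ann u" using u uc by (simp add: ann_def)
    fix x y assume xy: "x \<in> A" "y \<in> A" "x \<otimes> y \<in> ann u"
    have c: "x \<in> carrier R" "y \<in> carrier R" using xy A_closed by auto
    show "x \<in> ann u \<or> y \<in> ann u"
    proof (rule disjCI)
      assume "y \<notin> ann u"
      then have v: "y \<otimes> u \<in> A" "y \<otimes> u \<notin> I" using xy u Ad(6) by (auto simp: ann_def)
      have "ann u \<subseteq> ann (y \<otimes> u)"
      proof
        fix z assume z: "z \<in> ann u"
        then have "y \<otimes> (z \<otimes> u) \<in> I" using Id(4) xy by (auto simp: ann_def)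
        moreover have "y \<otimes> (z \<otimes> u) = z \<otimes> (y \<otimes> u)"
          using z A_closed c uc by (auto simp: ann_def m_ac)
        ultimately show "z \<in> ann (y \<otimes> u)" using z by (simp add: ann_def)
      qed
      then have "ann (y \<otimes> u) = ann u" by (rule max[OF v])
      moreover have "x \<in> ann (y \<otimes> u)" using xy c uc by (simp add: ann_def m_assoc)
      ultimately show "x \<in> ann u" by simp
    qed
  next
    fix a t assume a: "a \<in> A" "t \<in> P" "a \<otimes> a \<oplus> t \<in> ann u"
    have c: "a \<in> carrier R" "t \<in> carrier R" using a A_closed P_closed by auto
    have "u \<otimes> ((a \<otimes> a \<oplus> t) \<otimes> u) \<in> I" using a Id(4) u by (auto simp: ann_def)
    moreover have "u \<otimes> ((a \<otimes> a \<oplus> t) \<otimes> u) = (a \<otimes> u) \<otimes> (a \<otimes> u) \<oplus> (u \<otimes> u) \<otimes> t"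
      using c uc by algebra
    ultimately have "a \<otimes> u \<in> I"
      using central[of "a \<otimes> u" "(u \<otimes> u) \<otimes> t"] a u Ad(6) P_mult P_square uc by auto
    then show "a \<in> ann u" using a by (simp add: ann_def)
  qed
  moreover have "I \<subseteq> ann u"
  proof
    fix x assume x: "x \<in> I"
    then have "u \<otimes> x \<in> I" using Id(4) u by blast
    then show "x \<in> ann u" using x I(2) Id(1) uc by (auto simp: ann_def m_comm)
  qed
  moreover have "u \<notin> ann u"
    using central[OF u(1) zero_in_P] u uc by (auto simp: ann_def)
  ultimately show ?thesis using u by (auto simp: ann_def)
qed

text \<open>The multipliers of finitely many generators are multiplied together, and primality keeps
  the product outside \<open>p\<close>. The elements that \<open>w\<close> carries into
  \<open>A\<close> form a submodule, so generators suffice.\<close>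

lemma common_multiplier:
  assumes p: "cprime A p" and N: "is_submodule R A N"
    and ex: "\<And>c. c \<in> N \<Longrightarrow> \<exists>w\<in>A. w \<notin> p \<and> w \<otimes> c \<in> A"
  shows "\<exists>w\<in>A. w \<notin> p \<and> (\<forall>c\<in>N. w \<otimes> c \<in> A)"
proof -
  note Ad = subringE[OF A]
  have Nc: "x \<in> carrier R" if "x \<in> N" for x using is_submoduleD(1)[OF N that] .
  obtain Y where Y: "finite Y" "Y \<subseteq> N" "\<And>M. is_submodule R A M \<Longrightarrow> Y \<subseteq> M \<Longrightarrow> N \<subseteq> M"
    using noetherian[OF N] by (auto simp: fin_generated_def)
  have "\<exists>w\<in>A. w \<notin> p \<and> (\<forall>c\<in>Y. w \<otimes> c \<in> A)" using Y(1,2)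
  proof (induction Y rule: finite_induct)
    case empty
    then show ?case using Ad(3) cprimeD(3)[OF p] by auto
  next
    case (insert y Y)
    obtain w where w: "w \<in> A" "w \<notin> p" "\<And>c. c \<in> Y \<Longrightarrow> w \<otimes> c \<in> A" using insert by auto
    obtain v where v: "v \<in> A" "v \<notin> p" "v \<otimes> y \<in> A" using ex[of y] insert.prems by blast
    have "(v \<otimes> w) \<otimes> c \<in> A" if c: "c \<in> insert y Y" for c
    proof -
      have cc: "c \<in> carrier R" "v \<in> carrier R" "w \<in> carrier R"
        using c insert.prems Nc v(1) w(1) A_closed by auto
      have "(v \<otimes> w) \<otimes> c = v \<otimes> (w \<otimes> c)" "(v \<otimes> w) \<otimes> c = w \<otimes> (v \<otimes> c)"
        using cc by (simp_all add: m_ac)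
      then show ?thesis using c v(1,3) w(1,3) Ad(6) by (metis insertE)
    qed
    moreover have "v \<otimes> w \<in> A" "v \<otimes> w \<notin> p" using cprimeD(4)[OF p] Ad(6) v w by blast+
    ultimately show ?case by blast
  qed
  then obtain w where w: "w \<in> A" "w \<notin> p" "\<And>c. c \<in> Y \<Longrightarrow> w \<otimes> c \<in> A" by blast
  have wc: "w \<in> carrier R" using w A_closed by blast
  have "is_submodule R A {c\<in>carrier R. w \<otimes> c \<in> A}"
    unfolding is_submodule_def
  proof (intro conjI ballI)
    show "\<zero> \<in> {c\<in>carrier R. w \<otimes> c \<in> A}" using wc Ad(2) by simp
    show "x \<oplus> y \<in> {c\<in>carrier R. w \<otimes> c \<in> A}"
      if "x \<in> {c\<in>carrier R. w \<otimes> c \<in> A}" "y \<in> {c\<in>carrier R. w \<otimes> c \<in> A}" for x y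
      using that wc Ad(7) by (simp add: r_distr)
    show "a \<otimes> x \<in> {c\<in>carrier R. w \<otimes> c \<in> A}"
      if a: "a \<in> A" "x \<in> {c\<in>carrier R. w \<otimes> c \<in> A}" for a x
    proof -
      have "w \<otimes> (a \<otimes> x) = a \<otimes> (w \<otimes> x)" using a wc A_closed[OF a(1)] by (simp add: m_lcomm)
      then show ?thesis using a Ad(6) A_closed by auto
    qed
  qed auto
  from Y(3)[OF this] have "N \<subseteq> {c\<in>carrier R. w \<otimes> c \<in> A}" using Y(2) Nc w(3) by blast
  then show ?thesis using w(1,2) by blast
qed

lemma gluing_enlarges_conductor:
  assumes normal: "\<And>D. subring D R \<Longrightarrow> A \<subseteq> D \<Longrightarrow> subintegral D \<Longrightarrow> D \<subseteq> A"
    and C: "subring C R" "A \<subseteq> C" "C \<noteq> A"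
  shows "\<exists>p. cprime A p \<and> conductor C \<subset> conductor (gluing C p)"
proof -
  note Ad = subringE[OF A] note Cd = subringE[OF C(1)]
  have Cc: "x \<in> carrier R" if "x \<in> C" for x using Cd(1) that by blast
  define I where "I = conductor C"
  have JC: "central_closure C \<subseteq> C" by (auto simp: central_closure_def)
  have Isub: "is_submodule R C I" unfolding I_def by (rule conductor_submodule[OF C(1,2)])
  note Id = is_submoduleD[OF Isub]
  have IA: "I \<subseteq> A" unfolding I_def by (rule conductor_subset)
  note Js = central_closure_submodule[OF C(1,2)]
  note Ds = subring_plus_ideal[OF C(1,2) Js JC]
  \<comment> \<open>Here seminormality is applied. As \<open>J\<close> is an ideal of
    \<open>C\<close>, lying inside \<open>A\<close> already puts it inside the conductor.\<close>
  have "central_closure C \<subseteq> A"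
    using Ds(4) normal[OF Ds(1,2) subintegral_plus_central_closure[OF C(1,2)]] by blast
  then have J: "central_closure C = I"
    using ideal_subset_conductor[OF C(1) Js] conductor_subset_central_closure[OF C(2)]
    by (auto simp: I_def)
  then have mem_I: "c \<in> I" if "c \<in> C" "\<And>Q. cprime C Q \<Longrightarrow> I \<subseteq> Q \<Longrightarrow> c \<in> Q" for c
    using that by (auto simp: central_closure_def I_def)
  have central: "a \<in> I" if "a \<in> C" "t \<in> P" "a \<otimes> a \<oplus> t \<in> I" for a t
    using that by (intro mem_I) (auto dest: cprimeD(5))
  have one: "\<one> \<notin> I"
  proof
    assume "\<one> \<in> I"
    then have "\<one> \<otimes> c \<in> A" if "c \<in> C" for c using that unfolding I_def conductor_def by blast
    then show False using C Cc by auto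
  qed
  have IA': "I \<subset> A" using IA one Ad(3) by blast
  obtain p u where p: "cprime A p" "I \<subseteq> p" and u: "u \<in> A" "u \<notin> p" "\<And>x. x \<in> p \<Longrightarrow> x \<otimes> u \<in> I"
    using associated_central_prime[OF submodule_restrict[OF Isub C(2)] IA' one] central C(2)
    by blast
  have "\<exists>w\<in>A. w \<notin> p \<and> w \<otimes> c \<in> A" if c: "c \<in> gluing C p" for c
  proof -
    obtain a s where as: "c \<in> C" "a \<in> A" "s \<in> A" "s \<notin> p"
      "\<And>q. cprime C q \<Longrightarrow> q \<inter> A = p \<Longrightarrow> s \<otimes> c \<ominus> a \<in> q" using c by (auto simp: gluing_def)
    \<comment> \<open>\<open>n\<close> lies in every central \<open>q\<close> over \<open>p\<close>.
      Once \<open>v n \<in> I \<subseteq> A\<close> for some \<open>v \<notin> p\<close>, the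
      multiplier \<open>v s\<close> carries \<open>c\<close> into \<open>A\<close>, because
      \<open>v s c = v n + v a\<close>.\<close>
    define n where "n = s \<otimes> c \<ominus> a"
    have n: "n \<in> C" unfolding n_def using as C(2) Cd(6) by (intro subring_minus[OF C(1)]) auto
    have nk: "n [^] k \<in> C" for k :: nat by (induction k) (use n Cd(3,6) in auto)
    have "\<exists>v\<in>A. v \<notin> p \<and> v \<otimes> n \<in> I"
    proof (rule ccontr)
      assume no: "\<not> ?thesis"
      \<comment> \<open>A central prime of \<open>C\<close> over \<open>I\<close> that misses
        \<open>S\<close> contracts into \<open>p\<close> and does not contain \<open>n\<close>.
        Minimality of \<open>p\<close> makes the contraction equal to \<open>p\<close>, and then
        \<open>n\<close> must belong to it. All powers of \<open>n\<close> are included to make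
        \<open>S\<close> multiplicatively closed.\<close>
      define S where "S = {v \<otimes> n [^] k | v (k::nat). v \<in> A \<and> v \<notin> p}"
      have "\<exists>Q. cprime C Q \<and> I \<subseteq> Q \<and> Q \<inter> S = {}"
      proof (rule avoiding_ideal_extend[OF C(1)])
        show SC: "S \<subseteq> C" using C(2) Cd(6) nk by (auto simp: S_def)
        show "S \<noteq> {}" using Ad(3) cprimeD(3)[OF p(1)] by (auto simp: S_def)
        fix s t assume st: "s \<in> S" "t \<in> S"
        then obtain v k w l where e: "v \<in> A" "v \<notin> p" "w \<in> A" "w \<notin> p"
          "s = v \<otimes> n [^] (k::nat)" "t = w \<otimes> n [^] (l::nat)" by (auto simp: S_def)
        have "s \<otimes> t = (v \<otimes> w) \<otimes> n [^] (k + l)"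
          using e A_closed Cc[OF n] by (simp add: nat_pow_mult[symmetric] m_ac)
        then show "s \<otimes> t \<in> S" using e Ad(6) cprimeD(4)[OF p(1)] unfolding S_def by blast
      next
        fix s t assume st: "s \<in> S" "t \<in> P"
        then obtain v k where e: "v \<in> A" "v \<notin> p" "s = v \<otimes> n [^] (k::nat)" by (auto simp: S_def)
        show "s \<otimes> s \<oplus> t \<notin> I"
        proof
          assume "s \<otimes> s \<oplus> t \<in> I"
          \<comment> \<open>Centrality of \<open>I\<close> leaves \<open>v n^k \<in> I\<close>;
            since \<open>I\<close> is an intersection of central primes, the exponent can then be
            lowered to 1.\<close>
          then have sI: "v \<otimes> n [^] k \<in> I"
            using central[OF _ st(2)] e C(2) Cd(6) nk by auto
          have "v \<otimes> n \<in> I"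
          proof (rule mem_I)
            show "v \<otimes> n \<in> C" using e(1) C(2) n Cd(6) by blast
            show "v \<otimes> n \<in> Q" if "cprime C Q" "I \<subseteq> Q" for Q
              using power_mem_cprime[OF C(1) that(1) _ n] sI that(2) e(1) C(2) by blast
          qed
          then show False using no e by blast
        qed
      qed (use Isub IA C(2) in auto)
      then obtain Q where Q: "cprime C Q" "I \<subseteq> Q" "Q \<inter> S = {}" by blast
      have vS: "v \<in> S" if "v \<in> A" "v \<notin> p" for v
      proof -
        have "v = v \<otimes> n [^] (0::nat)" using that A_closed by simp
        then show ?thesis using that unfolding S_def by blast
      qed
      have nS: "n \<in> S"
      proof -
        have "n = \<one> \<otimes> n [^] (1::nat)" using Cc[OF n] by simp
        then show ?thesis using Ad(3) cprimeD(3)[OF p(1)] unfolding S_def by blast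
      qed
      \<comment> \<open>Minimality of \<open>p\<close> in action:
        \<open>x u \<in> I \<subseteq> Q\<close>, while \<open>u\<close> belongs to \<open>S\<close>
        and so is outside \<open>Q\<close>.\<close>
      have "x \<in> Q" if x: "x \<in> p" for x
      proof -
        have "x \<otimes> u \<in> Q" using u(3)[OF x] Q(2) by blast
        then show ?thesis
          using cprimeD(4)[OF Q(1), of x u] cprimeD(2)[OF p(1) x] u C(2) Q(3) vS[OF u(1,2)] by blast
      qed
      then have "Q \<inter> A = p" using Q(3) vS cprimeD(2)[OF p(1)] by blast
      then have "n \<in> Q" using as(5) Q(1) by (simp add: n_def)
      then show False using nS Q(3) by blast
    qed
    then obtain v where v: "v \<in> A" "v \<notin> p" "v \<otimes> n \<in> I" by blast
    have cc: "v \<in> carrier R" "s \<in> carrier R" "c \<in> carrier R" "a \<in> carrier R"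
      using v as A_closed Cc by auto
    have "(v \<otimes> s) \<otimes> c = v \<otimes> n \<oplus> v \<otimes> a" unfolding n_def using cc by algebra
    also have "\<dots> \<in> A" using v IA as Ad(6,7) by blast
    finally show ?thesis
      using Ad(6) cprimeD(4)[OF p(1)] v(1,2) as(3,4) by blast
  qed
  note Gs = gluing_subring[OF C(1,2) p(1)]
  have "is_submodule R (gluing C p) (gluing C p)"
    using subringE[OF Gs(1)] by (simp add: is_submodule_def)
  then have "is_submodule R A (gluing C p)" using Gs(2) by (rule submodule_restrict)
  from common_multiplier[OF p(1) this] obtain w where
    w: "w \<in> A" "w \<notin> p" "\<And>c. c \<in> gluing C p \<Longrightarrow> w \<otimes> c \<in> A"
    using \<open>\<And>c. c \<in> gluing C p \<Longrightarrow> \<exists>w\<in>A. w \<notin> p \<and> w \<otimes> c \<in> A\<close> by blast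
  have "w \<in> conductor (gluing C p)" using w by (simp add: conductor_def)
  moreover have "w \<notin> conductor C" using w(2) p(2) by (auto simp: I_def)
  moreover have "conductor C \<subseteq> conductor (gluing C p)"
    using gluing_subset by (fastforce simp: conductor_def)
  ultimately show ?thesis using p(1) by blast
qed

text \<open>Noetherian induction by contradiction: among the rings that no sequence joins to
  \<open>A\<close>, take \<open>E\<close> with maximal conductor. Its gluing has a strictly larger
  conductor, hence a sequence starts there, and one more step in front makes it start at
  \<open>E\<close>.\<close>

theorem gluing_sequence:
  assumes normal: "\<And>D. subring D R \<Longrightarrow> A \<subseteq> D \<Longrightarrow> subintegral D \<Longrightarrow> D \<subseteq> A"
    and C: "subring C R" "A \<subseteq> C"
  shows "\<exists>n Cs. Cs 0 = C \<and> Cs n = A \<and>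
    (\<forall>i<(n::nat). \<exists>p. cprime A p \<and> Cs (Suc i) = gluing (Cs i) p)"
proof (rule ccontr)
  define good where "good C \<longleftrightarrow> (\<exists>n Cs. Cs 0 = C \<and> Cs n = A \<and>
    (\<forall>i<(n::nat). \<exists>p. cprime A p \<and> Cs (Suc i) = gluing (Cs i) p))" for C
  define Bad where "Bad = {C. subring C R \<and> A \<subseteq> C \<and> \<not> good C}"
  assume "\<not> ?thesis"
  then have "C \<in> Bad" using C by (simp add: good_def Bad_def)
  then have "\<exists>M\<in>conductor ` Bad. \<forall>N\<in>conductor ` Bad. M \<subseteq> N \<longrightarrow> N = M"
    by (intro submodule_maximal[of R A])
      (auto simp: Bad_def intro: noetherian submodule_restrict conductor_submodule)
  then obtain E where E: "subring E R" "A \<subseteq> E" "\<not> good E"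
    and max: "\<And>F. F \<in> Bad \<Longrightarrow> conductor E \<subseteq> conductor F \<Longrightarrow> conductor F = conductor E"
    by (auto simp: Bad_def)
  have "good A" unfolding good_def by (rule exI[of _ 0], rule exI[of _ "\<lambda>_. A"]) simp
  then have "E \<noteq> A" using E(3) by blast
  from gluing_enlarges_conductor[OF normal E(1,2) this] obtain p where
    p: "cprime A p" "conductor E \<subset> conductor (gluing E p)" by blast
  have "good (gluing E p)"
    using max[of "gluing E p"] p gluing_subring[OF E(1,2) p(1)] by (auto simp: Bad_def)
  then obtain n Cs where Cs: "Cs 0 = gluing E p" "Cs n = A"
    "\<And>i. i < (n::nat) \<Longrightarrow> \<exists>p. cprime A p \<and> Cs (Suc i) = gluing (Cs i) p"
    unfolding good_def by blast
  \<comment> \<open>\<open>case_nat E Cs\<close> puts \<open>E\<close> in front, so its entry at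
    \<open>Suc i\<close> is \<open>Cs i\<close>; hence the unshifted \<open>Cs i\<close> on the
    left.\<close>
  have "\<exists>p. cprime A p \<and> Cs i = gluing (case_nat E Cs i) p" if "i < Suc n" for i
    using that Cs p(1) by (cases i) auto
  then have "good E"
    unfolding good_def using Cs by (intro exI[of _ "Suc n"] exI[of _ "case_nat E Cs"]) auto
  then show False using E(3) by blast
qed

end

section \<open>Noetherian modules and integrality\<close>

lemma submodule_Inter:
  assumes "is_submodule R A M0" "M0 \<in> \<M>" "\<And>M. M \<in> \<M> \<Longrightarrow> is_submodule R A M"
  shows "is_submodule R A (\<Inter>\<M>)"
  using assms is_submoduleD[OF assms(3)] unfolding is_submodule_def by blast

lemma (in cring) carrier_submodule:
  "A \<subseteq> carrier R \<Longrightarrow> is_submodule R A (carrier R)"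
  by (auto simp: is_submodule_def)

lemma (in cring) submodule_adjoin:
  assumes A: "subring A R" and L: "is_submodule R A L" and g: "g \<in> carrier R"
  shows "is_submodule R A {a \<otimes> g \<oplus> m | a m. a \<in> A \<and> m \<in> L}" (is "is_submodule R A ?M")
    and "g \<in> {a \<otimes> g \<oplus> m | a m. a \<in> A \<and> m \<in> L}" "L \<subseteq> {a \<otimes> g \<oplus> m | a m. a \<in> A \<and> m \<in> L}"
proof -
  note Ad = subringE[OF A] note Ld = is_submoduleD[OF L]
  have Ac: "a \<in> carrier R" if "a \<in> A" for a using Ad(1) that by blast
  have "g = \<one> \<otimes> g \<oplus> \<zero>" using g by simp
  then show "g \<in> ?M" using Ad(3) Ld(2) by blast
  show LM: "L \<subseteq> ?M"
  proof
    fix m assume m: "m \<in> L"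
    then have "m = \<zero> \<otimes> g \<oplus> m" using g Ld(1) by simp
    then show "m \<in> ?M" using m Ad(2) by blast
  qed
  show "is_submodule R A ?M"
    unfolding is_submodule_def
  proof (intro conjI ballI)
    show "?M \<subseteq> carrier R" using Ac g Ld(1) by auto
    show "\<zero> \<in> ?M" using LM Ld(2) by blast
    fix x y assume "x \<in> ?M" "y \<in> ?M"
    then obtain a m b n where e: "a \<in> A" "m \<in> L" "b \<in> A" "n \<in> L" "x = a \<otimes> g \<oplus> m" "y = b \<otimes> g \<oplus> n"
      by blast
    have "x \<oplus> y = (a \<oplus> b) \<otimes> g \<oplus> (m \<oplus> n)"
      unfolding e(5,6) using e(1,3)[THEN Ac] e(2,4)[THEN Ld(1)] g by algebra
    then show "x \<oplus> y \<in> ?M" using e Ad(7) Ld(3) by blast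
  next
    fix c x assume c: "c \<in> A" and "x \<in> ?M"
    then obtain a m where e: "a \<in> A" "m \<in> L" "x = a \<otimes> g \<oplus> m" by blast
    have "c \<otimes> x = (c \<otimes> a) \<otimes> g \<oplus> c \<otimes> m"
      unfolding e(3) using e(1)[THEN Ac] e(2)[THEN Ld(1)] g Ac[OF c] by algebra
    then show "c \<otimes> x \<in> ?M" using e c Ad(6) Ld(4) by blast
  qed
qed

text \<open>The analogue of a leading coefficient ideal: all coefficients that \<open>g\<close> can
  have in an element of \<open>N\<close> when it is written in \<open>A g + L\<close>.\<close>

lemma (in cring) coefficient_ideal:
  assumes A: "subring A R" and L: "is_submodule R A L" and N: "is_submodule R A N"
    and g: "g \<in> carrier R"
  shows "is_submodule R A {a\<in>A. \<exists>m\<in>L. a \<otimes> g \<oplus> m \<in> N}" (is "is_submodule R A ?I")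
  unfolding is_submodule_def
proof (intro conjI ballI)
  note Ad = subringE[OF A] note Ld = is_submoduleD[OF L] note Nd = is_submoduleD[OF N]
  have Ac: "a \<in> carrier R" if "a \<in> A" for a using Ad(1) that by blast
  show "?I \<subseteq> carrier R" using Ac by blast
  have "\<zero> \<otimes> g \<oplus> \<zero> \<in> N" using Nd(2) g by simp
  then show "\<zero> \<in> ?I" using Ad(2) Ld(2) by blast
  show "x \<oplus> y \<in> ?I" if xy: "x \<in> ?I" "y \<in> ?I" for x y
  proof -
    obtain m n where e: "x \<in> A" "m \<in> L" "x \<otimes> g \<oplus> m \<in> N" "y \<in> A" "n \<in> L" "y \<otimes> g \<oplus> n \<in> N"
      using xy by blast
    have "(x \<oplus> y) \<otimes> g \<oplus> (m \<oplus> n) = (x \<otimes> g \<oplus> m) \<oplus> (y \<otimes> g \<oplus> n)"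
      using e(1,4)[THEN Ac] e(2,5)[THEN Ld(1)] g by algebra
    then have "(x \<oplus> y) \<otimes> g \<oplus> (m \<oplus> n) \<in> N" using e Nd(3) by simp
    then show ?thesis using e Ad(7) Ld(3) by blast
  qed
  show "c \<otimes> x \<in> ?I" if cx: "c \<in> A" "x \<in> ?I" for c x
  proof -
    obtain m where e: "x \<in> A" "m \<in> L" "x \<otimes> g \<oplus> m \<in> N" using cx by blast
    have "(c \<otimes> x) \<otimes> g \<oplus> c \<otimes> m = c \<otimes> (x \<otimes> g \<oplus> m)"
      using Ac[OF e(1)] Ld(1)[OF e(2)] g Ac[OF cx(1)] by algebra
    then have "(c \<otimes> x) \<otimes> g \<oplus> c \<otimes> m \<in> N" using e Nd(4) cx by simp
    then show ?thesis using e Ad(6) Ld(4) cx by blast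
  qed
qed

text \<open>Induction on \<open>G\<close>, stated for every \<open>N\<close> inside the span of
  \<open>G\<close>. With \<open>L\<close> the span of the remaining generators, \<open>N\<close> is
  controlled by \<open>N \<inter> L\<close> and the ideal of \<open>g\<close>-coefficients, both
  finitely generated.\<close>

lemma (in cring) submodule_fin_generated:
  assumes A: "subring A R"
    and noeth: "\<And>I. is_submodule R A I \<Longrightarrow> I \<subseteq> A \<Longrightarrow> fin_generated R A I"
    and G: "finite G" "G \<subseteq> carrier R"
    and N: "is_submodule R A N" "\<And>M. is_submodule R A M \<Longrightarrow> G \<subseteq> M \<Longrightarrow> N \<subseteq> M"
  shows "fin_generated R A N"
  using G N
proof (induction G arbitrary: N rule: finite_induct)
  case empty
  then show ?case by (auto simp: fin_generated_def intro: exI[of _ "{}"])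
next
  case (insert g G)
  note Ad = subringE[OF A]
  have Ac: "a \<in> carrier R" if "a \<in> A" for a using Ad(1) that by blast
  have g: "g \<in> carrier R" "G \<subseteq> carrier R" using insert by auto
  note Nd = is_submoduleD[OF insert.prems(2)]
  define L where "L = \<Inter>{M. is_submodule R A M \<and> G \<subseteq> M}"
  have L: "is_submodule R A L"
    unfolding L_def by (rule submodule_Inter[OF carrier_submodule[OF Ad(1)]]) (use g carrier_submodule[OF Ad(1)] in auto)
  note Ld = is_submoduleD[OF L]
  have GL: "G \<subseteq> L" and Lmin: "\<And>M. is_submodule R A M \<Longrightarrow> G \<subseteq> M \<Longrightarrow> L \<subseteq> M"
    unfolding L_def by blast+
  define M0 where "M0 = {a \<otimes> g \<oplus> m | a m. a \<in> A \<and> m \<in> L}"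
  have NM0: "N \<subseteq> M0"
    unfolding M0_def using submodule_adjoin[OF A L g(1)] GL by (intro insert.prems(3)) auto
  define coeffs where "coeffs N' = {a\<in>A. \<exists>m\<in>L. a \<otimes> g \<oplus> m \<in> N'}" for N'
  have coeffs: "is_submodule R A (coeffs N')" if "is_submodule R A N'" for N'
    unfolding coeffs_def by (rule coefficient_ideal[OF A L that g(1)])
  have "fin_generated R A (coeffs N)"
    by (rule noeth[OF coeffs[OF insert.prems(2)]]) (auto simp: coeffs_def)
  then obtain S where S: "finite S" "S \<subseteq> coeffs N"
    "\<And>M. is_submodule R A M \<Longrightarrow> S \<subseteq> M \<Longrightarrow> coeffs N \<subseteq> M" by (auto simp: fin_generated_def)
  have "\<forall>a\<in>S. \<exists>m\<in>L. a \<otimes> g \<oplus> m \<in> N" using S(2) by (auto simp: coeffs_def)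
  then obtain h where h: "\<And>a. a \<in> S \<Longrightarrow> h a \<in> L" "\<And>a. a \<in> S \<Longrightarrow> a \<otimes> g \<oplus> h a \<in> N" by metis
  have NL: "is_submodule R A (N \<inter> L)" using insert.prems(2) L by (rule submodule_Int)
  have "fin_generated R A (N \<inter> L)"
    using insert.IH[OF g(2) NL] Lmin by blast
  then obtain Y where Y: "finite Y" "Y \<subseteq> N \<inter> L"
    "\<And>M. is_submodule R A M \<Longrightarrow> Y \<subseteq> M \<Longrightarrow> N \<inter> L \<subseteq> M" by (auto simp: fin_generated_def)
  \<comment> \<open>Generators of \<open>N \<inter> L\<close>, and one lift to \<open>N\<close> of
    each generator of the coefficient ideal.\<close>
  let ?Z = "Y \<union> (\<lambda>a. a \<otimes> g \<oplus> h a) ` S"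
  have "N \<subseteq> M" if M: "is_submodule R A M" "?Z \<subseteq> M" for M
  proof
    fix x assume x: "x \<in> N"
    have MN: "is_submodule R A (M \<inter> N)" using M(1) insert.prems(2) by (rule submodule_Int)
    \<comment> \<open>Coefficients are compared for \<open>M \<inter> N\<close> instead of
      \<open>M\<close>, so that the subtracted element lies in \<open>N\<close> too and the
      remainder falls into \<open>N \<inter> L\<close>.\<close>
    have "S \<subseteq> coeffs (M \<inter> N)"
    proof
      fix b assume b: "b \<in> S"
      then have "b \<otimes> g \<oplus> h b \<in> M \<inter> N" using M(2) h(2) by blast
      then show "b \<in> coeffs (M \<inter> N)" using b S(2) h(1) unfolding coeffs_def by blast
    qed
    then have sub: "coeffs N \<subseteq> coeffs (M \<inter> N)" by (rule S(3)[OF coeffs[OF MN]])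
    obtain a m where am: "a \<in> A" "m \<in> L" "x = a \<otimes> g \<oplus> m" using x NM0 by (auto simp: M0_def)
    then have "a \<in> coeffs N" using x by (auto simp: coeffs_def)
    then obtain n where n: "n \<in> L" "a \<otimes> g \<oplus> n \<in> M" "a \<otimes> g \<oplus> n \<in> N"
      using sub by (auto simp: coeffs_def)
    have c: "a \<in> carrier R" "m \<in> carrier R" "n \<in> carrier R" using am n Ac Ld(1) by auto
    have "x \<ominus> (a \<otimes> g \<oplus> n) = m \<ominus> n" unfolding am(3) using c g(1) by algebra
    moreover have "m \<ominus> n \<in> L" using submodule_minus[OF A L am(2) n(1)] .
    moreover have "x \<ominus> (a \<otimes> g \<oplus> n) \<in> N" using submodule_minus[OF A insert.prems(2) x n(3)] .
    ultimately have "m \<ominus> n \<in> M" using Y(3)[OF M(1)] M(2) by auto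
    then have "(a \<otimes> g \<oplus> n) \<oplus> (m \<ominus> n) \<in> M" using is_submoduleD(3)[OF M(1)] n(2) by blast
    moreover have "(a \<otimes> g \<oplus> n) \<oplus> (m \<ominus> n) = x" unfolding am(3) using c g(1) by algebra
    ultimately show "x \<in> M" by simp
  qed
  moreover have "finite ?Z" "?Z \<subseteq> N" using S(1) Y h(2) by auto
  ultimately show ?case unfolding fin_generated_def by blast
qed

lemma (in cring) power_span_submodule:
  assumes A: "subring A R" and x: "x \<in> carrier R"
  shows "is_submodule R A (power_span R A x k)"
proof (induction k)
  case 0
  show ?case using subringE(1)[OF A] by (auto simp: is_submodule_def)
next
  case (Suc k)
  have "power_span R A x (Suc k) = {a \<otimes> x [^] k \<oplus> m | a m. a \<in> A \<and> m \<in> power_span R A x k}"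
  proof -
    have "v \<oplus> a \<otimes> x [^] k = a \<otimes> x [^] k \<oplus> v" if "v \<in> power_span R A x k" "a \<in> A" for v a
      using is_submoduleD(1)[OF Suc that(1)] that(2) x subringE(1)[OF A] by (intro a_comm) auto
    then show ?thesis by (simp, metis (no_types, lifting))
  qed
  then show ?case using submodule_adjoin(1)[OF A Suc, of "x [^] k"] x by simp
qed

lemma (in cring) power_span_Suc:
  assumes A: "subring A R" and x: "x \<in> carrier R"
  shows "power_span R A x k \<subseteq> power_span R A x (Suc k)" "x [^] k \<in> power_span R A x (Suc k)"
proof -
  note d = is_submoduleD[OF power_span_submodule[OF A x, of k]]
  have e: "v = v \<oplus> \<zero> \<otimes> x [^] k" if "v \<in> power_span R A x k" for v
    using d(1)[OF that] x by simp
  show "power_span R A x k \<subseteq> power_span R A x (Suc k)"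
    unfolding power_span.simps using e subringE(2)[OF A] by blast
  have "x [^] k = \<zero> \<oplus> \<one> \<otimes> x [^] k" using x by simp
  then show "x [^] k \<in> power_span R A x (Suc k)"
    unfolding power_span.simps using d(2) subringE(3)[OF A] by blast
qed

text \<open>The spans of \<open>1, ..., x^(k-1)\<close> ascend and their union is finitely
  generated, so it equals one of them, which therefore contains \<open>x^k\<close>. This takes the
  place of the determinant argument for integrality.\<close>

lemma (in cring) power_in_power_span:
  assumes A: "subring A R" and x: "x \<in> carrier R"
    and noeth: "\<And>N. is_submodule R A N \<Longrightarrow> fin_generated R A N"
  shows "\<exists>k. x [^] k \<in> power_span R A x k"
proof -
  let ?W = "\<lambda>k. power_span R A x k"
  have mono: "?W k \<subseteq> ?W l" if "k \<le> l" for k l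
    using that power_span_Suc(1)[OF A x] by (rule lift_Suc_mono_le[rotated])
  have ch: "subset.chain {N. is_submodule R A N} (range ?W)"
  proof -
    have "?W k \<subseteq> ?W l \<or> ?W l \<subseteq> ?W k" for k l using mono nat_le_linear by blast
    then show ?thesis using power_span_submodule[OF A x] by (auto simp: subset_chain_def)
  qed
  then have "fin_generated R A (\<Union>(range ?W))" by (intro noeth submodule_Union_chain) auto
  then obtain Z where Z: "finite Z" "Z \<subseteq> \<Union>(range ?W)"
    "\<And>M. is_submodule R A M \<Longrightarrow> Z \<subseteq> M \<Longrightarrow> \<Union>(range ?W) \<subseteq> M" by (auto simp: fin_generated_def)
  obtain M where "M \<in> range ?W" "Z \<subseteq> M"
    by (rule finite_subset_Union_chain[OF Z(1,2) _ ch]) auto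
  then obtain k where "Z \<subseteq> ?W k" by blast
  then have "\<Union>(range ?W) \<subseteq> ?W k" by (rule Z(3)[OF power_span_submodule[OF A x]])
  then show ?thesis using power_span_Suc(2)[OF A x] by blast
qed

text \<open>Polynomials are coefficient lists with the highest degree first. Leading zeros are kept
  here, so the length is exactly \<open>k\<close> and one further head entry is the coefficient of
  \<open>x^k\<close>.\<close>

lemma (in ring) power_span_eval:
  assumes A: "A \<subseteq> carrier R" and x: "x \<in> carrier R"
  shows "v \<in> power_span R A x k \<Longrightarrow> \<exists>ps. set ps \<subseteq> A \<and> length ps = k \<and> eval ps x = v"
proof (induction k arbitrary: v)
  case (Suc k)
  then obtain u a where u: "u \<in> power_span R A x k" "a \<in> A" "v = u \<oplus> a \<otimes> x [^] k" by auto
  obtain ps where ps: "set ps \<subseteq> A" "length ps = k" "eval ps x = u" using Suc.IH[OF u(1)] by blast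
  have "u \<in> carrier R" using ps A x eval_in_carrier[of ps x] by auto
  then have "eval (a # ps) x = v" using ps u A x a_comm[of u] by auto
  then show ?case using ps u by (intro exI[of _ "a # ps"]) auto
qed simp

lemma (in cring) integral_polynomial:
  assumes A: "subring A R" and x: "x \<in> carrier R" and k: "x [^] k \<in> power_span R A x k"
    and one: "\<one> \<noteq> \<zero>"
  shows "\<exists>p\<in>carrier (univ_poly R A). p \<noteq> [] \<and> lead_coeff p = \<one> \<and> eval p x = \<zero>"
proof -
  have "\<ominus> (x [^] k) \<in> power_span R A x k"
    by (rule submodule_uminus[OF A power_span_submodule[OF A x] k])
  from power_span_eval[OF subringE(1)[OF A] x this] obtain ps where
    ps: "set ps \<subseteq> A" "length ps = k" "eval ps x = \<ominus> (x [^] k)" by blast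
  have "eval (\<one> # ps) x = \<zero>" using ps x by (simp add: r_neg)
  moreover have "\<one> # ps \<in> carrier (univ_poly R A)"
    using ps(1) subringE(3)[OF A] one by (simp add: univ_poly_def polynomial_def)
  ultimately show ?thesis by (intro bexI[of _ "\<one> # ps"]) auto
qed

section \<open>Sums of squares in fraction fields\<close>

text \<open>The carrier of \<open>R\<close> does not occur in the rules, so the same set serves all
  rings \<open>R\<lparr>carrier := C\<rparr>\<close>; only the supply \<open>Y\<close> of elements
  to be squared varies.\<close>

inductive_set square_sums :: "('b, 'n) ring_scheme \<Rightarrow> 'b set \<Rightarrow> 'b set" for R Y where
  zero: "\<zero>\<^bsub>R\<^esub> \<in> square_sums R Y"
| step: "y \<in> Y \<Longrightarrow> x \<in> square_sums R Y \<Longrightarrow> y \<otimes>\<^bsub>R\<^esub> y \<oplus>\<^bsub>R\<^esub> x \<in> square_sums R Y"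

lemma square_sums_mono:
  assumes "Y \<subseteq> Z" "x \<in> square_sums R Y"
  shows "x \<in> square_sums R Z"
  using assms(2) by induction (use assms(1) in \<open>auto intro: square_sums.intros\<close>)

lemma square_sums_update: "square_sums (R\<lparr>carrier := C\<rparr>) Y = square_sums R Y"
proof (intro Set.set_eqI iffI)
  fix x
  show "x \<in> square_sums R Y" if "x \<in> square_sums (R\<lparr>carrier := C\<rparr>) Y"
    using that by induction (auto intro: square_sums.intros)
  show "x \<in> square_sums (R\<lparr>carrier := C\<rparr>) Y" if "x \<in> square_sums R Y"
    using that
  proof induction
    case zero
    then show ?case using square_sums.zero[of "R\<lparr>carrier := C\<rparr>"] by simp
  next
    case (step y x)
    then show ?case using square_sums.step[of y Y x "R\<lparr>carrier := C\<rparr>"] by simp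
  qed
qed

lemma (in ring) sums_of_squares_eq: "sums_of_squares R = square_sums R (carrier R)"
proof (intro Set.set_eqI iffI)
  fix x
  have "(\<Oplus>i\<in>{..<n}. y i [^] (2::nat)) \<in> square_sums R (carrier R)"
    if "y \<in> {..<n} \<rightarrow> carrier R" for n :: nat and y
    using that
  proof (induction n)
    case (Suc n)
    have "(\<Oplus>i\<in>{..<Suc n}. y i [^] (2::nat)) = y n [^] (2::nat) \<oplus> (\<Oplus>i\<in>{..<n}. y i [^] (2::nat))"
      unfolding lessThan_Suc using Suc.prems by (intro finsum_insert) auto
    moreover have "y n [^] (2::nat) = y n \<otimes> y n" "y n \<in> carrier R" "y \<in> {..<n} \<rightarrow> carrier R"
      using Suc.prems by (auto simp: numeral_2_eq_2 Pi_def)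
    ultimately show ?case using Suc.IH square_sums.step by metis
  qed (auto intro: square_sums.zero)
  then show "x \<in> square_sums R (carrier R)" if "x \<in> sums_of_squares R"
    using that by (auto simp: sums_of_squares_def)
  show "x \<in> sums_of_squares R" if "x \<in> square_sums R (carrier R)"
    using that
  proof induction
    case zero
    show ?case unfolding sums_of_squares_def by (auto intro!: exI[of _ 0])
  next
    case (step z x)
    then obtain n :: nat and y where y: "y \<in> {..<n} \<rightarrow> carrier R"
      "x = (\<Oplus>i\<in>{..<n}. y i [^] (2::nat))" by (auto simp: sums_of_squares_def)
    let ?y = "y(n := z)"
    have cl: "?y \<in> {..<Suc n} \<rightarrow> carrier R" using y(1) step.hyps(1) by (auto simp: Pi_def less_Suc_eq)
    have "(\<Oplus>i\<in>{..<Suc n}. ?y i [^] (2::nat)) = ?y n [^] (2::nat) \<oplus> (\<Oplus>i\<in>{..<n}. ?y i [^] (2::nat))"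
      unfolding lessThan_Suc using y(1) step.hyps(1) by (intro finsum_insert) (auto simp: Pi_def)
    also have "(\<Oplus>i\<in>{..<n}. ?y i [^] (2::nat)) = x"
      unfolding y(2) using y(1) by (intro finsum_cong') auto
    finally have "z \<otimes> z \<oplus> x = (\<Oplus>i\<in>{..<Suc n}. ?y i [^] (2::nat))"
      using step.hyps(1) by (simp add: numeral_2_eq_2)
    then show ?case unfolding sums_of_squares_def using cl by blast
  qed
qed

lemma (in cring) square_sums_closed:
  assumes "Y \<subseteq> carrier R" "x \<in> square_sums R Y"
  shows "x \<in> carrier R"
  using assms(2) by induction (use assms(1) in auto)

lemma (in cring) square_sums_add:
  assumes Y: "Y \<subseteq> carrier R" and y: "y \<in> square_sums R Y"
  shows "x \<in> square_sums R Y \<Longrightarrow> x \<oplus> y \<in> square_sums R Y"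
proof (induction rule: square_sums.induct)
  case zero
  then show ?case using y square_sums_closed[OF Y] by simp
next
  case (step z x)
  have "z \<otimes> z \<oplus> x \<oplus> y = z \<otimes> z \<oplus> (x \<oplus> y)"
    using step.hyps Y y square_sums_closed[OF Y] by (intro a_assoc) auto
  then show ?case using square_sums.step[OF step.hyps(1) step.IH] by simp
qed

lemma (in cring) square_sums_square_mult:
  assumes Y: "Y \<subseteq> carrier R" "\<And>y z. y \<in> Y \<Longrightarrow> z \<in> Y \<Longrightarrow> y \<otimes> z \<in> Y" and s: "s \<in> Y"
  shows "x \<in> square_sums R Y \<Longrightarrow> s \<otimes> s \<otimes> x \<in> square_sums R Y"
proof (induction rule: square_sums.induct)
  case zero
  have "s \<in> carrier R" using s Y(1) by blast
  then show ?case by (auto intro: square_sums.zero)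
next
  case (step z x)
  have c: "s \<in> carrier R" "z \<in> carrier R" "x \<in> carrier R"
    using step.hyps s Y(1) square_sums_closed[OF Y(1)] by auto
  have "s \<otimes> s \<otimes> (z \<otimes> z \<oplus> x) = (s \<otimes> z) \<otimes> (s \<otimes> z) \<oplus> s \<otimes> s \<otimes> x" using c by algebra
  then show ?case using square_sums.step[OF Y(2)[OF s step.hyps(1)] step.IH] by simp
qed

lemma (in cring) square_sums_mult:
  assumes Y: "Y \<subseteq> carrier R" "\<And>y z. y \<in> Y \<Longrightarrow> z \<in> Y \<Longrightarrow> y \<otimes> z \<in> Y"
    and y: "y \<in> square_sums R Y"
  shows "x \<in> square_sums R Y \<Longrightarrow> x \<otimes> y \<in> square_sums R Y"
proof (induction rule: square_sums.induct)
  case zero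
  then show ?case using y square_sums_closed[OF Y(1)] by (auto intro: square_sums.zero)
next
  case (step z x)
  have c: "y \<in> carrier R" "z \<in> carrier R" "x \<in> carrier R"
    using step.hyps y Y(1) square_sums_closed[OF Y(1)] by auto
  have "(z \<otimes> z \<oplus> x) \<otimes> y = z \<otimes> z \<otimes> y \<oplus> x \<otimes> y" using c by algebra
  then show ?case
    using square_sums_add[OF Y(1) step.IH] square_sums_square_mult[OF Y step.hyps(1) y] by simp
qed

lemma square_sums_image:
  assumes "ring R" "ring S" "h \<in> ring_hom R S" "Y \<subseteq> carrier R"
  shows "square_sums S (h ` Y) = h ` square_sums R Y"
proof -
  interpret R: ring R by fact
  interpret S: ring S by fact
  have cl: "x \<in> carrier R" if "x \<in> square_sums R Y" for x
    using that by induction (use assms(4) in auto)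
  have hz: "h \<zero>\<^bsub>R\<^esub> = \<zero>\<^bsub>S\<^esub>" by (rule ring_hom_zero[OF assms(3,1,2)])
  have hs: "h (y \<otimes>\<^bsub>R\<^esub> y \<oplus>\<^bsub>R\<^esub> x) = h y \<otimes>\<^bsub>S\<^esub> h y \<oplus>\<^bsub>S\<^esub> h x" if "y \<in> Y" "x \<in> square_sums R Y" for x y
    using that cl assms(4) ring_hom_add[OF assms(3)] ring_hom_mult[OF assms(3)] by auto
  show ?thesis
  proof (intro subset_antisym subsetI)
    show "x \<in> h ` square_sums R Y" if "x \<in> square_sums S (h ` Y)" for x
      using that
    proof induction
      case zero
      show ?case using hz square_sums.zero by (metis image_eqI)
    next
      case (step y x)
      then obtain z w where "y = h z" "z \<in> Y" "x = h w" "w \<in> square_sums R Y" by blast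
      then show ?case using hs square_sums.step by (metis image_eqI)
    qed
    have "h x \<in> square_sums S (h ` Y)" if "x \<in> square_sums R Y" for x
      using that
    proof induction
      case zero
      show ?case using hz square_sums.zero by metis
    next
      case (step y x)
      then show ?case using hs[OF step.hyps] square_sums.step[of "h y" "h ` Y" "h x" S] by simp
    qed
    then show "x \<in> square_sums S (h ` Y)" if "x \<in> h ` square_sums R Y" for x using that by blast
  qed
qed

context domain begin

lemma frac_pairsI: "a \<in> carrier R \<Longrightarrow> s \<in> carrier R \<Longrightarrow> s \<noteq> \<zero> \<Longrightarrow> (a, s) \<in> frac_pairs R"
  by (simp add: frac_pairs_def)

text \<open>Adding the square of a fraction with denominator \<open>d\<close> to a sum over
  \<open>s^2\<close> leads to the denominator \<open>(d s)^2\<close>, again a square.\<close>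

lemma sums_of_squares_frac_field:
  "sums_of_squares (frac_field R) =
     {fraction R x (s \<otimes> s) | x s. x \<in> square_sums R (carrier R) \<and> s \<in> carrier R \<and> s \<noteq> \<zero>}"
proof -
  let ?K = "frac_field R"
  interpret K: field ?K by (rule frac_field_is_field)
  note cl = square_sums_closed[OF subset_refl]
  have nz: "s \<otimes> t \<noteq> \<zero>" if "s \<in> carrier R" "s \<noteq> \<zero>" "t \<in> carrier R" "t \<noteq> \<zero>" for s t
    using that integral by blast
  note eqI = frac_eq_iff[OF frac_pairsI frac_pairsI, THEN iffD2]
  have K_zero: "\<zero>\<^bsub>?K\<^esub> = fraction R \<zero> \<one>" by (simp add: frac_field_def)
  have 1: "\<exists>x s. b = fraction R x (s \<otimes> s) \<and> x \<in> square_sums R (carrier R) \<and> s \<in> carrier R \<and> s \<noteq> \<zero>"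
    if "b \<in> square_sums ?K (carrier ?K)" for b
    using that
  proof induction
    case zero
    have "\<zero>\<^bsub>?K\<^esub> = fraction R \<zero> (\<one> \<otimes> \<one>)" by (simp add: K_zero)
    then show ?case using square_sums.zero one_closed one_not_zero by blast
  next
    case (step y b)
    then obtain x s where x: "b = fraction R x (s \<otimes> s)" "x \<in> square_sums R (carrier R)"
      "s \<in> carrier R" "s \<noteq> \<zero>" by blast
    obtain a d where a: "y = fraction R a d" "a \<in> carrier R" "d \<in> carrier R" "d \<noteq> \<zero>"
      using step.hyps(1) by (auto simp: carrier_frac_field frac_pairs_def)
    let ?x = "(a \<otimes> s) \<otimes> (a \<otimes> s) \<oplus> d \<otimes> d \<otimes> x"
    have "y \<otimes>\<^bsub>?K\<^esub> y \<oplus>\<^bsub>?K\<^esub> b = fraction R ((a \<otimes> a) \<otimes> (s \<otimes> s) \<oplus> x \<otimes> (d \<otimes> d)) ((d \<otimes> d) \<otimes> (s \<otimes> s))"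
      unfolding a(1) x(1) using a x nz cl
      by (simp add: mult_frac_field add_frac_field frac_pairsI)
    also have "(a \<otimes> a) \<otimes> (s \<otimes> s) \<oplus> x \<otimes> (d \<otimes> d) = ?x"
      using a(2,3) x(3) cl[OF x(2)] by algebra
    also have "(d \<otimes> d) \<otimes> (s \<otimes> s) = (d \<otimes> s) \<otimes> (d \<otimes> s)" using a(3) x(3) by algebra
    finally have e: "y \<otimes>\<^bsub>?K\<^esub> y \<oplus>\<^bsub>?K\<^esub> b = fraction R ?x ((d \<otimes> s) \<otimes> (d \<otimes> s))" .
    have "?x \<in> square_sums R (carrier R)"
      using a x by (intro square_sums.step square_sums_square_mult) auto
    then show ?case using e a(3,4) x(3,4) nz m_closed by blast
  qed
  have 2: "fraction R x (s \<otimes> s) \<in> square_sums ?K (carrier ?K)"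
    if s: "s \<in> carrier R" "s \<noteq> \<zero>" and "x \<in> square_sums R (carrier R)" for x s
    using that(3)
  proof induction
    case zero
    have "fraction R \<zero> (s \<otimes> s) = \<zero>\<^bsub>?K\<^esub>" unfolding K_zero using s nz by (intro eqI) auto
    then show ?case by (simp add: square_sums.zero)
  next
    case (step y x)
    note c = step.hyps(1) cl[OF step.hyps(2)] s
    have K: "fraction R y s \<in> carrier ?K" using c by (auto simp: carrier_frac_field frac_pairs_def)
    have "fraction R y s \<otimes>\<^bsub>?K\<^esub> fraction R y s \<oplus>\<^bsub>?K\<^esub> fraction R x (s \<otimes> s)
        = fraction R ((y \<otimes> y) \<otimes> (s \<otimes> s) \<oplus> x \<otimes> (s \<otimes> s)) ((s \<otimes> s) \<otimes> (s \<otimes> s))"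
      using c nz by (simp add: mult_frac_field add_frac_field frac_pairsI)
    also have "\<dots> = fraction R (y \<otimes> y \<oplus> x) (s \<otimes> s)"
    proof (rule eqI)
      show "((y \<otimes> y) \<otimes> (s \<otimes> s) \<oplus> x \<otimes> (s \<otimes> s)) \<otimes> (s \<otimes> s)
          = (y \<otimes> y \<oplus> x) \<otimes> ((s \<otimes> s) \<otimes> (s \<otimes> s))" using c by algebra
    qed (use c nz in auto)
    finally show ?case using square_sums.step[OF K step.IH] by simp
  qed
  show ?thesis unfolding K.sums_of_squares_eq using 1 2 by blast
qed

text \<open>Clears square denominators, so that being a sum of squares in the fraction field becomes
  a condition in \<open>R\<close>; the cone \<open>P\<close> is later defined in this form.\<close>

lemma frac_emb_in_sums_of_squares:
  assumes "t \<in> carrier R"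
  shows "frac_emb R t \<in> sums_of_squares (frac_field R) \<longleftrightarrow>
    (\<exists>s\<in>carrier R. s \<noteq> \<zero> \<and> s \<otimes> s \<otimes> t \<in> square_sums R (carrier R))"
proof -
  have "fraction R t \<one> = fraction R x (s \<otimes> s) \<longleftrightarrow> s \<otimes> s \<otimes> t = x"
    if "x \<in> square_sums R (carrier R)" "s \<in> carrier R" "s \<noteq> \<zero>" for x s
  proof -
    have "x \<in> carrier R" using that square_sums_closed by blast
    moreover have "s \<otimes> s \<noteq> \<zero>" using that integral by blast
    ultimately show ?thesis
      using frac_eq_iff[of t \<one> x "s \<otimes> s"] that assms by (simp add: frac_pairsI m_comm)
  qed
  then show ?thesis unfolding sums_of_squares_frac_field frac_emb_def by blast
qed

lemma real_domain_iff:
  "real_domain R \<longleftrightarrow> \<not> (\<exists>s\<in>carrier R. s \<noteq> \<zero> \<and> \<ominus> (s \<otimes> s) \<in> square_sums R (carrier R))"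
proof -
  let ?K = "frac_field R"
  interpret K: field ?K by (rule frac_field_is_field)
  have "frac_emb R (\<ominus> \<one>) \<oplus>\<^bsub>?K\<^esub> \<one>\<^bsub>?K\<^esub> = fraction R (\<ominus> \<one> \<oplus> \<one>) \<one>"
    using add_frac_field[of "\<ominus> \<one>" \<one> \<one> \<one>] by (simp add: frac_emb_def frac_field_def frac_pairsI)
  also have "\<dots> = \<zero>\<^bsub>?K\<^esub>" by (simp add: l_neg frac_field_def)
  finally have e: "frac_emb R (\<ominus> \<one>) \<oplus>\<^bsub>?K\<^esub> \<one>\<^bsub>?K\<^esub> = \<zero>\<^bsub>?K\<^esub>" .
  have "frac_emb R (\<ominus> \<one>) \<in> carrier ?K"
    unfolding frac_emb_def carrier_frac_field using frac_pairsI[of "\<ominus> \<one>" \<one>] by auto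
  then have "\<ominus>\<^bsub>?K\<^esub> \<one>\<^bsub>?K\<^esub> = frac_emb R (\<ominus> \<one>)" using K.minus_equality[OF e] by simp
  moreover have "s \<otimes> s \<otimes> (\<ominus> \<one>) = \<ominus> (s \<otimes> s)" if "s \<in> carrier R" for s
    using that by (simp add: r_minus)
  ultimately show ?thesis
    unfolding real_domain_def using frac_emb_in_sums_of_squares[of "\<ominus> \<one>"] domain_axioms by auto
qed

text \<open>The element \<open>b\<close> of the fraction field may be taken from \<open>R\<close>:
  if \<open>a^2 + b = i\<close> with \<open>i \<in> I\<close>, then
  \<open>b = i - a^2\<close>.\<close>

lemma central_ideal_iff:
  assumes "ideal I R"
  shows "central_ideal I R \<longleftrightarrow>
    (\<forall>a\<in>carrier R. \<forall>t\<in>carrier R. \<forall>s\<in>carrier R. s \<noteq> \<zero> \<longrightarrow>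
       s \<otimes> s \<otimes> t \<in> square_sums R (carrier R) \<longrightarrow> a \<otimes> a \<oplus> t \<in> I \<longrightarrow> a \<in> I)" (is "_ = ?rhs")
proof -
  let ?K = "frac_field R"
  interpret K: field ?K by (rule frac_field_is_field)
  interpret I: ideal I R by fact
  have K: "frac_emb R a \<in> carrier ?K" if "a \<in> carrier R" for a
    unfolding frac_emb_def carrier_frac_field using frac_pairsI[OF that, of \<one>] by auto
  have add: "frac_emb R a \<oplus>\<^bsub>?K\<^esub> frac_emb R b = frac_emb R (a \<oplus> b)"
    if "a \<in> carrier R" "b \<in> carrier R" for a b
    using that add_frac_field[of a \<one> b \<one>] by (simp add: frac_emb_def frac_pairsI)
  have sq: "frac_emb R a [^]\<^bsub>?K\<^esub> (2::nat) = frac_emb R (a \<otimes> a)" if "a \<in> carrier R" for a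
    using that K[OF that] mult_frac_field[of a \<one> a \<one>]
    by (simp add: numeral_2_eq_2) (simp add: frac_emb_def frac_pairsI)
  have inj: "a = b" if "frac_emb R a = frac_emb R b" "a \<in> carrier R" "b \<in> carrier R" for a b
    using that frac_eq_iff[of a \<one> b \<one>] by (simp add: frac_emb_def frac_pairsI)
  show ?thesis
  proof
    assume c: "central_ideal I R"
    show ?rhs
    proof (intro ballI impI)
      fix a t s assume h: "a \<in> carrier R" "t \<in> carrier R" "s \<in> carrier R" "s \<noteq> \<zero>"
        "s \<otimes> s \<otimes> t \<in> square_sums R (carrier R)" "a \<otimes> a \<oplus> t \<in> I"
      have "frac_emb R t \<in> sums_of_squares ?K" using h frac_emb_in_sums_of_squares by blast
      moreover have "frac_emb R a [^]\<^bsub>?K\<^esub> (2::nat) \<oplus>\<^bsub>?K\<^esub> frac_emb R t \<in> frac_emb R ` I"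
        using h by (simp add: sq add)
      ultimately show "a \<in> I" using c h(1) by (auto simp: central_ideal_def)
    qed
  next
    assume r: ?rhs
    have "a \<in> I" if a: "a \<in> carrier R" and b: "b \<in> sums_of_squares ?K"
      and ab: "frac_emb R a [^]\<^bsub>?K\<^esub> (2::nat) \<oplus>\<^bsub>?K\<^esub> b \<in> frac_emb R ` I" for a b
    proof -
      obtain i where i: "i \<in> I" "frac_emb R (a \<otimes> a) \<oplus>\<^bsub>?K\<^esub> b = frac_emb R i"
        using ab sq[OF a] by auto
      have ic: "i \<in> carrier R" using i(1) by (rule I.a_Hcarr)
      let ?t = "i \<ominus> a \<otimes> a"
      have bK: "b \<in> carrier ?K"
        using b K.square_sums_closed[OF subset_refl] by (simp add: K.sums_of_squares_eq)
      have ei: "a \<otimes> a \<oplus> ?t = i" using a ic by algebra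
      have "frac_emb R (a \<otimes> a) \<oplus>\<^bsub>?K\<^esub> frac_emb R ?t = frac_emb R i"
        using add[of "a \<otimes> a" ?t] ei a ic by simp
      then have "frac_emb R (a \<otimes> a) \<oplus>\<^bsub>?K\<^esub> frac_emb R ?t = frac_emb R (a \<otimes> a) \<oplus>\<^bsub>?K\<^esub> b"
        using i(2) by simp
      then have "b = frac_emb R ?t" using K.add.l_cancel[OF _ K bK K, of "a \<otimes> a" ?t] a ic by simp
      then obtain s where "s \<in> carrier R" "s \<noteq> \<zero>" "s \<otimes> s \<otimes> ?t \<in> square_sums R (carrier R)"
        using b frac_emb_in_sums_of_squares[of ?t] a ic by auto
      moreover have "a \<otimes> a \<oplus> ?t \<in> I" using ei i(1) by simp
      ultimately show ?thesis using r a ic by (metis minus_closed m_closed)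
    qed
    then show "central_ideal I R" unfolding central_ideal_def using assms by blast
  qed
qed

end

section \<open>Residue fields\<close>

lemma frac_map_ring_hom:
  assumes ext: "domain_extension R S h"
  shows "frac_map S h \<in> ring_hom (frac_field R) (frac_field S)"
    and "inj_on (frac_map S h) (carrier (frac_field R))"
proof -
  interpret R: "domain" R using ext by (simp add: domain_extension_def)
  interpret S: "domain" S using ext by (simp add: domain_extension_def)
  have hom: "h \<in> ring_hom R S" and inj: "inj_on h (carrier R)"
    using ext by (auto simp: domain_extension_def)
  note fm = frac_map_frac[OF ext]
  have elim: "\<exists>a s. x = fraction R a s \<and> (a, s) \<in> frac_pairs R" if "x \<in> carrier (frac_field R)" for x
    using that by (auto simp: R.carrier_frac_field)
  have c: "a \<in> carrier R" "s \<in> carrier R" if "(a, s) \<in> frac_pairs R" for a s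
    using that by (auto simp: frac_pairs_def)
  show "frac_map S h \<in> ring_hom (frac_field R) (frac_field S)"
  proof (rule ring_hom_memI)
    fix x assume "x \<in> carrier (frac_field R)"
    then obtain a s where x: "x = fraction R a s" "(a, s) \<in> frac_pairs R" using elim by blast
    show "frac_map S h x \<in> carrier (frac_field S)"
      unfolding x(1) fm(1)[OF x(2)] S.carrier_frac_field using fm(2)[OF x(2)] by blast
    fix y assume "y \<in> carrier (frac_field R)"
    then obtain b t where y: "y = fraction R b t" "(b, t) \<in> frac_pairs R" using elim by blast
    note cc = c[OF x(2)] c[OF y(2)]
    have st: "(b', s \<otimes>\<^bsub>R\<^esub> t) \<in> frac_pairs R" if "b' \<in> carrier R" for b'
      using R.frac_pairs_mult[OF x(2) y(2)] that by blast
    show "frac_map S h (x \<otimes>\<^bsub>frac_field R\<^esub> y)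
        = frac_map S h x \<otimes>\<^bsub>frac_field S\<^esub> frac_map S h y"
      unfolding x(1) y(1) R.mult_frac_field[OF x(2) y(2)] fm(1)[OF x(2)] fm(1)[OF y(2)]
        S.mult_frac_field[OF fm(2)[OF x(2)] fm(2)[OF y(2)]]
      using cc st fm(1) by (simp add: ring_hom_mult[OF hom])
    show "frac_map S h (x \<oplus>\<^bsub>frac_field R\<^esub> y)
        = frac_map S h x \<oplus>\<^bsub>frac_field S\<^esub> frac_map S h y"
      unfolding x(1) y(1) R.add_frac_field[OF x(2) y(2)] fm(1)[OF x(2)] fm(1)[OF y(2)]
        S.add_frac_field[OF fm(2)[OF x(2)] fm(2)[OF y(2)]]
      using cc st fm(1) by (simp add: ring_hom_mult[OF hom] ring_hom_add[OF hom])
  next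
    have "(\<one>\<^bsub>R\<^esub>, \<one>\<^bsub>R\<^esub>) \<in> frac_pairs R" by (simp add: frac_pairs_def)
    from fm(1)[OF this] show "frac_map S h \<one>\<^bsub>frac_field R\<^esub> = \<one>\<^bsub>frac_field S\<^esub>"
      by (simp add: frac_field_def ring_hom_one[OF hom])
  qed
  show "inj_on (frac_map S h) (carrier (frac_field R))"
  proof (rule inj_onI)
    fix x y assume "x \<in> carrier (frac_field R)" "y \<in> carrier (frac_field R)"
      and e: "frac_map S h x = frac_map S h y"
    then obtain a s b t where x: "x = fraction R a s" "(a, s) \<in> frac_pairs R"
      and y: "y = fraction R b t" "(b, t) \<in> frac_pairs R" using elim by blast
    note cc = c[OF x(2)] c[OF y(2)]
    have "h a \<otimes>\<^bsub>S\<^esub> h t = h b \<otimes>\<^bsub>S\<^esub> h s"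
      using e S.frac_eq_iff[OF fm(2)[OF x(2)] fm(2)[OF y(2)]] by (simp add: x y fm(1))
    then have "h (a \<otimes>\<^bsub>R\<^esub> t) = h (b \<otimes>\<^bsub>R\<^esub> s)" using cc by (simp add: ring_hom_mult[OF hom])
    then have "a \<otimes>\<^bsub>R\<^esub> t = b \<otimes>\<^bsub>R\<^esub> s" using inj cc by (auto dest: inj_onD)
    then show "x = y" using R.frac_eq_iff[OF x(2) y(2)] x(1) y(1) by simp
  qed
qed

lemma carrier_FactRing: "carrier (R Quot I) = {I +>\<^bsub>R\<^esub> a | a. a \<in> carrier R}"
  unfolding FactRing_simps by (simp, blast)

lemma rcos_nonzero:
  assumes "primeideal I T" "a \<in> carrier T"
  shows "I +>\<^bsub>T\<^esub> a = \<zero>\<^bsub>T Quot I\<^esub> \<longleftrightarrow> a \<in> I"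
proof -
  interpret primeideal I T by fact
  have "I +>\<^bsub>T\<^esub> \<zero>\<^bsub>T\<^esub> = \<zero>\<^bsub>T Quot I\<^esub>"
    by (rule ring_hom_zero[OF rcos_ring_hom ring_axioms quotient_is_ring])
  then show ?thesis
    using quotient_eq_iff_same_a_r_cos[OF ideal_axioms assms(2) zero_closed] assms(2)
    by (simp add: minus_eq)
qed

lemma frac_pairs_FactRing:
  assumes "primeideal I T"
  shows "frac_pairs (T Quot I) =
    {(I +>\<^bsub>T\<^esub> a, I +>\<^bsub>T\<^esub> s) | a s. a \<in> carrier T \<and> s \<in> carrier T \<and> s \<notin> I}"
proof (intro Set.set_eqI iffI)
  fix z
  show "z \<in> {(I +>\<^bsub>T\<^esub> a, I +>\<^bsub>T\<^esub> s) | a s. a \<in> carrier T \<and> s \<in> carrier T \<and> s \<notin> I}"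
    if z: "z \<in> frac_pairs (T Quot I)"
  proof -
    obtain x y where xy: "z = (x, y)" "x \<in> carrier (T Quot I)" "y \<in> carrier (T Quot I)"
      "y \<noteq> \<zero>\<^bsub>T Quot I\<^esub>"
      using z by (cases z) (simp add: frac_pairs_def)
    obtain a s where as: "x = I +>\<^bsub>T\<^esub> a" "a \<in> carrier T" "y = I +>\<^bsub>T\<^esub> s" "s \<in> carrier T"
      using xy(2,3) unfolding carrier_FactRing by blast
    then have "s \<notin> I" using xy(4) rcos_nonzero[OF assms as(4)] by simp
    then show ?thesis using as xy(1) by blast
  qed
  show "z \<in> frac_pairs (T Quot I)"
    if z: "z \<in> {(I +>\<^bsub>T\<^esub> a, I +>\<^bsub>T\<^esub> s) | a s. a \<in> carrier T \<and> s \<in> carrier T \<and> s \<notin> I}"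
    using z rcos_nonzero[OF assms] by (auto simp: frac_pairs_def carrier_FactRing)
qed

lemma carrier_residue_field:
  assumes "primeideal I T"
  shows "carrier (residue_field T I) =
    {fraction (T Quot I) (I +>\<^bsub>T\<^esub> a) (I +>\<^bsub>T\<^esub> s) | a s.
       a \<in> carrier T \<and> s \<in> carrier T \<and> s \<notin> I}"
proof -
  interpret Q: "domain" "T Quot I" by (rule primeideal.quotient_is_domain[OF assms])
  show ?thesis
    unfolding residue_field_def Q.carrier_frac_field frac_pairs_FactRing[OF assms] by blast
qed

text \<open>Injectivity matters only for the induced map
  \<open>R Quot p \<rightarrow> S Quot q\<close>, where it comes from \<open>p\<close> being the
  full preimage of \<open>q\<close>.\<close>

locale residue_extension =
  R: cring R + S: cring S + prime: primeideal q S
  for R :: "('a, 'm) ring_scheme" and S :: "('b, 'n) ring_scheme" and h q +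
  assumes hom: "h \<in> ring_hom R S"
begin

abbreviation p where "p \<equiv> contraction R h q"

lemma contraction_prime: "primeideal p R"
proof -
  interpret h: ring_hom_ring R S h
    by (rule ring_hom_ringI2[OF R.ring_axioms S.ring_axioms hom])
  show ?thesis
    unfolding contraction_def by (rule h.primeideal_vimage[OF R.is_cring prime.primeideal_axioms])
qed

sublocale p: primeideal p R by (rule contraction_prime)

lemma h_closed: "a \<in> carrier R \<Longrightarrow> h a \<in> carrier S"
  by (rule ring_hom_closed[OF hom])

lemma mem_p: "a \<in> carrier R \<Longrightarrow> a \<in> p \<longleftrightarrow> h a \<in> q"
  unfolding contraction_def by blast

lemma quot_map_rcos: "a \<in> carrier R \<Longrightarrow> quot_map S q h (p +>\<^bsub>R\<^esub> a) = q +>\<^bsub>S\<^esub> h a"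
  by (rule quot_map_coset[OF R.ring_axioms prime.ideal_axioms hom])

lemma quot_extension: "domain_extension (R Quot p) (S Quot q) (quot_map S q h)"
  unfolding domain_extension_def
proof (intro conjI)
  show "domain (R Quot p)" by (rule p.quotient_is_domain)
  show "domain (S Quot q)" by (rule prime.quotient_is_domain)
  note [simp] = quot_map_rcos h_closed
  show "quot_map S q h \<in> ring_hom (R Quot p) (S Quot q)"
  proof (rule ring_hom_memI)
    fix x assume "x \<in> carrier (R Quot p)"
    then obtain a where x: "x = p +>\<^bsub>R\<^esub> a" "a \<in> carrier R" by (auto simp: carrier_FactRing)
    show "quot_map S q h x \<in> carrier (S Quot q)"
      using x by (auto simp: carrier_FactRing)
    fix y assume "y \<in> carrier (R Quot p)"
    then obtain b where y: "y = p +>\<^bsub>R\<^esub> b" "b \<in> carrier R" by (auto simp: carrier_FactRing)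
    show "quot_map S q h (x \<otimes>\<^bsub>R Quot p\<^esub> y) = quot_map S q h x \<otimes>\<^bsub>S Quot q\<^esub> quot_map S q h y"
      using x y by (simp add: FactRing_def p.rcoset_mult_add prime.rcoset_mult_add ring_hom_mult[OF hom])
    show "quot_map S q h (x \<oplus>\<^bsub>R Quot p\<^esub> y) = quot_map S q h x \<oplus>\<^bsub>S Quot q\<^esub> quot_map S q h y"
      using x y by (simp add: FactRing_def p.a_rcos_sum prime.a_rcos_sum ring_hom_add[OF hom])
  next
    show "quot_map S q h \<one>\<^bsub>R Quot p\<^esub> = \<one>\<^bsub>S Quot q\<^esub>"
      by (simp add: FactRing_def ring_hom_one[OF hom])
  qed
  show "inj_on (quot_map S q h) (carrier (R Quot p))"
  proof (rule inj_onI)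
    fix x y assume "x \<in> carrier (R Quot p)" "y \<in> carrier (R Quot p)"
      and e: "quot_map S q h x = quot_map S q h y"
    then obtain a b where x: "x = p +>\<^bsub>R\<^esub> a" "a \<in> carrier R" "y = p +>\<^bsub>R\<^esub> b" "b \<in> carrier R"
      by (auto simp: carrier_FactRing)
    have "h a \<ominus>\<^bsub>S\<^esub> h b \<in> q"
      using e x S.quotient_eq_iff_same_a_r_cos[OF prime.ideal_axioms, of "h a" "h b"] by simp
    moreover have "h (a \<ominus>\<^bsub>R\<^esub> b) = h a \<ominus>\<^bsub>S\<^esub> h b"
    proof -
      interpret h: ring_hom_cring R S h by unfold_locales (rule hom)
      show ?thesis using x by (simp add: a_minus_def)
    qed
    ultimately have "a \<ominus>\<^bsub>R\<^esub> b \<in> p" using x mem_p by simp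
    then show "x = y"
      using x R.quotient_eq_iff_same_a_r_cos[OF p.ideal_axioms, of a b] by simp
  qed
qed

lemma residue_map_fraction:
  assumes "a \<in> carrier R" "s \<in> carrier R" "s \<notin> p"
  shows "residue_map S q h (fraction (R Quot p) (p +>\<^bsub>R\<^esub> a) (p +>\<^bsub>R\<^esub> s))
    = fraction (S Quot q) (q +>\<^bsub>S\<^esub> h a) (q +>\<^bsub>S\<^esub> h s)"
proof -
  have "(p +>\<^bsub>R\<^esub> a, p +>\<^bsub>R\<^esub> s) \<in> frac_pairs (R Quot p)"
    unfolding frac_pairs_FactRing[OF p.primeideal_axioms] using assms by blast
  then show ?thesis
    unfolding residue_map_def using frac_map_frac(1)[OF quot_extension] assms
    by (simp add: quot_map_rcos)
qed

lemma fraction_quot_eq_iff: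
  assumes "a \<in> carrier S" "s \<in> carrier S" "s \<notin> q" "b \<in> carrier S" "t \<in> carrier S" "t \<notin> q"
  shows "fraction (S Quot q) (q +>\<^bsub>S\<^esub> a) (q +>\<^bsub>S\<^esub> s) = fraction (S Quot q) (q +>\<^bsub>S\<^esub> b) (q +>\<^bsub>S\<^esub> t)
    \<longleftrightarrow> s \<otimes>\<^bsub>S\<^esub> b \<ominus>\<^bsub>S\<^esub> a \<otimes>\<^bsub>S\<^esub> t \<in> q"
proof -
  interpret Q: "domain" "S Quot q" by (rule prime.quotient_is_domain)
  have P: "(q +>\<^bsub>S\<^esub> x, q +>\<^bsub>S\<^esub> y) \<in> frac_pairs (S Quot q)"
    if "x \<in> carrier S" "y \<in> carrier S" "y \<notin> q" for x y
    using that by (auto simp: frac_pairs_FactRing[OF prime.primeideal_axioms])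
  have m: "(q +>\<^bsub>S\<^esub> x) \<otimes>\<^bsub>S Quot q\<^esub> (q +>\<^bsub>S\<^esub> y) = q +>\<^bsub>S\<^esub> (x \<otimes>\<^bsub>S\<^esub> y)"
    if "x \<in> carrier S" "y \<in> carrier S" for x y
    using that prime.rcoset_mult_add by (simp add: FactRing_def)
  have "fraction (S Quot q) (q +>\<^bsub>S\<^esub> a) (q +>\<^bsub>S\<^esub> s) = fraction (S Quot q) (q +>\<^bsub>S\<^esub> b) (q +>\<^bsub>S\<^esub> t)
    \<longleftrightarrow> q +>\<^bsub>S\<^esub> (a \<otimes>\<^bsub>S\<^esub> t) = q +>\<^bsub>S\<^esub> (b \<otimes>\<^bsub>S\<^esub> s)"
    using assms P m by (simp add: Q.frac_eq_iff)
  also have "\<dots> \<longleftrightarrow> q +>\<^bsub>S\<^esub> (s \<otimes>\<^bsub>S\<^esub> b) = q +>\<^bsub>S\<^esub> (a \<otimes>\<^bsub>S\<^esub> t)"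
    using assms by (auto simp: S.m_comm)
  also have "\<dots> \<longleftrightarrow> s \<otimes>\<^bsub>S\<^esub> b \<ominus>\<^bsub>S\<^esub> a \<otimes>\<^bsub>S\<^esub> t \<in> q"
    using assms S.quotient_eq_iff_same_a_r_cos[OF prime.ideal_axioms] by simp
  finally show ?thesis .
qed

text \<open>The bridge from residue fields to congruences: \<open>a / s = c\<close> in k(q) is
  cross-multiplied to \<open>s c - a \<in> q\<close>.\<close>

lemma residue_map_eq_class_iff:
  assumes "a \<in> carrier R" "s \<in> carrier R" "s \<notin> p" "c \<in> carrier S"
  shows "residue_map S q h (fraction (R Quot p) (p +>\<^bsub>R\<^esub> a) (p +>\<^bsub>R\<^esub> s)) = residue_class S q c
    \<longleftrightarrow> h s \<otimes>\<^bsub>S\<^esub> c \<ominus>\<^bsub>S\<^esub> h a \<in> q"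
proof -
  have "\<one>\<^bsub>S\<^esub> \<notin> q" using prime.I_notcarr prime.one_imp_carrier by blast
  moreover have "residue_class S q c = fraction (S Quot q) (q +>\<^bsub>S\<^esub> c) (q +>\<^bsub>S\<^esub> \<one>\<^bsub>S\<^esub>)"
    by (simp add: residue_class_def frac_emb_def FactRing_def)
  ultimately show ?thesis
    using fraction_quot_eq_iff[of "h a" "h s" c "\<one>\<^bsub>S\<^esub>"] assms h_closed mem_p
    by (simp add: residue_map_fraction)
qed

text \<open>It suffices to reach classes of elements of \<open>S\<close>. If
  \<open>c = a / s\<close> and \<open>d = b / t\<close> in k(q) with \<open>d \<notin> q\<close>,
  then \<open>b\<close> is nonzero there as well and \<open>c / d = (a t) / (s b)\<close>.\<close>

lemma residue_map_ring_iso: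
  assumes surj: "\<And>c. c \<in> carrier S \<Longrightarrow>
    \<exists>a\<in>carrier R. \<exists>s\<in>carrier R. h s \<notin> q \<and> h s \<otimes>\<^bsub>S\<^esub> c \<ominus>\<^bsub>S\<^esub> h a \<in> q"
  shows "residue_map S q h \<in> ring_iso (residue_field R p) (residue_field S q)"
proof -
  interpret QR: "domain" "R Quot p" by (rule p.quotient_is_domain)
  interpret QS: "domain" "S Quot q" by (rule prime.quotient_is_domain)
  let ?f = "residue_map S q h"
  have hom': "?f \<in> ring_hom (residue_field R p) (residue_field S q)"
    and inj: "inj_on ?f (carrier (residue_field R p))"
    unfolding residue_map_def residue_field_def by (rule frac_map_ring_hom[OF quot_extension])+
  have "\<exists>x\<in>carrier (residue_field R p). ?f x = y" if y: "y \<in> carrier (residue_field S q)" for y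
  proof -
    obtain u v where uv: "y = fraction (S Quot q) u v" "(u, v) \<in> frac_pairs (S Quot q)"
      using y unfolding residue_field_def QS.carrier_frac_field by blast
    obtain c d where "u = q +>\<^bsub>S\<^esub> c" "v = q +>\<^bsub>S\<^esub> d" and cd': "c \<in> carrier S" "d \<in> carrier S" "d \<notin> q"
      using uv(2) unfolding frac_pairs_FactRing[OF prime.primeideal_axioms] by blast
    then have cd: "y = fraction (S Quot q) (q +>\<^bsub>S\<^esub> c) (q +>\<^bsub>S\<^esub> d)"
      "c \<in> carrier S" "d \<in> carrier S" "d \<notin> q" using uv(1) by simp_all
    obtain a s where as: "a \<in> carrier R" "s \<in> carrier R" "h s \<notin> q"
      "h s \<otimes>\<^bsub>S\<^esub> c \<ominus>\<^bsub>S\<^esub> h a \<in> q" using surj[OF cd(2)] by blast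
    obtain b t where bt: "b \<in> carrier R" "t \<in> carrier R" "h t \<notin> q"
      "h t \<otimes>\<^bsub>S\<^esub> d \<ominus>\<^bsub>S\<^esub> h b \<in> q" using surj[OF cd(3)] by blast
    have cc: "h a \<in> carrier S" "h s \<in> carrier S" "h b \<in> carrier S" "h t \<in> carrier S"
      using as bt h_closed by auto
    have hb: "h b \<notin> q"
    proof
      assume "h b \<in> q"
      then have "(h t \<otimes>\<^bsub>S\<^esub> d \<ominus>\<^bsub>S\<^esub> h b) \<oplus>\<^bsub>S\<^esub> h b \<in> q" using bt(4) by simp
      moreover have "(h t \<otimes>\<^bsub>S\<^esub> d \<ominus>\<^bsub>S\<^esub> h b) \<oplus>\<^bsub>S\<^esub> h b = h t \<otimes>\<^bsub>S\<^esub> d"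
        using cc cd(3) by (simp add: S.minus_eq S.a_assoc S.l_neg)
      ultimately show False using prime.I_prime[OF cc(4) cd(3)] bt(3) cd(4) by simp
    qed
    have sb: "s \<otimes>\<^bsub>R\<^esub> b \<notin> p" "h (s \<otimes>\<^bsub>R\<^esub> b) \<notin> q"
      using prime.I_prime[OF cc(2,3)] as bt hb by (auto simp: mem_p ring_hom_mult[OF hom])
    let ?x = "fraction (R Quot p) (p +>\<^bsub>R\<^esub> (a \<otimes>\<^bsub>R\<^esub> t)) (p +>\<^bsub>R\<^esub> (s \<otimes>\<^bsub>R\<^esub> b))"
    have "?x \<in> carrier (residue_field R p)"
      unfolding carrier_residue_field[OF p.primeideal_axioms] using as bt sb(1) by blast
    moreover have "?f ?x = y"
    proof -
      have "(h s \<otimes>\<^bsub>S\<^esub> h b) \<otimes>\<^bsub>S\<^esub> c \<ominus>\<^bsub>S\<^esub> (h a \<otimes>\<^bsub>S\<^esub> h t) \<otimes>\<^bsub>S\<^esub> d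
          = h b \<otimes>\<^bsub>S\<^esub> (h s \<otimes>\<^bsub>S\<^esub> c \<ominus>\<^bsub>S\<^esub> h a) \<ominus>\<^bsub>S\<^esub> h a \<otimes>\<^bsub>S\<^esub> (h t \<otimes>\<^bsub>S\<^esub> d \<ominus>\<^bsub>S\<^esub> h b)"
        using cc cd(2,3) by algebra
      also have "\<dots> \<in> q"
        using as(4) bt(4) cc prime.I_l_closed by (simp add: S.minus_eq)
      finally show ?thesis
        unfolding cd(1) using as bt sb cd(2-4) cc
        by (simp add: residue_map_fraction fraction_quot_eq_iff ring_hom_mult[OF hom])
    qed
    ultimately show ?thesis by blast
  qed
  then have "?f ` carrier (residue_field R p) = carrier (residue_field S q)"
    using ring_hom_closed[OF hom'] by blast
  then show ?thesis using hom' inj by (simp add: ring_iso_def bij_betw_def)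
qed

end

section \<open>Finite extensions of noetherian domains\<close>

text \<open>Changing the carrier leaves sum and product untouched, but the additive inverse is
  defined by reference to the carrier. Hence subtraction needs its own comparison between
  \<open>B\<close> and its subrings.\<close>

lemma (in ring) a_inv_subring:
  assumes "subring C R" "x \<in> C"
  shows "\<ominus>\<^bsub>R\<lparr>carrier := C\<rparr>\<^esub> x = \<ominus> x"
proof -
  interpret C: ring "R\<lparr>carrier := C\<rparr>" by (rule subring_is_ring[OF assms(1)])
  have "\<ominus> x \<in> C" by (rule subringE(5)[OF assms])
  moreover have "\<ominus> x \<oplus> x = \<zero>" using subringE(1)[OF assms(1)] assms(2) by (auto simp: l_neg)
  ultimately show ?thesis using C.minus_equality[of "\<ominus> x" x] assms(2) by simp
qed

lemma (in ring) minus_subring: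
  "subring C R \<Longrightarrow> y \<in> C \<Longrightarrow> x \<ominus>\<^bsub>R\<lparr>carrier := C\<rparr>\<^esub> y = x \<ominus> y"
  by (simp add: a_minus_def a_inv_subring)

lemma power_span_update: "power_span (R\<lparr>carrier := C\<rparr>) Y x k = power_span R Y x k"
proof (induction k)
  case (Suc k)
  have "x [^]\<^bsub>R\<lparr>carrier := C\<rparr>\<^esub> n = x [^]\<^bsub>R\<^esub> n" for n :: nat by (simp add: nat_pow_def)
  then show ?case using Suc by simp
qed simp

lemma is_submodule_update:
  "C \<subseteq> carrier R \<Longrightarrow> is_submodule (R\<lparr>carrier := C\<rparr>) Y N \<longleftrightarrow> is_submodule R Y N \<and> N \<subseteq> C"
  by (auto simp: is_submodule_def)

lemma (in cring) ideal_iff_submodule: "ideal I R \<longleftrightarrow> is_submodule R (carrier R) I"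
proof
  assume "ideal I R"
  then interpret ideal I R .
  show "is_submodule R (carrier R) I"
    using a_subset by (auto simp: is_submodule_def I_l_closed)
next
  assume I: "is_submodule R (carrier R) I"
  note d = is_submoduleD[OF I]
  show "ideal I R"
  proof (rule idealI[OF ring_axioms])
    show "subgroup I (add_monoid R)"
    proof (rule add.subgroupI)
      show "I \<subseteq> carrier R" using d(1) by blast
      show "I \<noteq> {}" using d(2) by blast
      show "\<ominus> a \<in> I" if "a \<in> I" for a
        using submodule_uminus[OF carrier_is_subring I that] .
      show "a \<oplus> b \<in> I" if "a \<in> I" "b \<in> I" for a b using d(3) that .
    qed
    show "x \<otimes> a \<in> I" if "a \<in> I" "x \<in> carrier R" for a x using d(4) that by blast
    then show "a \<otimes> x \<in> I" if "a \<in> I" "x \<in> carrier R" for a x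
      using that d(1) m_comm by metis
  qed
qed

lemma (in cring) primeideal_iff:
  "primeideal I R \<longleftrightarrow> is_submodule R (carrier R) I \<and> \<one> \<notin> I \<and>
    (\<forall>x\<in>carrier R. \<forall>y\<in>carrier R. x \<otimes> y \<in> I \<longrightarrow> x \<in> I \<or> y \<in> I)"
proof
  assume "primeideal I R"
  then interpret primeideal I R .
  show "is_submodule R (carrier R) I \<and> \<one> \<notin> I \<and>
    (\<forall>x\<in>carrier R. \<forall>y\<in>carrier R. x \<otimes> y \<in> I \<longrightarrow> x \<in> I \<or> y \<in> I)"
    using ideal_axioms ideal_iff_submodule I_notcarr one_imp_carrier I_prime by blast
next
  assume "is_submodule R (carrier R) I \<and> \<one> \<notin> I \<and>
    (\<forall>x\<in>carrier R. \<forall>y\<in>carrier R. x \<otimes> y \<in> I \<longrightarrow> x \<in> I \<or> y \<in> I)"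
  then show "primeideal I R"
    using ideal_iff_submodule by (intro primeidealI is_cring) auto
qed

lemma (in domain) C_Spec_iff:
  "q \<in> C_Spec R \<longleftrightarrow> is_submodule R (carrier R) q \<and> \<one> \<notin> q \<and>
    (\<forall>x\<in>carrier R. \<forall>y\<in>carrier R. x \<otimes> y \<in> q \<longrightarrow> x \<in> q \<or> y \<in> q) \<and>
    (\<forall>a\<in>carrier R. \<forall>t\<in>carrier R. \<forall>s\<in>carrier R. s \<noteq> \<zero> \<longrightarrow>
       s \<otimes> s \<otimes> t \<in> square_sums R (carrier R) \<longrightarrow> a \<otimes> a \<oplus> t \<in> q \<longrightarrow> a \<in> q)"
  unfolding C_Spec_def mem_Collect_eq primeideal_iff
  using central_ideal_iff[of q] ideal_iff_submodule[of q] by auto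

section \<open>Finite generation and integrality over the image of \<open>A\<close>\<close>

locale finite_noetherian_extension =
  fixes A :: "('a, 'm) ring_scheme" and B :: "('b, 'n) ring_scheme" and f :: "'a \<Rightarrow> 'b"
  assumes finite: "finite_extension A B f" and noetherian: "noetherian_ring A"
begin

lemma extension: "domain_extension A B f"
  using finite by (simp add: finite_extension_def)

sublocale A: "domain" A using extension by (simp add: domain_extension_def)
sublocale B: "domain" B using extension by (simp add: domain_extension_def)
sublocale A: noetherian_ring A by (rule noetherian)

lemma f_hom: "f \<in> ring_hom A B" and f_inj: "inj_on f (carrier A)"
  using extension by (auto simp: domain_extension_def)

sublocale f: ring_hom_cring A B f
  by unfold_locales (rule f_hom)

lemma f_eq_iff: "a \<in> carrier A \<Longrightarrow> b \<in> carrier A \<Longrightarrow> f a = f b \<longleftrightarrow> a = b"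
  using f_inj by (auto dest: inj_onD)

lemma f_zero_iff: "a \<in> carrier A \<Longrightarrow> f a = \<zero>\<^bsub>B\<^esub> \<longleftrightarrow> a = \<zero>\<^bsub>A\<^esub>"
  using f_eq_iff[of a "\<zero>\<^bsub>A\<^esub>"] by simp

abbreviation A1 where "A1 \<equiv> f ` carrier A"
abbreviation B1 where "B1 \<equiv> birational_gluing A B f"

lemma A1_subring: "subring A1 B"
  using ring_hom_ring.img_is_subring[OF ring_hom_ringI2[OF A.ring_axioms B.ring_axioms f_hom]
      A.carrier_is_subring] by simp

lemma A1_closed: "x \<in> A1 \<Longrightarrow> x \<in> carrier B"
  by auto

lemma submodule_preimage:
  assumes "is_submodule B A1 M"
  shows "ideal {a \<in> carrier A. f a \<in> M} A"
  unfolding A.ideal_iff_submodule using is_submoduleD[OF assms]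
  by (auto simp: is_submodule_def)

lemma ideal_A1_fin_generated:
  assumes I: "is_submodule B A1 I" "I \<subseteq> A1"
  shows "fin_generated B A1 I"
proof -
  let ?J = "{a \<in> carrier A. f a \<in> I}"
  obtain S where S: "S \<subseteq> carrier A" "finite S" "?J = Idl\<^bsub>A\<^esub> S"
    using A.finetely_gen[OF submodule_preimage[OF I(1)]] by blast
  have "f ` S \<subseteq> I" using A.genideal_self[OF S(1)] S(3) by auto
  moreover have "I \<subseteq> M" if M: "is_submodule B A1 M" "f ` S \<subseteq> M" for M
  proof
    fix x assume x: "x \<in> I"
    then obtain a where a: "a \<in> carrier A" "x = f a" using I(2) by blast
    have "Idl\<^bsub>A\<^esub> S \<subseteq> {a \<in> carrier A. f a \<in> M}"
      using S(1) M(2) by (intro A.genideal_minimal submodule_preimage[OF M(1)]) auto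
    then show "x \<in> M" using a x S(3) by auto
  qed
  ultimately show ?thesis unfolding fin_generated_def using S(2) by blast
qed

lemma submodule_fin_generated:
  assumes N: "is_submodule B A1 N"
  shows "fin_generated B A1 N"
proof -
  obtain G where G: "finite G" "G \<subseteq> carrier B"
    "\<And>b. b \<in> carrier B \<Longrightarrow> \<exists>c\<in>G \<rightarrow> carrier A. b = (\<Oplus>\<^bsub>B\<^esub>g\<in>G. f (c g) \<otimes>\<^bsub>B\<^esub> g)"
    using finite by (auto simp: finite_extension_def)
  have sum_mem: "(\<Oplus>\<^bsub>B\<^esub>g\<in>H. f (c g) \<otimes>\<^bsub>B\<^esub> g) \<in> M"
    if M: "is_submodule B A1 M" "G \<subseteq> M" and c: "c \<in> G \<rightarrow> carrier A" and H: "H \<subseteq> G" for M c H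
    using finite_subset[OF H G(1)] H
  proof (induction H rule: finite_induct)
    case empty
    then show ?case using is_submoduleD(2)[OF M(1)] by simp
  next
    case (insert g H)
    have cl: "(\<lambda>g. f (c g) \<otimes>\<^bsub>B\<^esub> g) \<in> insert g H \<rightarrow> carrier B"
      using insert.prems c G(2) by (auto intro!: B.m_closed f.hom_closed)
    have "f (c g) \<otimes>\<^bsub>B\<^esub> g \<in> M"
      using insert.prems c M by (intro is_submoduleD(4)[OF M(1)]) auto
    moreover have "(\<Oplus>\<^bsub>B\<^esub>g\<in>H. f (c g) \<otimes>\<^bsub>B\<^esub> g) \<in> M" using insert by auto
    ultimately show ?case
      using insert.hyps cl is_submoduleD(3)[OF M(1)] by (simp add: B.finsum_insert)
  qed
  have min: "N \<subseteq> M" if M: "is_submodule B A1 M" "G \<subseteq> M" for M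
    using is_submoduleD(1)[OF N] G(3) sum_mem[OF M _ subset_refl] by blast
  show ?thesis
    by (rule B.submodule_fin_generated[OF A1_subring ideal_A1_fin_generated G(1,2) N min])
qed

lemma power_in_power_span: "x \<in> carrier B \<Longrightarrow> \<exists>k. x [^]\<^bsub>B\<^esub> k \<in> power_span B A1 x k"
  by (rule B.power_in_power_span[OF A1_subring _ submodule_fin_generated])

section \<open>The birational gluing and its cone of sums of squares\<close>

lemma birational_gluing_iff:
  "b \<in> B1 \<longleftrightarrow> b \<in> carrier B \<and> (\<exists>s\<in>A1. s \<noteq> \<zero>\<^bsub>B\<^esub> \<and> s \<otimes>\<^bsub>B\<^esub> b \<in> A1)"
proof -
  have "frac_emb B b \<in> frac_map B f ` carrier (frac_field A) \<longleftrightarrow>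
      (\<exists>s\<in>carrier A. s \<noteq> \<zero>\<^bsub>A\<^esub> \<and> (\<exists>a\<in>carrier A. f s \<otimes>\<^bsub>B\<^esub> b = f a))" if b: "b \<in> carrier B"
  proof -
    have eq: "frac_emb B b = frac_map B f (fraction A a s) \<longleftrightarrow> f s \<otimes>\<^bsub>B\<^esub> b = f a"
      if p: "(a, s) \<in> frac_pairs A" for a s
    proof -
      have "(b, \<one>\<^bsub>B\<^esub>) \<in> frac_pairs B" using b by (simp add: frac_pairs_def)
      then have "frac_emb B b = frac_map B f (fraction A a s) \<longleftrightarrow> b \<otimes>\<^bsub>B\<^esub> f s = f a \<otimes>\<^bsub>B\<^esub> \<one>\<^bsub>B\<^esub>"
        unfolding frac_emb_def frac_map_frac(1)[OF extension p]
        by (rule B.frac_eq_iff[OF _ frac_map_frac(2)[OF extension p]])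
      then show ?thesis using p b by (auto simp: frac_pairs_def B.m_comm)
    qed
    have "frac_emb B b \<in> frac_map B f ` carrier (frac_field A) \<longleftrightarrow>
      (\<exists>a s. (a, s) \<in> frac_pairs A \<and> frac_emb B b = frac_map B f (fraction A a s))"
      unfolding A.carrier_frac_field by blast
    also have "\<dots> \<longleftrightarrow> (\<exists>a s. (a, s) \<in> frac_pairs A \<and> f s \<otimes>\<^bsub>B\<^esub> b = f a)" using eq by blast
    finally show ?thesis unfolding frac_pairs_def by blast
  qed
  then show ?thesis unfolding birational_gluing_def using f_zero_iff by auto
qed

lemma B1_closed: "x \<in> B1 \<Longrightarrow> x \<in> carrier B"
  by (simp add: birational_gluing_iff)

lemma A1_B1: "A1 \<subseteq> B1"
proof
  fix x assume x: "x \<in> A1"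
  have "\<one>\<^bsub>B\<^esub> \<otimes>\<^bsub>B\<^esub> x = x" using x by auto
  then show "x \<in> B1"
    using x subringE(3)[OF A1_subring] A1_closed B.one_not_zero
    unfolding birational_gluing_iff by metis
qed

lemma B_mult_nonzero:
  "x \<in> carrier B \<Longrightarrow> y \<in> carrier B \<Longrightarrow> x \<noteq> \<zero>\<^bsub>B\<^esub> \<Longrightarrow> y \<noteq> \<zero>\<^bsub>B\<^esub> \<Longrightarrow> x \<otimes>\<^bsub>B\<^esub> y \<noteq> \<zero>\<^bsub>B\<^esub>"
  using B.integral by blast

lemma B1_subring: "subring B1 B"
proof (rule B.subringI)
  note Ad = subringE[OF A1_subring]
  show "B1 \<subseteq> carrier B" using B1_closed by blast
  show "\<one>\<^bsub>B\<^esub> \<in> B1" using A1_B1 Ad(3) by blast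
  fix x assume "x \<in> B1"
  then obtain s where x: "x \<in> carrier B" "s \<in> A1" "s \<noteq> \<zero>\<^bsub>B\<^esub>" "s \<otimes>\<^bsub>B\<^esub> x \<in> A1"
    unfolding birational_gluing_iff by blast
  have sc: "s \<in> carrier B" using A1_closed[OF x(2)] .
  have "s \<otimes>\<^bsub>B\<^esub> (\<ominus>\<^bsub>B\<^esub> x) = \<ominus>\<^bsub>B\<^esub> (s \<otimes>\<^bsub>B\<^esub> x)" using x(1) sc by (simp add: B.r_minus)
  then have "s \<otimes>\<^bsub>B\<^esub> (\<ominus>\<^bsub>B\<^esub> x) \<in> A1" using Ad(5)[OF x(4)] by simp
  then show "\<ominus>\<^bsub>B\<^esub> x \<in> B1" unfolding birational_gluing_iff using x B.a_inv_closed by blast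
  fix y assume "y \<in> B1"
  then obtain t where y: "y \<in> carrier B" "t \<in> A1" "t \<noteq> \<zero>\<^bsub>B\<^esub>" "t \<otimes>\<^bsub>B\<^esub> y \<in> A1"
    unfolding birational_gluing_iff by blast
  have tc: "t \<in> carrier B" using A1_closed[OF y(2)] .
  have st: "s \<otimes>\<^bsub>B\<^esub> t \<in> A1" "s \<otimes>\<^bsub>B\<^esub> t \<noteq> \<zero>\<^bsub>B\<^esub>"
    using x y sc tc Ad(6) B_mult_nonzero by blast+
  have "(s \<otimes>\<^bsub>B\<^esub> t) \<otimes>\<^bsub>B\<^esub> (x \<otimes>\<^bsub>B\<^esub> y) = (s \<otimes>\<^bsub>B\<^esub> x) \<otimes>\<^bsub>B\<^esub> (t \<otimes>\<^bsub>B\<^esub> y)"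
    using x(1) y(1) sc tc by algebra
  then have "(s \<otimes>\<^bsub>B\<^esub> t) \<otimes>\<^bsub>B\<^esub> (x \<otimes>\<^bsub>B\<^esub> y) \<in> A1" using Ad(6)[OF x(4) y(4)] by simp
  then show "x \<otimes>\<^bsub>B\<^esub> y \<in> B1"
    unfolding birational_gluing_iff using st x(1) y(1) B.m_closed by blast
  have "(s \<otimes>\<^bsub>B\<^esub> t) \<otimes>\<^bsub>B\<^esub> (x \<oplus>\<^bsub>B\<^esub> y) = t \<otimes>\<^bsub>B\<^esub> (s \<otimes>\<^bsub>B\<^esub> x) \<oplus>\<^bsub>B\<^esub> s \<otimes>\<^bsub>B\<^esub> (t \<otimes>\<^bsub>B\<^esub> y)"
    using x(1) y(1) sc tc by algebra
  then have "(s \<otimes>\<^bsub>B\<^esub> t) \<otimes>\<^bsub>B\<^esub> (x \<oplus>\<^bsub>B\<^esub> y) \<in> A1"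
    using Ad(7)[OF Ad(6)[OF y(2) x(4)] Ad(6)[OF x(2) y(4)]] by simp
  then show "x \<oplus>\<^bsub>B\<^esub> y \<in> B1"
    unfolding birational_gluing_iff using st x(1) y(1) B.a_closed by blast
qed

text \<open>The elements of \<open>B1\<close> that are sums of squares in K(A), with square
  denominators cleared. Only \<open>A1\<close> occurs on the right, so no choice of an intermediate
  ring enters.\<close>

definition P :: "'b set" where
  "P = {t\<in>B1. \<exists>s\<in>A1. s \<noteq> \<zero>\<^bsub>B\<^esub> \<and> s \<otimes>\<^bsub>B\<^esub> s \<otimes>\<^bsub>B\<^esub> t \<in> square_sums B A1}"

lemma A1_subset: "A1 \<subseteq> carrier B"
  by auto

lemma A1_mult: "x \<in> A1 \<Longrightarrow> y \<in> A1 \<Longrightarrow> x \<otimes>\<^bsub>B\<^esub> y \<in> A1"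
  by (rule subringE(6)[OF A1_subring])

lemma sums_A1_add: "x \<in> square_sums B A1 \<Longrightarrow> y \<in> square_sums B A1 \<Longrightarrow> x \<oplus>\<^bsub>B\<^esub> y \<in> square_sums B A1"
  using B.square_sums_add[OF A1_subset] by blast

lemma sums_A1_square_mult: "s \<in> A1 \<Longrightarrow> x \<in> square_sums B A1 \<Longrightarrow> s \<otimes>\<^bsub>B\<^esub> s \<otimes>\<^bsub>B\<^esub> x \<in> square_sums B A1"
  using B.square_sums_square_mult[OF A1_subset A1_mult] by blast

lemma sums_A1_mult: "x \<in> square_sums B A1 \<Longrightarrow> y \<in> square_sums B A1 \<Longrightarrow> x \<otimes>\<^bsub>B\<^esub> y \<in> square_sums B A1"
  using B.square_sums_mult[OF A1_subset A1_mult] by blast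

lemma PI: "t \<in> B1 \<Longrightarrow> s \<in> A1 \<Longrightarrow> s \<noteq> \<zero>\<^bsub>B\<^esub> \<Longrightarrow> s \<otimes>\<^bsub>B\<^esub> s \<otimes>\<^bsub>B\<^esub> t \<in> square_sums B A1 \<Longrightarrow> t \<in> P"
  by (auto simp: P_def)

lemma P_closed_operations:
  assumes "x \<in> P" "y \<in> P"
  shows "x \<oplus>\<^bsub>B\<^esub> y \<in> P" "x \<otimes>\<^bsub>B\<^esub> y \<in> P"
proof -
  obtain s where x: "x \<in> B1" "s \<in> A1" "s \<noteq> \<zero>\<^bsub>B\<^esub>" "s \<otimes>\<^bsub>B\<^esub> s \<otimes>\<^bsub>B\<^esub> x \<in> square_sums B A1"
    using assms(1) by (auto simp: P_def)
  obtain t where y: "y \<in> B1" "t \<in> A1" "t \<noteq> \<zero>\<^bsub>B\<^esub>" "t \<otimes>\<^bsub>B\<^esub> t \<otimes>\<^bsub>B\<^esub> y \<in> square_sums B A1"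
    using assms(2) by (auto simp: P_def)
  have c: "x \<in> carrier B" "y \<in> carrier B" "s \<in> carrier B" "t \<in> carrier B"
    using x y B1_closed A1_closed by blast+
  have st: "s \<otimes>\<^bsub>B\<^esub> t \<in> A1" "s \<otimes>\<^bsub>B\<^esub> t \<noteq> \<zero>\<^bsub>B\<^esub>"
    using x y c A1_mult B_mult_nonzero by blast+
  have "(s \<otimes>\<^bsub>B\<^esub> t) \<otimes>\<^bsub>B\<^esub> (s \<otimes>\<^bsub>B\<^esub> t) \<otimes>\<^bsub>B\<^esub> (x \<oplus>\<^bsub>B\<^esub> y)
      = t \<otimes>\<^bsub>B\<^esub> t \<otimes>\<^bsub>B\<^esub> (s \<otimes>\<^bsub>B\<^esub> s \<otimes>\<^bsub>B\<^esub> x) \<oplus>\<^bsub>B\<^esub> s \<otimes>\<^bsub>B\<^esub> s \<otimes>\<^bsub>B\<^esub> (t \<otimes>\<^bsub>B\<^esub> t \<otimes>\<^bsub>B\<^esub> y)"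
    using c by algebra
  also have "\<dots> \<in> square_sums B A1"
    by (rule sums_A1_add[OF sums_A1_square_mult[OF y(2) x(4)] sums_A1_square_mult[OF x(2) y(4)]])
  finally show "x \<oplus>\<^bsub>B\<^esub> y \<in> P"
    by (rule PI[OF subringE(7)[OF B1_subring x(1) y(1)] st])
  have "(s \<otimes>\<^bsub>B\<^esub> t) \<otimes>\<^bsub>B\<^esub> (s \<otimes>\<^bsub>B\<^esub> t) \<otimes>\<^bsub>B\<^esub> (x \<otimes>\<^bsub>B\<^esub> y)
      = (s \<otimes>\<^bsub>B\<^esub> s \<otimes>\<^bsub>B\<^esub> x) \<otimes>\<^bsub>B\<^esub> (t \<otimes>\<^bsub>B\<^esub> t \<otimes>\<^bsub>B\<^esub> y)"
    using c by algebra
  also have "\<dots> \<in> square_sums B A1"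
    by (rule sums_A1_mult[OF x(4) y(4)])
  finally show "x \<otimes>\<^bsub>B\<^esub> y \<in> P"
    by (rule PI[OF subringE(6)[OF B1_subring x(1) y(1)] st])
qed

lemma square_sums_B1_denominator:
  "x \<in> square_sums B B1 \<Longrightarrow>
    x \<in> carrier B \<and> (\<exists>d\<in>A1. d \<noteq> \<zero>\<^bsub>B\<^esub> \<and> d \<otimes>\<^bsub>B\<^esub> d \<otimes>\<^bsub>B\<^esub> x \<in> square_sums B A1)"
proof (induction rule: square_sums.induct)
  case zero
  have "\<one>\<^bsub>B\<^esub> \<otimes>\<^bsub>B\<^esub> \<one>\<^bsub>B\<^esub> \<otimes>\<^bsub>B\<^esub> \<zero>\<^bsub>B\<^esub> \<in> square_sums B A1" by (simp add: square_sums.zero)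
  then show ?case using subringE(3)[OF A1_subring] B.one_not_zero B.zero_closed by blast
next
  case (step y x)
  obtain d where d: "d \<in> A1" "d \<noteq> \<zero>\<^bsub>B\<^esub>" "d \<otimes>\<^bsub>B\<^esub> d \<otimes>\<^bsub>B\<^esub> x \<in> square_sums B A1"
    using step.IH by blast
  obtain e where e: "e \<in> A1" "e \<noteq> \<zero>\<^bsub>B\<^esub>" "e \<otimes>\<^bsub>B\<^esub> y \<in> A1"
    using step.hyps(1) unfolding birational_gluing_iff by blast
  have c: "x \<in> carrier B" "y \<in> carrier B" "d \<in> carrier B" "e \<in> carrier B"
    using step d e A1_closed B1_closed by blast+
  have "(d \<otimes>\<^bsub>B\<^esub> e) \<otimes>\<^bsub>B\<^esub> (d \<otimes>\<^bsub>B\<^esub> e) \<otimes>\<^bsub>B\<^esub> (y \<otimes>\<^bsub>B\<^esub> y \<oplus>\<^bsub>B\<^esub> x)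
    = (d \<otimes>\<^bsub>B\<^esub> (e \<otimes>\<^bsub>B\<^esub> y)) \<otimes>\<^bsub>B\<^esub> (d \<otimes>\<^bsub>B\<^esub> (e \<otimes>\<^bsub>B\<^esub> y)) \<oplus>\<^bsub>B\<^esub> e \<otimes>\<^bsub>B\<^esub> e \<otimes>\<^bsub>B\<^esub> (d \<otimes>\<^bsub>B\<^esub> d \<otimes>\<^bsub>B\<^esub> x)"
    using c by algebra
  also have "\<dots> \<in> square_sums B A1"
    by (rule square_sums.step[OF A1_mult[OF d(1) e(3)] sums_A1_square_mult[OF e(1) d(3)]])
  finally show ?case using c d e A1_mult B_mult_nonzero by (meson B.m_closed B.a_closed)
qed

lemma positive_cancel:
  assumes s: "s \<in> B1" "s \<noteq> \<zero>\<^bsub>B\<^esub>" and t: "t \<in> B1"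
    and d: "d \<in> A1" "d \<noteq> \<zero>\<^bsub>B\<^esub>" "d \<otimes>\<^bsub>B\<^esub> d \<otimes>\<^bsub>B\<^esub> (s \<otimes>\<^bsub>B\<^esub> s \<otimes>\<^bsub>B\<^esub> t) \<in> square_sums B A1"
  shows "t \<in> P"
proof -
  obtain e where e: "e \<in> A1" "e \<noteq> \<zero>\<^bsub>B\<^esub>" "e \<otimes>\<^bsub>B\<^esub> s \<in> A1"
    using s(1) unfolding birational_gluing_iff by blast
  have c: "s \<in> carrier B" "t \<in> carrier B" "d \<in> carrier B" "e \<in> carrier B"
    using s t d e A1_closed B1_closed by blast+
  \<comment> \<open>The natural denominator \<open>d s\<close> need not lie in \<open>A1\<close>;
    the factor \<open>e\<close> clears it.\<close>
  let ?r = "d \<otimes>\<^bsub>B\<^esub> (e \<otimes>\<^bsub>B\<^esub> s)"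
  have "?r \<otimes>\<^bsub>B\<^esub> ?r \<otimes>\<^bsub>B\<^esub> t = e \<otimes>\<^bsub>B\<^esub> e \<otimes>\<^bsub>B\<^esub> (d \<otimes>\<^bsub>B\<^esub> d \<otimes>\<^bsub>B\<^esub> (s \<otimes>\<^bsub>B\<^esub> s \<otimes>\<^bsub>B\<^esub> t))"
    using c by algebra
  also have "\<dots> \<in> square_sums B A1" by (rule sums_A1_square_mult[OF e(1) d(3)])
  finally have "?r \<otimes>\<^bsub>B\<^esub> ?r \<otimes>\<^bsub>B\<^esub> t \<in> square_sums B A1" .
  moreover have "?r \<in> A1" using A1_mult d(1) e(3) by blast
  moreover have "?r \<noteq> \<zero>\<^bsub>B\<^esub>" using c d(2) e(2) s(2) B_mult_nonzero by simp
  ultimately show ?thesis using PI[OF t] by blast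
qed

text \<open>All rings between \<open>A1\<close> and \<open>B1\<close> have fraction field K(A),
  hence the same sums of squares in it. In terms of elements: denominators of the finitely many
  squared elements can be moved into \<open>A1\<close>.\<close>

lemma positive_iff:
  assumes C: "A1 \<subseteq> C" "C \<subseteq> B1" and t: "t \<in> C"
  shows "(\<exists>s\<in>C. s \<noteq> \<zero>\<^bsub>B\<^esub> \<and> s \<otimes>\<^bsub>B\<^esub> s \<otimes>\<^bsub>B\<^esub> t \<in> square_sums B C) \<longleftrightarrow> t \<in> P"
proof
  assume "t \<in> P"
  then show "\<exists>s\<in>C. s \<noteq> \<zero>\<^bsub>B\<^esub> \<and> s \<otimes>\<^bsub>B\<^esub> s \<otimes>\<^bsub>B\<^esub> t \<in> square_sums B C"
    using C(1) square_sums_mono[OF C(1)] unfolding P_def by blast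
next
  assume "\<exists>s\<in>C. s \<noteq> \<zero>\<^bsub>B\<^esub> \<and> s \<otimes>\<^bsub>B\<^esub> s \<otimes>\<^bsub>B\<^esub> t \<in> square_sums B C"
  then obtain s where s: "s \<in> B1" "s \<noteq> \<zero>\<^bsub>B\<^esub>" "s \<otimes>\<^bsub>B\<^esub> s \<otimes>\<^bsub>B\<^esub> t \<in> square_sums B B1"
    using C(2) square_sums_mono[OF C(2)] by blast
  obtain d where "d \<in> A1" "d \<noteq> \<zero>\<^bsub>B\<^esub>"
    "d \<otimes>\<^bsub>B\<^esub> d \<otimes>\<^bsub>B\<^esub> (s \<otimes>\<^bsub>B\<^esub> s \<otimes>\<^bsub>B\<^esub> t) \<in> square_sums B A1"
    using square_sums_B1_denominator[OF s(3)] by blast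
  then show "t \<in> P" using positive_cancel[OF s(1,2)] t C(2) by blast
qed

text \<open>Finiteness and integrality over \<open>A1\<close> are inherited from \<open>B\<close>,
  because a submodule of \<open>B1\<close> is a submodule of \<open>B\<close> and powers of an
  element do not depend on the carrier.\<close>

sublocale K: positive_domain "B\<lparr>carrier := B1\<rparr>" A1 P
proof -
  have sub: "B1 \<subseteq> carrier B" using B1_closed by blast
  interpret R: "domain" "B\<lparr>carrier := B1\<rparr>"
    by (rule B.subdomain_is_domain[OF B.subdomainI'[OF B1_subring]])
  show "positive_domain (B\<lparr>carrier := B1\<rparr>) A1 P"
  proof (rule positive_domain.intro[OF R.domain_axioms], rule positive_domain_axioms.intro)
    note Ad = subringE[OF A1_subring]
    show "subring A1 (B\<lparr>carrier := B1\<rparr>)"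
    proof (rule R.subringI)
      show "\<ominus>\<^bsub>B\<lparr>carrier := B1\<rparr>\<^esub> x \<in> A1" if "x \<in> A1" for x
        using Ad(5)[OF that] B.a_inv_subring[OF B1_subring] that A1_B1 by (metis subsetD)
    qed (use A1_B1 Ad in auto)
    show "P \<subseteq> carrier (B\<lparr>carrier := B1\<rparr>)" by (auto simp: P_def)
    show "x \<oplus>\<^bsub>B\<lparr>carrier := B1\<rparr>\<^esub> y \<in> P" "x \<otimes>\<^bsub>B\<lparr>carrier := B1\<rparr>\<^esub> y \<in> P"
      if "x \<in> P" "y \<in> P" for x y
      using P_closed_operations[OF that] by simp_all
    show "x \<otimes>\<^bsub>B\<lparr>carrier := B1\<rparr>\<^esub> x \<in> P" if "x \<in> carrier (B\<lparr>carrier := B1\<rparr>)" for x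
    proof -
      have x: "x \<in> B1" using that by simp
      obtain s where s: "s \<in> A1" "s \<noteq> \<zero>\<^bsub>B\<^esub>" "s \<otimes>\<^bsub>B\<^esub> x \<in> A1"
        using x unfolding birational_gluing_iff by blast
      have c: "s \<in> carrier B" "x \<in> carrier B" using s A1_closed B1_closed x by blast+
      have "s \<otimes>\<^bsub>B\<^esub> s \<otimes>\<^bsub>B\<^esub> (x \<otimes>\<^bsub>B\<^esub> x) = (s \<otimes>\<^bsub>B\<^esub> x) \<otimes>\<^bsub>B\<^esub> (s \<otimes>\<^bsub>B\<^esub> x) \<oplus>\<^bsub>B\<^esub> \<zero>\<^bsub>B\<^esub>"
        using c by algebra
      also have "\<dots> \<in> square_sums B A1" using s(3) by (intro square_sums.intros)
      finally show ?thesis using PI[OF subringE(6)[OF B1_subring x x] s(1,2)] by simp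
    qed
    show "t \<in> P" if h: "s \<in> carrier (B\<lparr>carrier := B1\<rparr>)" "s \<noteq> \<zero>\<^bsub>B\<lparr>carrier := B1\<rparr>\<^esub>"
      "t \<in> carrier (B\<lparr>carrier := B1\<rparr>)"
      "s \<otimes>\<^bsub>B\<lparr>carrier := B1\<rparr>\<^esub> s \<otimes>\<^bsub>B\<lparr>carrier := B1\<rparr>\<^esub> t \<in> P" for s t
    proof -
      obtain d where "d \<in> A1" "d \<noteq> \<zero>\<^bsub>B\<^esub>"
        "d \<otimes>\<^bsub>B\<^esub> d \<otimes>\<^bsub>B\<^esub> (s \<otimes>\<^bsub>B\<^esub> s \<otimes>\<^bsub>B\<^esub> t) \<in> square_sums B A1"
        using h(4) unfolding P_def by auto
      then show ?thesis using positive_cancel[of s t d] h(1-3) by simp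
    qed
    show "\<exists>k. x [^]\<^bsub>B\<lparr>carrier := B1\<rparr>\<^esub> k \<in> power_span (B\<lparr>carrier := B1\<rparr>) A1 x k"
      if "x \<in> carrier (B\<lparr>carrier := B1\<rparr>)" for x
      using power_in_power_span[OF B1_closed, of x] that
      by (simp add: power_span_update nat_pow_def)
    show "fin_generated (B\<lparr>carrier := B1\<rparr>) A1 N" if "is_submodule (B\<lparr>carrier := B1\<rparr>) A1 N" for N
    proof -
      have N: "is_submodule B A1 N" using is_submodule_update[OF sub] that by blast
      obtain Y where Y: "finite Y" "Y \<subseteq> N" "\<And>M. is_submodule B A1 M \<Longrightarrow> Y \<subseteq> M \<Longrightarrow> N \<subseteq> M"
        using submodule_fin_generated[OF N] unfolding fin_generated_def by blast
      have "N \<subseteq> M" if "is_submodule (B\<lparr>carrier := B1\<rparr>) A1 M" "Y \<subseteq> M" for M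
        using Y(3)[OF _ that(2)] is_submodule_update[OF sub, of A1 M] that(1) by blast
      then show ?thesis unfolding fin_generated_def using Y(1,2) by blast
    qed
  qed
qed

section \<open>Translation of central primes, gluings and subintegrality\<close>

abbreviation Sub :: "'b set \<Rightarrow> ('b, 'n) ring_scheme" where
  "Sub C \<equiv> B\<lparr>carrier := C\<rparr>"

lemma Sub_minus:
  assumes "subring C B" "C \<subseteq> B1" "y \<in> C"
  shows "x \<ominus>\<^bsub>Sub C\<^esub> y = x \<ominus>\<^bsub>Sub B1\<^esub> y"
  using B.minus_subring[OF assms(1,3)] B.minus_subring[OF B1_subring, of y] assms(2,3) by auto

lemma subring_Sub_B1:
  assumes "subring D (Sub B1)"
  shows "subring D B" "D \<subseteq> B1"
proof -
  note d = subringE[OF assms]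
  show DB: "D \<subseteq> B1" using d(1) by simp
  show "subring D B"
  proof (rule B.subringI)
    show "D \<subseteq> carrier B" using DB B1_closed by blast
    show "\<ominus>\<^bsub>B\<^esub> h \<in> D" if "h \<in> D" for h
      using d(5)[OF that] B.a_inv_subring[OF B1_subring, of h] DB that by auto
  qed (use d in auto)
qed

text \<open>Centrality in \<open>C\<close> tests with sums of squares from the fraction field of
  \<open>C\<close>; by \<open>positive_iff\<close> those lying in \<open>C\<close> are exactly the
  elements of \<open>P\<close> in \<open>C\<close>.\<close>

lemma C_Spec_Sub_iff:
  assumes C: "subring C B" "A1 \<subseteq> C" "C \<subseteq> B1"
  shows "q \<in> C_Spec (Sub C) \<longleftrightarrow> K.cprime C q"
proof -
  interpret T: "domain" "Sub C" by (rule B.subring_is_domain[OF C(1)])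
  have sub: "is_submodule (Sub C) C q \<longleftrightarrow> is_submodule (Sub B1) C q \<and> q \<subseteq> C"
    using C(3) by (auto simp: is_submodule_def)
  have central: "(\<forall>t\<in>C. \<forall>s\<in>C. s \<noteq> \<zero>\<^bsub>B\<^esub> \<longrightarrow>
       s \<otimes>\<^bsub>B\<^esub> s \<otimes>\<^bsub>B\<^esub> t \<in> square_sums B C \<longrightarrow> a \<otimes>\<^bsub>B\<^esub> a \<oplus>\<^bsub>B\<^esub> t \<in> q \<longrightarrow> a \<in> q) \<longleftrightarrow>
     (\<forall>t\<in>P. a \<otimes>\<^bsub>B\<^esub> a \<oplus>\<^bsub>B\<^esub> t \<in> q \<longrightarrow> a \<in> q)" if q: "q \<subseteq> C" and a: "a \<in> C" for a
  proof -
    have "t \<in> C" if t: "t \<in> P" "a \<otimes>\<^bsub>B\<^esub> a \<oplus>\<^bsub>B\<^esub> t \<in> q" for t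
    proof -
      have c: "a \<in> carrier B" "t \<in> carrier B"
        using a C(3) B1_closed K.P_closed t(1) by auto
      have "(a \<otimes>\<^bsub>B\<^esub> a \<oplus>\<^bsub>B\<^esub> t) \<ominus>\<^bsub>B\<^esub> a \<otimes>\<^bsub>B\<^esub> a \<in> C"
        using t(2) q a subringE(6)[OF C(1)] by (intro B.subring_minus[OF C(1)]) auto
      moreover have "(a \<otimes>\<^bsub>B\<^esub> a \<oplus>\<^bsub>B\<^esub> t) \<ominus>\<^bsub>B\<^esub> a \<otimes>\<^bsub>B\<^esub> a = t" using c by algebra
      ultimately show ?thesis by simp
    qed
    then show ?thesis using positive_iff[OF C(2,3)] by blast
  qed
  show ?thesis
    unfolding T.C_Spec_iff K.cprime_def square_sums_update
    using sub central by simp blast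
qed

lemma f_mem_iff: "p \<subseteq> carrier A \<Longrightarrow> a \<in> carrier A \<Longrightarrow> f a \<in> f ` p \<longleftrightarrow> a \<in> p"
  by (rule inj_on_image_mem_iff[OF f_inj])

lemma f_in_P_iff:
  assumes t: "t \<in> carrier A"
  shows "f t \<in> P \<longleftrightarrow>
    (\<exists>s\<in>carrier A. s \<noteq> \<zero>\<^bsub>A\<^esub> \<and> s \<otimes>\<^bsub>A\<^esub> s \<otimes>\<^bsub>A\<^esub> t \<in> square_sums A (carrier A))"
proof -
  have cl: "square_sums A (carrier A) \<subseteq> carrier A" using A.square_sums_closed by blast
  have eq: "square_sums B A1 = f ` square_sums A (carrier A)"
    by (rule square_sums_image[OF A.ring_axioms B.ring_axioms f_hom subset_refl])
  have "f s \<otimes>\<^bsub>B\<^esub> f s \<otimes>\<^bsub>B\<^esub> f t \<in> square_sums B A1 \<longleftrightarrow>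
      s \<otimes>\<^bsub>A\<^esub> s \<otimes>\<^bsub>A\<^esub> t \<in> square_sums A (carrier A)" if "s \<in> carrier A" for s
    using f_mem_iff[OF cl, of "s \<otimes>\<^bsub>A\<^esub> s \<otimes>\<^bsub>A\<^esub> t"] that t by (simp add: eq)
  then show ?thesis
    using positive_iff[OF subset_refl A1_B1, of "f t"] t f_zero_iff by auto
qed

lemma C_Spec_A_iff: "p \<in> C_Spec A \<longleftrightarrow> p \<subseteq> carrier A \<and> K.cprime A1 (f ` p)"
proof (cases "p \<subseteq> carrier A")
  case False
  then show ?thesis unfolding A.C_Spec_iff by (auto simp: is_submodule_def)
next
  case True
  note mem = f_mem_iff[OF True]
  have pc: "x \<in> carrier A" if "x \<in> p" for x using True that by blast
  have sub: "is_submodule (Sub B1) A1 (f ` p) \<longleftrightarrow> is_submodule A (carrier A) p"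
  proof
    assume s: "is_submodule (Sub B1) A1 (f ` p)"
    show "is_submodule A (carrier A) p"
      unfolding is_submodule_def
    proof (intro conjI ballI)
      show "p \<subseteq> carrier A" by (rule True)
      show "\<zero>\<^bsub>A\<^esub> \<in> p" using is_submoduleD(2)[OF s] mem[of "\<zero>\<^bsub>A\<^esub>"] by simp
      show "x \<oplus>\<^bsub>A\<^esub> y \<in> p" if "x \<in> p" "y \<in> p" for x y
        using is_submoduleD(3)[OF s, of "f x" "f y"] mem[of "x \<oplus>\<^bsub>A\<^esub> y"] that pc by simp
      show "a \<otimes>\<^bsub>A\<^esub> x \<in> p" if "a \<in> carrier A" "x \<in> p" for a x
        using is_submoduleD(4)[OF s, of "f a" "f x"] mem[of "a \<otimes>\<^bsub>A\<^esub> x"] that pc by simp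
    qed
  next
    assume s: "is_submodule A (carrier A) p"
    note d = is_submoduleD[OF s]
    show "is_submodule (Sub B1) A1 (f ` p)"
      unfolding is_submodule_def
    proof (intro conjI ballI)
      show "f ` p \<subseteq> carrier (Sub B1)" using True A1_B1 by auto
      show "\<zero>\<^bsub>Sub B1\<^esub> \<in> f ` p" using mem[of "\<zero>\<^bsub>A\<^esub>"] d(2) by simp
      show "x \<oplus>\<^bsub>Sub B1\<^esub> y \<in> f ` p" if xy: "x \<in> f ` p" "y \<in> f ` p" for x y
      proof -
        obtain u v where "x = f u" "y = f v" "u \<in> p" "v \<in> p" using xy by blast
        then have "x \<oplus>\<^bsub>Sub B1\<^esub> y = f (u \<oplus>\<^bsub>A\<^esub> v)" "u \<oplus>\<^bsub>A\<^esub> v \<in> p" using pc d(3) by auto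
        then show ?thesis by blast
      qed
      show "x \<otimes>\<^bsub>Sub B1\<^esub> y \<in> f ` p" if xy: "x \<in> A1" "y \<in> f ` p" for x y
      proof -
        obtain u v where "x = f u" "y = f v" "u \<in> carrier A" "v \<in> p" using xy by blast
        then have "x \<otimes>\<^bsub>Sub B1\<^esub> y = f (u \<otimes>\<^bsub>A\<^esub> v)" "u \<otimes>\<^bsub>A\<^esub> v \<in> p" using pc d(4) by auto
        then show ?thesis by blast
      qed
    qed
  qed
  have one: "\<one>\<^bsub>Sub B1\<^esub> \<in> f ` p \<longleftrightarrow> \<one>\<^bsub>A\<^esub> \<in> p" using mem[of "\<one>\<^bsub>A\<^esub>"] by simp
  have prime: "(\<forall>x\<in>A1. \<forall>y\<in>A1. x \<otimes>\<^bsub>Sub B1\<^esub> y \<in> f ` p \<longrightarrow> x \<in> f ` p \<or> y \<in> f ` p) \<longleftrightarrow>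
    (\<forall>x\<in>carrier A. \<forall>y\<in>carrier A. x \<otimes>\<^bsub>A\<^esub> y \<in> p \<longrightarrow> x \<in> p \<or> y \<in> p)"
  proof -
    have "f x \<otimes>\<^bsub>Sub B1\<^esub> f y \<in> f ` p \<longleftrightarrow> x \<otimes>\<^bsub>A\<^esub> y \<in> p"
      if "x \<in> carrier A" "y \<in> carrier A" for x y
      using mem[of "x \<otimes>\<^bsub>A\<^esub> y"] that by simp
    then show ?thesis using mem by (simp add: ball_simps)
  qed
  have central: "(\<forall>t\<in>P. f a \<otimes>\<^bsub>Sub B1\<^esub> f a \<oplus>\<^bsub>Sub B1\<^esub> t \<in> f ` p \<longrightarrow> f a \<in> f ` p) \<longleftrightarrow>
    (\<forall>t\<in>carrier A. \<forall>s\<in>carrier A. s \<noteq> \<zero>\<^bsub>A\<^esub> \<longrightarrow>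
       s \<otimes>\<^bsub>A\<^esub> s \<otimes>\<^bsub>A\<^esub> t \<in> square_sums A (carrier A) \<longrightarrow> a \<otimes>\<^bsub>A\<^esub> a \<oplus>\<^bsub>A\<^esub> t \<in> p \<longrightarrow> a \<in> p)"
    if a: "a \<in> carrier A" for a
  proof -
    have 1: "\<exists>t'\<in>carrier A. t = f t'" if t: "t \<in> P" "f a \<otimes>\<^bsub>B\<^esub> f a \<oplus>\<^bsub>B\<^esub> t \<in> f ` p" for t
    proof -
      obtain x where x: "x \<in> carrier A" "f a \<otimes>\<^bsub>B\<^esub> f a \<oplus>\<^bsub>B\<^esub> t = f x" using t(2) pc by blast
      have c: "t \<in> carrier B" using K.P_closed[OF t(1)] B1_closed by simp
      have "t = (f a \<otimes>\<^bsub>B\<^esub> f a \<oplus>\<^bsub>B\<^esub> t) \<ominus>\<^bsub>B\<^esub> f a \<otimes>\<^bsub>B\<^esub> f a"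
        using c f.hom_closed[OF a] by algebra
      also have "\<dots> = f (x \<ominus>\<^bsub>A\<^esub> a \<otimes>\<^bsub>A\<^esub> a)" unfolding x(2) using x(1) a by (simp add: a_minus_def)
      finally show ?thesis using x(1) a by blast
    qed
    have 2: "f a \<otimes>\<^bsub>B\<^esub> f a \<oplus>\<^bsub>B\<^esub> f t \<in> f ` p \<longleftrightarrow> a \<otimes>\<^bsub>A\<^esub> a \<oplus>\<^bsub>A\<^esub> t \<in> p" if "t \<in> carrier A" for t
      using mem[of "a \<otimes>\<^bsub>A\<^esub> a \<oplus>\<^bsub>A\<^esub> t"] a that by simp
    have "(\<forall>t\<in>P. f a \<otimes>\<^bsub>B\<^esub> f a \<oplus>\<^bsub>B\<^esub> t \<in> f ` p \<longrightarrow> f a \<in> f ` p) \<longleftrightarrow>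
      (\<forall>t\<in>carrier A. f t \<in> P \<longrightarrow> a \<otimes>\<^bsub>A\<^esub> a \<oplus>\<^bsub>A\<^esub> t \<in> p \<longrightarrow> a \<in> p)"
      using 1 2 mem[OF a] by metis
    then show ?thesis using f_in_P_iff by simp blast
  qed
  have "f ` p \<subseteq> A1" using True by blast
  then show ?thesis
    unfolding A.C_Spec_iff K.cprime_def sub one prime using True central by (simp add: ball_simps)
qed

lemma contraction_image: "f ` contraction A f q = q \<inter> A1"
  by (auto simp: contraction_def)

lemma contraction_eq_iff:
  "p \<subseteq> carrier A \<Longrightarrow> contraction A f q = p \<longleftrightarrow> q \<inter> A1 = f ` p"
proof -
  assume p: "p \<subseteq> carrier A"
  have "contraction A f q \<subseteq> carrier A" by (auto simp: contraction_def)
  then show ?thesis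
    using inj_on_image_eq_iff[OF f_inj _ p] contraction_image[of q] by metis
qed

lemma f_hom_Sub: "A1 \<subseteq> C \<Longrightarrow> f \<in> ring_hom A (Sub C)"
  by (rule ring_hom_memI) auto

lemma residue_extension_Sub:
  assumes C: "subring C B" "A1 \<subseteq> C" and q: "primeideal q (Sub C)"
  shows "residue_extension A (Sub C) f q"
proof -
  interpret T: "domain" "Sub C" by (rule B.subring_is_domain[OF C(1)])
  show ?thesis
    by (intro residue_extension.intro residue_extension_axioms.intro A.is_cring T.is_cring q
        f_hom_Sub[OF C(2)])
qed

text \<open>Every element of k(p) is a fraction \<open>a / s\<close> with \<open>a\<close> and
  \<open>s\<close> from \<open>A\<close> and \<open>s \<notin> p\<close>; agreement with the class
  of \<open>c\<close> in k(q) is then the congruence used in \<open>K.gluing\<close>.\<close>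

lemma central_gluing_eq:
  assumes C: "subring C B" "A1 \<subseteq> C" "C \<subseteq> B1" and p: "p \<in> C_Spec A"
  shows "central_gluing A (Sub C) f p = K.gluing C (f ` p)"
proof -
  have pA: "p \<subseteq> carrier A" and pp: "primeideal p A"
    using p C_Spec_A_iff by (auto simp: C_Spec_def)
  have res: "residue_map (Sub C) q f (fraction (A Quot p) (p +>\<^bsub>A\<^esub> a) (p +>\<^bsub>A\<^esub> s))
        = residue_class (Sub C) q c \<longleftrightarrow> f s \<otimes>\<^bsub>B\<^esub> c \<ominus>\<^bsub>Sub B1\<^esub> f a \<in> q"
    if q: "q \<in> C_Spec (Sub C)" "contraction A f q = p"
      and a: "a \<in> carrier A" "s \<in> carrier A" "s \<notin> p" and c: "c \<in> C" for q a s c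
  proof -
    interpret q: residue_extension A "Sub C" f q
      by (rule residue_extension_Sub[OF C(1,2)]) (use q(1) in \<open>simp add: C_Spec_def\<close>)
    have "f s \<otimes>\<^bsub>B\<^esub> c \<ominus>\<^bsub>Sub C\<^esub> f a = f s \<otimes>\<^bsub>B\<^esub> c \<ominus>\<^bsub>Sub B1\<^esub> f a"
      using a(1) C(2) by (intro Sub_minus[OF C(1,3)]) auto
    then show ?thesis
      using q.residue_map_eq_class_iff[of a s c] q(2) a c by simp
  qed
  have inner: "(\<forall>q\<in>C_Spec (Sub C). contraction A f q = p \<longrightarrow> Z q) \<longleftrightarrow>
    (\<forall>q. K.cprime C q \<longrightarrow> q \<inter> A1 = f ` p \<longrightarrow> Z q)" for Z
    by (simp only: Ball_def C_Spec_Sub_iff[OF C] contraction_eq_iff[OF pA])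
  have mult: "s \<otimes>\<^bsub>Sub B1\<^esub> c = s \<otimes>\<^bsub>B\<^esub> c" for s c by simp
  have bex: "(\<exists>a s. a \<in> carrier A \<and> s \<in> carrier A \<and> Q (f a) (f s)) \<longleftrightarrow>
    (\<exists>a\<in>A1. \<exists>s\<in>A1. Q a s)" for Q by blast
  have "c \<in> central_gluing A (Sub C) f p \<longleftrightarrow> c \<in> K.gluing C (f ` p)" for c
  proof -
    have "c \<in> central_gluing A (Sub C) f p \<longleftrightarrow> c \<in> C \<and>
      (\<exists>a s. a \<in> carrier A \<and> s \<in> carrier A \<and> s \<notin> p \<and> (\<forall>q\<in>C_Spec (Sub C). contraction A f q = p \<longrightarrow>
         residue_map (Sub C) q f (fraction (A Quot p) (p +>\<^bsub>A\<^esub> a) (p +>\<^bsub>A\<^esub> s))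
           = residue_class (Sub C) q c))"
      unfolding central_gluing_def carrier_residue_field[OF pp] by auto
    also have "\<dots> \<longleftrightarrow> c \<in> C \<and>
      (\<exists>a s. a \<in> carrier A \<and> s \<in> carrier A \<and> s \<notin> p \<and> (\<forall>q\<in>C_Spec (Sub C). contraction A f q = p \<longrightarrow>
         f s \<otimes>\<^bsub>B\<^esub> c \<ominus>\<^bsub>Sub B1\<^esub> f a \<in> q))"
      using res by (metis (no_types, lifting))
    also have "\<dots> \<longleftrightarrow> c \<in> C \<and>
      (\<exists>a s. a \<in> carrier A \<and> s \<in> carrier A \<and> f s \<notin> f ` p \<and> (\<forall>q. K.cprime C q \<longrightarrow> q \<inter> A1 = f ` p \<longrightarrow>
         f s \<otimes>\<^bsub>B\<^esub> c \<ominus>\<^bsub>Sub B1\<^esub> f a \<in> q))"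
      by (simp only: inner f_mem_iff[OF pA] cong: conj_cong)
    also have "\<dots> \<longleftrightarrow> c \<in> C \<and> (\<exists>a\<in>A1. \<exists>s\<in>A1. s \<notin> f ` p \<and> (\<forall>q. K.cprime C q \<longrightarrow>
        q \<inter> A1 = f ` p \<longrightarrow> s \<otimes>\<^bsub>B\<^esub> c \<ominus>\<^bsub>Sub B1\<^esub> a \<in> q))"
      by (simp only: bex[of "\<lambda>a s. s \<notin> f ` p \<and> (\<forall>q. K.cprime C q \<longrightarrow>
        q \<inter> A1 = f ` p \<longrightarrow> s \<otimes>\<^bsub>B\<^esub> c \<ominus>\<^bsub>Sub B1\<^esub> a \<in> q)"])
    also have "\<dots> \<longleftrightarrow> c \<in> K.gluing C (f ` p)"
      unfolding K.gluing_def mem_Collect_eq mult ..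
    finally show ?thesis .
  qed
  then show ?thesis by blast
qed

lemma integral_Sub:
  assumes C: "subring C B" "A1 \<subseteq> C"
  shows "integral_extension A (Sub C) f"
proof -
  interpret T: "domain" "Sub C" by (rule B.subring_is_domain[OF C(1)])
  have sub: "subring A1 (Sub C)"
  proof (rule T.subringI)
    note Ad = subringE[OF A1_subring]
    show "\<ominus>\<^bsub>Sub C\<^esub> x \<in> A1" if "x \<in> A1" for x
      using Ad(5)[OF that] B.a_inv_subring[OF C(1)] that C(2) by (metis subsetD)
  qed (use C(2) subringE[OF A1_subring] in auto)
  have "domain_extension A (Sub C) f"
    unfolding domain_extension_def
    using A.domain_axioms T.domain_axioms f_hom_Sub[OF C(2)] f_inj by blast
  moreover have "\<exists>p\<in>carrier (univ_poly (Sub C) A1). p \<noteq> [] \<and>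
      lead_coeff p = \<one>\<^bsub>Sub C\<^esub> \<and> ring.eval (Sub C) p b = \<zero>\<^bsub>Sub C\<^esub>" if b: "b \<in> C" for b
  proof -
    obtain k where "b [^]\<^bsub>B\<^esub> k \<in> power_span B A1 b k"
      using power_in_power_span b subringE(1)[OF C(1)] by blast
    then have "b [^]\<^bsub>Sub C\<^esub> k \<in> power_span (Sub C) A1 b k"
      by (simp add: power_span_update nat_pow_def)
    from T.integral_polynomial[OF sub _ this T.one_not_zero] b show ?thesis by simp
  qed
  ultimately show ?thesis by (simp add: integral_extension_def)
qed

lemma sc_subintegral_Sub:
  assumes D: "subring D B" "A1 \<subseteq> D" "D \<subseteq> B1" and s: "K.subintegral D"
  shows "sc_subintegral A (Sub D) f"
  unfolding sc_subintegral_def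
proof (intro conjI ballI)
  show "integral_extension A (Sub D) f" by (rule integral_Sub[OF D(1,2)])
  have spec: "C_Spec (Sub D) = {q. K.cprime D q}" using C_Spec_Sub_iff[OF D] by blast
  have bij: "bij_betw (\<lambda>q. q \<inter> A1) {q. K.cprime D q} {p. K.cprime A1 p}"
    using s by (simp add: K.subintegral_def)
  \<comment> \<open>Contraction to \<open>A\<close> factors through the trace on \<open>A1\<close>;
    its second half is the bijection between central primes of \<open>A1\<close> and of
    \<open>A\<close> inverse to taking images under \<open>f\<close>.\<close>
  have "bij_betw (contraction A f) {p. K.cprime A1 p} (C_Spec A)"
  proof (rule bij_betw_byWitness[where f' = "image f"])
    have fc: "f ` contraction A f p = p" if "K.cprime A1 p" for p
      using K.cprimeD(2)[OF that] contraction_image[of p] by blast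
    show "\<forall>p\<in>{p. K.cprime A1 p}. f ` contraction A f p = p"
      using fc by blast
    show "\<forall>p\<in>C_Spec A. contraction A f (f ` p) = p"
      using C_Spec_A_iff contraction_eq_iff by auto
    show "contraction A f ` {p. K.cprime A1 p} \<subseteq> C_Spec A"
    proof (intro image_subsetI)
      fix p assume p: "p \<in> {p. K.cprime A1 p}"
      then have "f ` contraction A f p = p" using fc by blast
      moreover have "contraction A f p \<subseteq> carrier A" by (auto simp: contraction_def)
      ultimately show "contraction A f p \<in> C_Spec A" using p C_Spec_A_iff by simp
    qed
    show "image f ` C_Spec A \<subseteq> {p. K.cprime A1 p}" using C_Spec_A_iff by auto
  qed
  from bij_betw_trans[OF bij this]
  have "bij_betw (contraction A f \<circ> (\<lambda>q. q \<inter> A1)) (C_Spec (Sub D)) (C_Spec A)"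
    unfolding spec .
  moreover have "contraction A f \<circ> (\<lambda>q. q \<inter> A1) = contraction A f"
    by (auto simp: contraction_def)
  ultimately show "bij_betw (contraction A f) (C_Spec (Sub D)) (C_Spec A)" by simp
  fix q assume q: "q \<in> C_Spec (Sub D)"
  interpret q: residue_extension A "Sub D" f q
    by (rule residue_extension_Sub[OF D(1,2)]) (use q in \<open>simp add: C_Spec_def\<close>)
  show "residue_map (Sub D) q f \<in> ring_iso (residue_field A (contraction A f q)) (residue_field (Sub D) q)"
  proof (rule q.residue_map_ring_iso)
    fix c assume "c \<in> carrier (Sub D)"
    moreover have "K.cprime D q" using q spec by blast
    ultimately have "\<exists>a\<in>A1. \<exists>s\<in>A1. s \<notin> q \<and> s \<otimes>\<^bsub>B\<^esub> c \<ominus>\<^bsub>Sub B1\<^esub> a \<in> q"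
      using s by (simp add: K.subintegral_def)
    then obtain a s where as: "a \<in> carrier A" "s \<in> carrier A" "f s \<notin> q"
      "f s \<otimes>\<^bsub>B\<^esub> c \<ominus>\<^bsub>Sub B1\<^esub> f a \<in> q"
      by blast
    moreover have "f s \<otimes>\<^bsub>B\<^esub> c \<ominus>\<^bsub>Sub D\<^esub> f a = f s \<otimes>\<^bsub>B\<^esub> c \<ominus>\<^bsub>Sub B1\<^esub> f a"
      using as(1) D(2) by (intro Sub_minus[OF D(1,3)]) auto
    ultimately have "f s \<otimes>\<^bsub>Sub D\<^esub> c \<ominus>\<^bsub>Sub D\<^esub> f a \<in> q" by simp
    then show "\<exists>a\<in>carrier A. \<exists>s\<in>carrier A. f s \<notin> q \<and> f s \<otimes>\<^bsub>Sub D\<^esub> c \<ominus>\<^bsub>Sub D\<^esub> f a \<in> q"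
      using as(1-3) by blast
  qed
qed

section \<open>Realness along the chain, and the chain itself\<close>

lemma real_domain_Sub_iff:
  assumes C: "subring C B"
  shows "real_domain (Sub C) \<longleftrightarrow> \<not> (\<exists>s\<in>C. s \<noteq> \<zero>\<^bsub>B\<^esub> \<and> \<ominus>\<^bsub>B\<^esub> (s \<otimes>\<^bsub>B\<^esub> s) \<in> square_sums B C)"
proof -
  interpret T: "domain" "Sub C" by (rule B.subring_is_domain[OF C])
  have "\<ominus>\<^bsub>Sub C\<^esub> (s \<otimes>\<^bsub>B\<^esub> s) = \<ominus>\<^bsub>B\<^esub> (s \<otimes>\<^bsub>B\<^esub> s)" if "s \<in> C" for s
    using B.a_inv_subring[OF C] subringE(6)[OF C that that] by simp
  then show ?thesis unfolding T.real_domain_iff square_sums_update by simp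
qed

lemma real_domain_Sub_of_B:
  assumes "real_domain B" "subring C B"
  shows "real_domain (Sub C)"
proof -
  note CB = subringE(1)[OF assms(2)]
  have "x \<in> square_sums B (carrier B)" if "x \<in> square_sums B C" for x
    by (rule square_sums_mono[OF CB that])
  then show ?thesis
    using assms(1) CB unfolding real_domain_Sub_iff[OF assms(2)] B.real_domain_iff by blast
qed

text \<open>Realness depends on the fraction field only, and \<open>C\<close> has that of
  \<open>A\<close>: failure in \<open>C\<close> would put -1 into \<open>P\<close>, which does not
  depend on \<open>C\<close>.\<close>

lemma real_domain_Sub_of_A:
  assumes "real_domain A" and C: "subring C B" "A1 \<subseteq> C" "C \<subseteq> B1"
  shows "real_domain (Sub C)"
  unfolding real_domain_Sub_iff[OF C(1)]
proof
  note Cd = subringE[OF C(1)]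
  assume "\<exists>s\<in>C. s \<noteq> \<zero>\<^bsub>B\<^esub> \<and> \<ominus>\<^bsub>B\<^esub> (s \<otimes>\<^bsub>B\<^esub> s) \<in> square_sums B C"
  then obtain s where s: "s \<in> C" "s \<noteq> \<zero>\<^bsub>B\<^esub>" "\<ominus>\<^bsub>B\<^esub> (s \<otimes>\<^bsub>B\<^esub> s) \<in> square_sums B C" by blast
  have "s \<otimes>\<^bsub>B\<^esub> s \<otimes>\<^bsub>B\<^esub> (\<ominus>\<^bsub>B\<^esub> \<one>\<^bsub>B\<^esub>) = \<ominus>\<^bsub>B\<^esub> (s \<otimes>\<^bsub>B\<^esub> s)"
    using s(1) Cd(1) by (auto simp: B.r_minus)
  then have "\<ominus>\<^bsub>B\<^esub> \<one>\<^bsub>B\<^esub> \<in> P"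
    using positive_iff[OF C(2,3) Cd(5)[OF Cd(3)]] s by auto
  then have "f (\<ominus>\<^bsub>A\<^esub> \<one>\<^bsub>A\<^esub>) \<in> P" by simp
  then obtain t where t: "t \<in> carrier A" "t \<noteq> \<zero>\<^bsub>A\<^esub>"
    "t \<otimes>\<^bsub>A\<^esub> t \<otimes>\<^bsub>A\<^esub> (\<ominus>\<^bsub>A\<^esub> \<one>\<^bsub>A\<^esub>) \<in> square_sums A (carrier A)"
    using f_in_P_iff[of "\<ominus>\<^bsub>A\<^esub> \<one>\<^bsub>A\<^esub>"] by auto
  then have "\<ominus>\<^bsub>A\<^esub> (t \<otimes>\<^bsub>A\<^esub> t) \<in> square_sums A (carrier A)" by (simp add: A.r_minus)
  then show False using assms(1) t(1,2) A.real_domain_iff by blast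
qed

lemma gluing_sequence:
  assumes "sc_normal A B f"
  shows "\<exists>n Cs. Cs 0 = B1 \<and> Cs n = A1 \<and> (\<forall>i\<le>n. subring (Cs i) B \<and> A1 \<subseteq> Cs i \<and> Cs i \<subseteq> B1) \<and>
    (\<forall>i<(n::nat). Cs (Suc i) \<subseteq> Cs i \<and>
       (\<exists>p\<in>C_Spec A. Cs (Suc i) = central_gluing A (Sub (Cs i)) f p))"
proof -
  have normal: "D \<subseteq> A1" if D: "subring D (Sub B1)" "A1 \<subseteq> D" "K.subintegral D" for D
  proof (rule ccontr)
    assume "\<not> D \<subseteq> A1"
    then have "A1 \<subset> D" using D(2) by blast
    moreover note Ds = subring_Sub_B1[OF D(1)]
    ultimately show False
      using assms sc_subintegral_Sub[OF Ds(1) D(2) Ds(2) D(3)] B.subdomainI'[OF Ds(1)]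
      unfolding sc_normal_def by blast
  qed
  have top: "subring B1 (Sub B1)" using K.carrier_is_subring by simp
  obtain n :: nat and Cs where Cs: "Cs 0 = B1" "Cs n = A1"
    "\<And>i. i < n \<Longrightarrow> \<exists>p. K.cprime A1 p \<and> Cs (Suc i) = K.gluing (Cs i) p"
    using K.gluing_sequence[OF normal top A1_B1] by blast
  have C: "subring (Cs i) (Sub B1) \<and> A1 \<subseteq> Cs i" if "i \<le> n" for i
    using that
  proof (induction i)
    case 0
    then show ?case using Cs(1) top A1_B1 by simp
  next
    case (Suc i)
    then obtain p where "K.cprime A1 p" "Cs (Suc i) = K.gluing (Cs i) p" using Cs(3)[of i] by auto
    then show ?case using K.gluing_subring[of "Cs i" p] Suc by auto
  qed
  have "Cs (Suc i) \<subseteq> Cs i \<and> (\<exists>p\<in>C_Spec A. Cs (Suc i) = central_gluing A (Sub (Cs i)) f p)"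
    if i: "i < n" for i
  proof -
    obtain p where p: "K.cprime A1 p" "Cs (Suc i) = K.gluing (Cs i) p" using Cs(3)[OF i] by blast
    let ?p = "contraction A f p"
    have "p \<subseteq> A1" using K.cprimeD(2)[OF p(1)] by blast
    then have fp: "f ` ?p = p" using contraction_image by blast
    moreover have "?p \<subseteq> carrier A" by (auto simp: contraction_def)
    ultimately have "?p \<in> C_Spec A" using p(1) C_Spec_A_iff by simp
    moreover have "Cs (Suc i) = central_gluing A (Sub (Cs i)) f ?p"
      using central_gluing_eq[OF _ _ _ \<open>?p \<in> C_Spec A\<close>, of "Cs i"] p(2) fp
        subring_Sub_B1[of "Cs i"] C[of i] i by simp
    moreover have "Cs (Suc i) \<subseteq> Cs i" unfolding p(2) by (rule K.gluing_subset)
    ultimately show ?thesis by blast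
  qed
  moreover have "subring (Cs i) B \<and> A1 \<subseteq> Cs i \<and> Cs i \<subseteq> B1" if "i \<le> n" for i
    using C[OF that] subring_Sub_B1[of "Cs i"] by blast
  ultimately show ?thesis using Cs(1,2) by (intro exI[of _ n] exI[of _ Cs]) simp
qed

end

theorem theorem6p23:
  fixes A :: "('a, 'm) ring_scheme" and B :: "('b, 'n) ring_scheme" and f :: "'a \<Rightarrow> 'b"
  assumes "contains_rat A"
    and "finite_extension A B f"
    and "noetherian_ring A"
    and "sc_normal A B f"
  shows "\<exists>(n::nat) (Bs :: nat \<Rightarrow> 'b set).
     1 \<le> n \<and>
     (\<forall>i\<le>n. subdomain (Bs i) B) \<and>
     (real_domain A \<longrightarrow> (\<forall>i. 1 \<le> i \<and> i \<le> n \<longrightarrow> real_domain (B\<lparr>carrier := Bs i\<rparr>))) \<and>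
     (real_domain B \<longrightarrow> (\<forall>i\<le>n. real_domain (B\<lparr>carrier := Bs i\<rparr>))) \<and>
     Bs n = f ` carrier A \<and> Bs 0 = carrier B \<and> (\<forall>i<n. Bs (Suc i) \<subseteq> Bs i) \<and>
     Bs 1 = birational_gluing A B f \<and>
     (\<forall>i. 1 \<le> i \<and> i < n \<longrightarrow>
        (\<exists>p \<in> C_Spec A. Bs (Suc i) = central_gluing A (B\<lparr>carrier := Bs i\<rparr>) f p))"
proof -
  interpret finite_noetherian_extension A B f
    by (rule finite_noetherian_extension.intro[OF assms(2,3)])
  obtain n Cs where h: "Cs 0 = birational_gluing A B f \<and> Cs n = f ` carrier A \<and>
    (\<forall>i\<le>n. subring (Cs i) B \<and> f ` carrier A \<subseteq> Cs i \<and> Cs i \<subseteq> birational_gluing A B f) \<and>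
    (\<forall>i<n. Cs (Suc i) \<subseteq> Cs i \<and>
       (\<exists>p\<in>C_Spec A. Cs (Suc i) = central_gluing A (B\<lparr>carrier := Cs i\<rparr>) f p))"
    using gluing_sequence[OF assms(4)] by (elim exE) (rule that)
  then have Cs: "Cs 0 = birational_gluing A B f" "Cs n = f ` carrier A"
    "\<And>i. i \<le> n \<Longrightarrow> subring (Cs i) B" "\<And>i. i \<le> n \<Longrightarrow> f ` carrier A \<subseteq> Cs i"
    "\<And>i. i \<le> n \<Longrightarrow> Cs i \<subseteq> birational_gluing A B f"
    "\<And>i. i < n \<Longrightarrow> Cs (Suc i) \<subseteq> Cs i"
    "\<And>i. i < n \<Longrightarrow> \<exists>p\<in>C_Spec A. Cs (Suc i) = central_gluing A (B\<lparr>carrier := Cs i\<rparr>) f p"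
    by simp_all
  \<comment> \<open>The gluings start at the birational gluing; the shift by one puts
    \<open>B\<close> in front, so the last index becomes \<open>Suc n\<close>.\<close>
  define Bs where "Bs = case_nat (carrier B) Cs"
  have Bs: "Bs 0 = carrier B" "\<And>i. Bs (Suc i) = Cs i" by (simp_all add: Bs_def)
  have sub: "subring (Bs i) B" if "i \<le> Suc n" for i
    using that Cs(3) B.carrier_is_subring by (cases i) (auto simp: Bs)
  show ?thesis
  proof (intro exI conjI allI impI)
    show "1 \<le> Suc n" by simp
    show "Bs (Suc n) = f ` carrier A" "Bs 0 = carrier B" "Bs 1 = birational_gluing A B f"
      using Bs Cs(1,2) by (simp_all add: Bs_def)
    fix i
    show "subdomain (Bs i) B" if "i \<le> Suc n"
      by (rule B.subdomainI'[OF sub[OF that]])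
    show "real_domain (B\<lparr>carrier := Bs i\<rparr>)" if "real_domain A" "1 \<le> i \<and> i \<le> Suc n"
      using that Cs(3,4,5) real_domain_Sub_of_A[OF that(1)] by (cases i) (auto simp: Bs)
    show "real_domain (B\<lparr>carrier := Bs i\<rparr>)" if "real_domain B" "i \<le> Suc n"
      by (rule real_domain_Sub_of_B[OF that(1) sub[OF that(2)]])
    show "Bs (Suc i) \<subseteq> Bs i" if "i < Suc n"
      using that Cs(6) subringE(1)[OF Cs(3)[of 0]] by (cases i) (auto simp: Bs)
    show "\<exists>p\<in>C_Spec A. Bs (Suc i) = central_gluing A (B\<lparr>carrier := Bs i\<rparr>) f p"
      if "1 \<le> i \<and> i < Suc n"
      using that Cs(7) by (cases i) (auto simp: Bs)
  qed
qed

end
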